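(* Let $(\mathbf{u}_0,\theta_0)\in(H^3(\mathbb{T}^2)\cap V)\times H^3(\mathbb{T}^2)$ and, for each $\alpha>0$, $(\mathbf{u}_0^\alpha,\theta_0^\alpha)\in(H^3(\mathbb{T}^2)\cap V)\times H^3(\mathbb{T}^2)$, with $\mathbf{u}_0^\alpha\to\mathbf{u}_0$ in $V$ and $\theta_0^\alpha\to\theta_0$ in $L^2(\mathbb{T}^2)$ as $\alpha\to0$. Let $(\mathbf{u},\theta)$ be the solution of $P^0_{0,0}$ with initial data $(\mathbf{u}_0,\theta_0)$ and $(\mathbf{u}^\alpha,\theta^\alpha)$ the solution of $P^\alpha_{0,0}$ with initial data $(\mathbf{u}_0^\alpha,\theta_0^\alpha)$. Suppose that for some $T_*<\infty$, $$\sup_{t\in[0,T_* )}\limsup_{\alpha\to0}\alpha^2\|\mathbf{u}^\alpha(t)\|^2>0.$$ Then the solution of $P^0_{0,0}$ becomes singular in the time interval $[0,T_* )$, i.e., it does not remain a solution bounded in $(H^3\cap V)\times H^3$ on $[0,T_* )$.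
   Context: $\mathbb{T}^2=[0,1]^2$ with periodic boundary conditions; all functions are periodic with zero spatial average. $H$, $V$ are the closures in $L^2$, $H^1$ of mean-zero divergence-free vector trigonometric polynomials; $\|\mathbf{u}\|=\|\nabla\mathbf{u}\|_{L^2}$; $((\mathbf{u},\mathbf{v}))=\sum_{i,j}\int\partial_ju^i\partial_jv^i$; $\mathbf{e}_2=(0,1)$. $P^0_{0,0}$ is the system $\partial_t\mathbf{u}+\sum_j\partial_j(u^j\mathbf{u})=-\nabla p+\theta\mathbf{e}_2$, $\nabla\cdot\mathbf{u}=0$, $\partial_t\theta+\nabla\cdot(\mathbf{u}\theta)=0$ on $\mathbb{T}^2$; for initial data in $(H^3\cap V)\times H^3$ it has a unique local-in-time solution in $C([0,T],H^3\cap V)\times C([0,T],H^3)$. $P^\alpha_{0,0}$ ($\alpha>0$) is the system $-\alpha^2\Delta\partial_t\mathbf{u}+\partial_t\mathbf{u}+\sum_j\partial_j(u^j\mathbf{u})=-\nabla p+\theta\mathbf{e}_2$, $\nabla\cdot\mathbf{u}=0$, $\partial_t\theta+\nabla\cdot(\mathbf{u}\theta)=0$, whose solution (which exists globally and is unique for such data) is understood in the weak sense: $\mathbf{u}\in C([0,T],V)$, $\partial_t\mathbf{u}\in L^\infty([0,T],V)$, $\theta\in L^\infty([0,T],L^2)\cap C_w([0,T],L^2)$, $\partial_t\theta\in L^\infty([0,T],H^{-2})$, and for all smooth periodic mean-zero test functions $\Phi$ (divergence free) and $\varphi$ vanishing at $t=T$: $-\int_0^T(\mathbf{u},\partial_s\Phi)-\alpha^2\int_0^T((\mathbf{u},\partial_s\Phi))-\sum_j\int_0^T(u^j\mathbf{u},\partial_j\Phi)=(\mathbf{u}_0^\alpha,\Phi(0))+\alpha^2((\mathbf{u}_0^\alpha,\Phi(0)))+\int_0^T(\theta\mathbf{e}_2,\Phi)$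 and $-\int_0^T(\theta,\partial_s\varphi)-\int_0^T(\theta\mathbf{u},\nabla\varphi)=(\theta_0^\alpha,\varphi(0))$. *)

theory Defs
  imports "HOL-Analysis.Analysis"
begin

text \<open>Spatial (scalar / vector) fields are represented by functions on real x real;
  only their values on the fundamental cell Tbox matter (all spatial integrals are over it).\<close>

definition Tbox :: "(real \<times> real) set" where
  "Tbox = {0..1} \<times> {0..1}"

definition Int2 :: "(real \<times> real \<Rightarrow> real) \<Rightarrow> real" where
  "Int2 f = (LINT x:Tbox|lborel. f x)"

definition in_L2 :: "(real \<times> real \<Rightarrow> real) \<Rightarrow> bool" where
  "in_L2 f \<longleftrightarrow> set_borel_measurable lborel Tbox f \<and> set_integrable lborel Tbox (\<lambda>x. (f x)\<^sup>2)"

definition fcoef :: "(real \<times> real \<Rightarrow> real) \<Rightarrow> int \<times> int \<Rightarrow> complex" where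
  "fcoef f k = (LINT x:Tbox|lborel.
      complex_of_real (f x) * cis (- 2 * pi * (of_int (fst k) * fst x + of_int (snd k) * snd x)))"

definition kweight :: "int \<times> int \<Rightarrow> real" where
  "kweight k = 4 * pi\<^sup>2 * ((of_int (fst k))\<^sup>2 + (of_int (snd k))\<^sup>2)"

definition Hs_sq :: "real \<Rightarrow> (real \<times> real \<Rightarrow> real) \<Rightarrow> real" where
  "Hs_sq s f = (\<Sum>\<^sub>\<infinity>k\<in>UNIV. kweight k powr s * (cmod (fcoef f k))\<^sup>2)"

definition in_Hs :: "real \<Rightarrow> (real \<times> real \<Rightarrow> real) \<Rightarrow> bool" where
  "in_Hs s f \<longleftrightarrow> in_L2 f \<and> fcoef f (0, 0) = 0 \<and>
      (\<lambda>k. kweight k powr s * (cmod (fcoef f k))\<^sup>2) summable_on UNIV"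

definition c1 :: "(real \<times> real \<Rightarrow> real \<times> real) \<Rightarrow> real \<times> real \<Rightarrow> real" where
  "c1 u = (\<lambda>x. fst (u x))"
definition c2 :: "(real \<times> real \<Rightarrow> real \<times> real) \<Rightarrow> real \<times> real \<Rightarrow> real" where
  "c2 u = (\<lambda>x. snd (u x))"

definition in_Hs_v :: "real \<Rightarrow> (real \<times> real \<Rightarrow> real \<times> real) \<Rightarrow> bool" where
  "in_Hs_v s u \<longleftrightarrow> in_Hs s (c1 u) \<and> in_Hs s (c2 u)"

definition Hs_sq_v :: "real \<Rightarrow> (real \<times> real \<Rightarrow> real \<times> real) \<Rightarrow> real" where
  "Hs_sq_v s u = Hs_sq s (c1 u) + Hs_sq s (c2 u)"

text \<open>V: mean-zero, divergence-free H^1 fields (Fourier description of the closure).\<close>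
definition in_V :: "(real \<times> real \<Rightarrow> real \<times> real) \<Rightarrow> bool" where
  "in_V u \<longleftrightarrow> in_Hs_v 1 u \<and>
     (\<forall>k. of_int (fst k) * fcoef (c1 u) k + of_int (snd k) * fcoef (c2 u) k = 0)"

text \<open>||u||^2 = ||grad u||^2_{L^2}\<close>
definition Vnorm_sq :: "(real \<times> real \<Rightarrow> real \<times> real) \<Rightarrow> real" where
  "Vnorm_sq u = Hs_sq_v 1 u"

text \<open>((u,v)) = sum_ij int d_j u^i d_j v^i, via Parseval\<close>
definition dinner :: "(real \<times> real \<Rightarrow> real \<times> real) \<Rightarrow> (real \<times> real \<Rightarrow> real \<times> real) \<Rightarrow> real" where
  "dinner u v = (\<Sum>\<^sub>\<infinity>k\<in>UNIV. kweight k *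
      Re (fcoef (c1 u) k * cnj (fcoef (c1 v) k) + fcoef (c2 u) k * cnj (fcoef (c2 v) k)))"

definition L2i :: "(real \<times> real \<Rightarrow> real) \<Rightarrow> (real \<times> real \<Rightarrow> real) \<Rightarrow> real" where
  "L2i f g = Int2 (\<lambda>x. f x * g x)"

definition L2iv :: "(real \<times> real \<Rightarrow> real \<times> real) \<Rightarrow> (real \<times> real \<Rightarrow> real \<times> real) \<Rightarrow> real" where
  "L2iv u v = Int2 (\<lambda>x. inner (u x) (v x))"

text \<open>C^infinity: f lies in a family of continuous functions closed under taking
  directional derivatives in every direction (i.e. all iterated directional derivatives
  exist everywhere and are continuous).\<close>
definition smooth_fun :: "('a::real_normed_vector \<Rightarrow> 'b::real_normed_vector) \<Rightarrow> bool" where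
  "smooth_fun f \<longleftrightarrow> (\<exists>S. f \<in> S \<and> (\<forall>g\<in>S. continuous_on UNIV g \<and>
      (\<forall>v. \<exists>g'\<in>S. \<forall>x. ((\<lambda>t. g (x + t *\<^sub>R v)) has_vector_derivative g' x) (at 0))))"

definition pd_t :: "(real \<times> (real \<times> real) \<Rightarrow> 'b::real_normed_vector) \<Rightarrow> real \<Rightarrow> real \<times> real \<Rightarrow> 'b" where
  "pd_t F s x = vector_derivative (\<lambda>t. F (t, x)) (at s)"
definition pd_1 :: "(real \<times> (real \<times> real) \<Rightarrow> 'b::real_normed_vector) \<Rightarrow> real \<Rightarrow> real \<times> real \<Rightarrow> 'b" where
  "pd_1 F s x = vector_derivative (\<lambda>y. F (s, (y, snd x))) (at (fst x))"
definition pd_2 :: "(real \<times> (real \<times> real) \<Rightarrow> 'b::real_normed_vector) \<Rightarrow> real \<Rightarrow> real \<times> real \<Rightarrow> 'b" where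
  "pd_2 F s x = vector_derivative (\<lambda>y. F (s, (fst x, y))) (at (snd x))"

definition periodic_st :: "(real \<times> (real \<times> real) \<Rightarrow> 'b) \<Rightarrow> bool" where
  "periodic_st F \<longleftrightarrow> (\<forall>s a b. F (s, (a + 1, b)) = F (s, (a, b)) \<and> F (s, (a, b + 1)) = F (s, (a, b)))"

definition stest :: "real \<Rightarrow> (real \<times> (real \<times> real) \<Rightarrow> real) \<Rightarrow> bool" where
  "stest T F \<longleftrightarrow> smooth_fun F \<and> periodic_st F \<and> (\<forall>s. Int2 (\<lambda>x. F (s, x)) = 0)
     \<and> (\<forall>x. F (T, x) = 0)"

definition vtest :: "real \<Rightarrow> (real \<times> (real \<times> real) \<Rightarrow> real \<times> real) \<Rightarrow> bool" where
  "vtest T F \<longleftrightarrow> smooth_fun F \<and> periodic_st F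
     \<and> (\<forall>s. Int2 (\<lambda>x. fst (F (s, x))) = 0 \<and> Int2 (\<lambda>x. snd (F (s, x))) = 0)
     \<and> (\<forall>s x. fst (pd_1 F s x) + snd (pd_2 F s x) = 0)
     \<and> (\<forall>x. F (T, x) = (0, 0))"

definition weak_eq ::
  "real \<Rightarrow> real \<Rightarrow> (real \<times> real \<Rightarrow> real \<times> real) \<Rightarrow> (real \<times> real \<Rightarrow> real)
   \<Rightarrow> (real \<Rightarrow> real \<times> real \<Rightarrow> real \<times> real) \<Rightarrow> (real \<Rightarrow> real \<times> real \<Rightarrow> real) \<Rightarrow> bool" where
  "weak_eq \<alpha> T u0 th0 u th \<longleftrightarrow>
    (\<forall>F. vtest T F \<longrightarrow>
       - (LINT s:{0..T}|lborel. L2iv (u s) (pd_t F s))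
       - \<alpha>\<^sup>2 * (LINT s:{0..T}|lborel. dinner (u s) (pd_t F s))
       - (LINT s:{0..T}|lborel. Int2 (\<lambda>x. fst (u s x) * inner (u s x) (pd_1 F s x)
                                       + snd (u s x) * inner (u s x) (pd_2 F s x)))
       = L2iv u0 (\<lambda>x. F (0, x)) + \<alpha>\<^sup>2 * dinner u0 (\<lambda>x. F (0, x))
         + (LINT s:{0..T}|lborel. Int2 (\<lambda>x. th s x * snd (F (s, x)))))
  \<and> (\<forall>\<phi>. stest T \<phi> \<longrightarrow>
       - (LINT s:{0..T}|lborel. L2i (th s) (pd_t \<phi> s))
       - (LINT s:{0..T}|lborel. Int2 (\<lambda>x. th s x * inner (u s x) (pd_1 \<phi> s x, pd_2 \<phi> s x)))
       = L2i th0 (\<lambda>x. \<phi> (0, x)))"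

definition cont_Hs_v :: "real \<Rightarrow> real \<Rightarrow> (real \<Rightarrow> real \<times> real \<Rightarrow> real \<times> real) \<Rightarrow> bool" where
  "cont_Hs_v s T u \<longleftrightarrow> (\<forall>t\<in>{0..T}.
     ((\<lambda>r. Hs_sq_v s (\<lambda>x. u r x - u t x)) \<longlongrightarrow> 0) (at t within {0..T}))"
definition cont_Hs :: "real \<Rightarrow> real \<Rightarrow> (real \<Rightarrow> real \<times> real \<Rightarrow> real) \<Rightarrow> bool" where
  "cont_Hs s T f \<longleftrightarrow> (\<forall>t\<in>{0..T}.
     ((\<lambda>r. Hs_sq s (\<lambda>x. f r x - f t x)) \<longlongrightarrow> 0) (at t within {0..T}))"

definition P0_sol :: "real \<Rightarrow> (real \<times> real \<Rightarrow> real \<times> real) \<Rightarrow> (real \<times> real \<Rightarrow> real)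
   \<Rightarrow> (real \<Rightarrow> real \<times> real \<Rightarrow> real \<times> real) \<Rightarrow> (real \<Rightarrow> real \<times> real \<Rightarrow> real) \<Rightarrow> bool" where
  "P0_sol T u0 th0 u th \<longleftrightarrow>
     (\<forall>t\<in>{0..T}. in_V (u t) \<and> in_Hs_v 3 (u t) \<and> in_Hs 3 (th t))
     \<and> cont_Hs_v 3 T u \<and> cont_Hs 3 T th \<and> weak_eq 0 T u0 th0 u th"

text \<open>Weak solution of P^alpha_{0,0} on [0,T]: u in C([0,T],V), d_t u in L^infty(V)
  (i.e. u Lipschitz into V), th in L^infty(L^2) \<inter> C_w(L^2), d_t th in L^infty(H^-2)
  (i.e. th Lipschitz into H^-2).\<close>
definition Palpha_sol :: "real \<Rightarrow> real \<Rightarrow> (real \<times> real \<Rightarrow> real \<times> real) \<Rightarrow> (real \<times> real \<Rightarrow> real)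
   \<Rightarrow> (real \<Rightarrow> real \<times> real \<Rightarrow> real \<times> real) \<Rightarrow> (real \<Rightarrow> real \<times> real \<Rightarrow> real) \<Rightarrow> bool" where
  "Palpha_sol \<alpha> T u0 th0 u th \<longleftrightarrow>
     (\<forall>t\<in>{0..T}. in_V (u t) \<and> in_Hs 0 (th t))
     \<and> cont_Hs_v 1 T u
     \<and> (\<exists>L. \<forall>s\<in>{0..T}. \<forall>t\<in>{0..T}. sqrt (Vnorm_sq (\<lambda>x. u s x - u t x)) \<le> L * \<bar>s - t\<bar>)
     \<and> (\<exists>M. \<forall>t\<in>{0..T}. Int2 (\<lambda>x. (th t x)\<^sup>2) \<le> M)
     \<and> (\<forall>g. in_L2 g \<longrightarrow> continuous_on {0..T} (\<lambda>t. L2i (th t) g))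
     \<and> (\<exists>L. \<forall>s\<in>{0..T}. \<forall>t\<in>{0..T}. sqrt (Hs_sq (-2) (\<lambda>x. th s x - th t x)) \<le> L * \<bar>s - t\<bar>)
     \<and> weak_eq \<alpha> T u0 th0 u th"

end

theory Submission
  imports Defs "HOL-Computational_Algebra.Polynomial"
begin

text \<open>
  Suppose the Euler solution \<open>(u, \<theta>)\<close> stays bounded in \<open>H\<^sup>3\<close>. Put \<open>w = u\<^sup>\<alpha> - u\<close>,
  \<open>\<eta> = \<theta>\<^sup>\<alpha> - \<theta>\<close>. The relative energy \<open>E = |w|\<^sup>2 + \<alpha>\<^sup>2 \<parallel>w\<parallel>\<^sup>2 + |\<eta>|\<^sup>2\<close> satisfies
  \<open>E' \<le> C E + D \<alpha>\<^sup>2\<close> with \<open>C\<close>, \<open>D\<close> independent of \<open>\<alpha>\<close>, and \<open>E(0)\<close> tends to \<open>0\<close>; hence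
  \<open>\<alpha>\<^sup>2 \<parallel>u\<^sup>\<alpha>(t)\<parallel>\<^sup>2\<close> tends to \<open>0\<close> at every time, against the hypothesis.

  The difficulty is that \<open>\<theta>\<^sup>\<alpha>\<close> is only a weak solution in \<open>L\<^sup>2\<close>, so \<open>\<eta>\<close> is not an admissible
  test function. Everything is done on Fourier coefficients, each of which solves an ordinary
  differential equation, and the energy is weighted by \<open>max 0 (1 - harm |k| / N)\<close>, so that only
  finitely many modes enter. For fixed \<open>\<alpha>\<close> the velocity \<open>u\<^sup>\<alpha>\<close> lies in \<open>H\<^sup>2\<close>, and this is just
  enough for the commutator of the weight with the transport by \<open>u\<^sup>\<alpha>\<close> to vanish as
  \<open>N \<rightarrow> \<infinity>\<close>: the weight varies so slowly that its increments compensate the logarithmic failure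
  of \<open>H\<^sup>2 \<subseteq> W\<^sup>1\<^sup>,\<^sup>\<infinity>\<close>.\<close>

section \<open>Parseval's identity on the torus\<close>

text \<open>The two limits have a fixed order. The \<open>H^2\<close> bound of the regularised
  velocity is obtained with constants that degenerate as \<alpha> tends to 0, but it multiplies only
  errors of size N^(-1/2). So N goes to infinity first, at fixed \<alpha>; what remains in C and D
  depends on the \<open>H^3\<close> bound M of the Euler solution alone, and \<alpha> may then tend
  to 0. The term D \<alpha>^2 arises because the Euler solution misses the regularised equation by
  \<alpha>^2 times the Laplacian of its time derivative. Paired with w, this is split by Young's
  inequality: one part is absorbed into \<alpha>^2 times the squared V norm of w, the other is
  \<alpha>^2 times the squared V norm of the time derivative, which M controls. The weight spoils
  the antisymmetry of transport. What remains is a difference of weights, multiplied by the smaller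
  of the two frequencies because the velocity is divergence free. Harmonic numbers are used in place
  of the logarithm because their increments are exactly 1/n, so the lattice sum that measures this
  remainder telescopes.\<close>

definition torus :: "(real \<times> real) measure" where
  "torus = restrict_space lborel Tbox"

definition ee :: "int \<times> int \<Rightarrow> real \<times> real \<Rightarrow> complex" where
  "ee k x = cis (2 * pi * (of_int (fst k) * fst x + of_int (snd k) * snd x))"

lemma Tbox_sets [measurable]: "Tbox \<in> sets borel"
  by (simp add: Tbox_def borel_closed closed_Times)

lemma emeasure_Tbox: "emeasure lborel Tbox = 1"
  unfolding Tbox_def lborel_prod[symmetric]
  by (subst lborel.emeasure_pair_measure_Times) simp_all

lemma space_torus [simp]: "space torus = Tbox"
  by (simp add: torus_def space_restrict_space)

interpretation torus: finite_measure torus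
proof
  show "emeasure torus (space torus) \<noteq> \<infinity>"
    unfolding space_torus torus_def by (subst emeasure_restrict_space) (simp_all add: emeasure_Tbox)
qed

lemma measurable_torus: "f \<in> borel_measurable borel \<Longrightarrow> f \<in> borel_measurable torus"
  unfolding torus_def by (intro measurable_restrict_space1) simp

lemma Int2_torus: "Int2 f = (LINT x|torus. f x)"
  unfolding Int2_def torus_def set_lebesgue_integral_def
  by (subst integral_restrict_space) simp_all

lemma fcoef_torus: "fcoef f k = (LINT x|torus. complex_of_real (f x) * cnj (ee k x))"
  unfolding fcoef_def torus_def set_lebesgue_integral_def ee_def
  by (subst integral_restrict_space) (simp_all add: cis_cnj)

lemma in_L2_torus: "in_L2 f \<longleftrightarrow> f \<in> borel_measurable torus \<and> integrable torus (\<lambda>x. (f x)\<^sup>2)"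
  unfolding in_L2_def torus_def set_borel_measurable_def set_integrable_def
  by (subst borel_measurable_restrict_space_iff integrable_restrict_space; simp)+

lemma ee_measurable [measurable]: "ee k \<in> borel_measurable torus"
  unfolding ee_def cis_conv_exp
  by (intro measurable_torus borel_measurable_continuous_onI continuous_intros)

lemma measure_torus [simp]: "measure torus Tbox = 1"
  unfolding torus_def by (subst measure_restrict_space) (simp_all add: measure_def emeasure_Tbox)

lemma norm_ee [simp]: "norm (ee k x) = 1"
  by (simp add: ee_def)

lemma ee_add: "ee (k + l) x = ee k x * ee l x"
  by (simp add: ee_def cis_mult algebra_simps)

lemma ee_0 [simp]: "ee 0 x = 1"
  by (simp add: ee_def)

lemma ee_uminus: "ee (- k) x = cnj (ee k x)"
  by (simp add: ee_def cis_cnj algebra_simps)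

lemma integrable_bounded_torus:
  fixes f :: "real \<times> real \<Rightarrow> 'b::{banach, second_countable_topology}"
  assumes [measurable]: "f \<in> borel_measurable torus" and "\<And>x. x \<in> Tbox \<Longrightarrow> norm (f x) \<le> B"
  shows "integrable torus f"
  by (rule torus.integrable_const_bound[where B = B]) (use assms in auto)

lemma integral_cis_period:
  "(LINT x:{0..1}|lborel. cis (2 * pi * (of_int n * x))) = (if n = 0 then 1 else 0)"
proof (cases "n = 0")
  case False
  let ?c = "\<i> * (2 * complex_of_real pi * of_int n)"
  have "((\<lambda>x. exp (?c * of_real x)) has_integral exp (?c * of_real 1) / ?c - exp (?c * of_real 0) / ?c) {0..1}"
  proof (intro fundamental_theorem_of_calculus)
    fix x :: real
    have "((\<lambda>z. exp (?c * z) / ?c) has_field_derivative exp (?c * of_real x)) (at (of_real x))"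
      using False by (auto intro!: derivative_eq_intros simp: field_simps)
    thus "((\<lambda>x. exp (?c * of_real x) / ?c) has_vector_derivative exp (?c * of_real x)) (at x within {0..1})"
      by (rule has_vector_derivative_real_field)
  qed simp
  moreover have "exp (?c * of_real x) = cis (2 * pi * (of_int n * x))" for x :: real
    by (simp add: cis_conv_exp mult.assoc)
  moreover have "cis (2 * pi * (of_int n * 1)) = 1"
    using cis_multiple_2pi[of "of_int n"] by (simp add: mult_ac)
  moreover have "cis (2 * pi * (of_int n * 0)) = 1"
    by simp
  ultimately have *: "((\<lambda>x. cis (2 * pi * (of_int n * x))) has_integral 0) {0..1}"
    by (simp only: diff_self)
  have "set_integrable lborel {0..1} (\<lambda>x. cis (2 * pi * (of_int n * x)))"
    by (intro borel_integrable_atLeastAtMost') (simp add: cis_conv_exp continuous_intros)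
  from set_borel_integral_eq_integral(2)[OF this] * show ?thesis
    using False by (simp add: integral_unique)
qed (simp add: set_lebesgue_integral_def)

text \<open>Once the indicator of the cell is split into two interval indicators, the integrand is a
  product of functions of one coordinate each, and Fubini reduces the orthogonality of the
  characters to one dimension.\<close>

lemma integral_ee: "(LINT x|torus. ee k x) = (if k = 0 then 1 else 0)"
proof -
  let ?f = "\<lambda>n x. cis (2 * pi * (of_int n * x)) :: complex"
  have "(LINT x|torus. ee k x) = (LINT x|(lborel \<Otimes>\<^sub>M lborel). 
     (indicator {0..1} (fst x) *\<^sub>R ?f (fst k) (fst x)) * (indicator {0..1} (snd x) *\<^sub>R ?f (snd k) (snd x)))"
    unfolding torus_def lborel_prod
    by (subst integral_restrict_space, simp, intro Bochner_Integration.integral_cong refl)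
       (auto simp: Tbox_def ee_def cis_mult indicator_def algebra_simps)
  also have "\<dots> = (LINT x:{0..1}|lborel. ?f (fst k) x) * (LINT x:{0..1}|lborel. ?f (snd k) x)"
    unfolding set_lebesgue_integral_def
  proof (subst lborel_pair.integral_fst'[symmetric])
    have "integrable torus (ee k)" by (rule integrable_bounded_torus[where B = 1]) simp_all
    hence "integrable lborel (\<lambda>x. indicator Tbox x *\<^sub>R ee k x)"
      unfolding torus_def by (subst (asm) integrable_restrict_space) simp_all
    also have "(\<lambda>x. indicator Tbox x *\<^sub>R ee k x) = (\<lambda>x. (indicator {0..1} (fst x) *\<^sub>R ?f (fst k) (fst x)) * (indicator {0..1} (snd x) *\<^sub>R ?f (snd k) (snd x)))"
      by (auto simp: Tbox_def ee_def cis_mult indicator_def algebra_simps)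
    finally show "integrable (lborel \<Otimes>\<^sub>M lborel) (\<lambda>x. (indicator {0..1} (fst x) *\<^sub>R ?f (fst k) (fst x)) * (indicator {0..1} (snd x) *\<^sub>R ?f (snd k) (snd x)))"
      unfolding lborel_prod .
  qed (simp only: fst_conv snd_conv integral_mult_right_zero integral_mult_left_zero)
  also have "\<dots> = (if k = 0 then 1 else 0)"
    by (auto simp: integral_cis_period prod_eq_iff)
  finally show ?thesis .
qed

lemma in_L2_imp_integrable: "in_L2 f \<Longrightarrow> integrable torus f"
  unfolding in_L2_torus
  by (rule torus.square_integrable_imp_integrable) auto

lemma integrable_mult_L2:
  assumes "in_L2 f" "in_L2 g" shows "integrable torus (\<lambda>x. f x * g x)"
proof (rule Bochner_Integration.integrable_bound)
  show "integrable torus (\<lambda>x. (f x)\<^sup>2 + (g x)\<^sup>2)" using assms by (simp add: in_L2_torus)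
  show "(\<lambda>x. f x * g x) \<in> borel_measurable torus" using assms by (intro borel_measurable_times) (simp_all add: in_L2_torus)
  show "AE x in torus. norm (f x * g x) \<le> norm ((f x)\<^sup>2 + (g x)\<^sup>2)"
  proof (intro AE_I2)
    fix x
    have "0 \<le> (\<bar>f x\<bar> - \<bar>g x\<bar>)\<^sup>2" "0 \<le> \<bar>f x\<bar> * \<bar>g x\<bar>" by simp_all
    hence "\<bar>f x\<bar> * \<bar>g x\<bar> \<le> (f x)\<^sup>2 + (g x)\<^sup>2"
      unfolding power2_diff power2_abs by linarith
    thus "norm (f x * g x) \<le> norm ((f x)\<^sup>2 + (g x)\<^sup>2)" by (simp add: abs_mult)
  qed
qed

lemma in_L2_mult_bounded:
  assumes "in_L2 f" "g \<in> borel_measurable torus" "\<And>x. \<bar>g x\<bar> \<le> B"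
  shows "in_L2 (\<lambda>x. f x * g x)"
  unfolding in_L2_torus
proof
  have [measurable]: "f \<in> borel_measurable torus" using assms by (simp add: in_L2_torus)
  note [measurable] = assms(2)
  show "(\<lambda>x. f x * g x) \<in> borel_measurable torus" by simp
  show "integrable torus (\<lambda>x. (f x * g x)\<^sup>2)"
  proof (rule Bochner_Integration.integrable_bound)
    show "integrable torus (\<lambda>x. B\<^sup>2 * (f x)\<^sup>2)" using assms by (simp add: in_L2_torus)
    show "AE x in torus. norm ((f x * g x)\<^sup>2) \<le> norm (B\<^sup>2 * (f x)\<^sup>2)"
    proof (intro AE_I2)
      fix x
      have "(g x)\<^sup>2 \<le> B\<^sup>2" using power_mono[OF assms(3)[of x] abs_ge_zero, of 2] by simp
      thus "norm ((f x * g x)\<^sup>2) \<le> norm (B\<^sup>2 * (f x)\<^sup>2)"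
        by (simp add: power_mult_distrib mult.commute[of "(f x)\<^sup>2"] mult_right_mono)
    qed
  qed simp
qed

lemma in_L2_cmult: "in_L2 f \<Longrightarrow> in_L2 (\<lambda>x. c * f x)"
  unfolding in_L2_torus power_mult_distrib by (intro conjI borel_measurable_times) simp_all

lemma in_L2_add:
  assumes "in_L2 f" "in_L2 g" shows "in_L2 (\<lambda>x. f x + g x)"
  using assms integrable_mult_L2[OF assms] unfolding in_L2_torus
  by (intro conjI borel_measurable_add) (simp_all add: power2_sum mult.assoc)

lemma in_L2_diff:
  assumes "in_L2 f" "in_L2 g" shows "in_L2 (\<lambda>x. f x - g x)"
  using in_L2_add[OF assms(1) in_L2_cmult[OF assms(2), of "-1"]] by simp

lemma integrable_mult_ee:
  assumes "integrable torus f" shows "integrable torus (\<lambda>x. complex_of_real (f x) * cnj (ee k x))"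
proof (rule Bochner_Integration.integrable_bound)
  show "(\<lambda>x. complex_of_real (f x) * cnj (ee k x)) \<in> borel_measurable torus" 
    using borel_measurable_integrable[OF assms] 
    by (intro borel_measurable_times borel_measurable_of_real) (simp_all add: ee_uminus[symmetric])
qed (use assms in \<open>auto simp: norm_mult\<close>)

lemma fcoef_uminus_index: "fcoef f (- k) = cnj (fcoef f k)"
  unfolding fcoef_torus using Bochner_Integration.integral_cnj[of torus "\<lambda>x. complex_of_real (f x) * cnj (ee k x)"]
  by (simp add: ee_uminus)

lemma fcoef_add:
  assumes "integrable torus f" "integrable torus g"
  shows "fcoef (\<lambda>x. f x + g x) k = fcoef f k + fcoef g k"
  using assms unfolding fcoef_torus
  by (simp add: algebra_simps integrable_mult_ee Bochner_Integration.integral_add)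

lemma fcoef_cmult: "fcoef (\<lambda>x. c * f x) k = of_real c * fcoef f k"
  unfolding fcoef_torus by (simp add: mult.assoc)

lemma fcoef_diff:
  assumes "integrable torus f" "integrable torus g"
  shows "fcoef (\<lambda>x. f x - g x) k = fcoef f k - fcoef g k"
  using assms unfolding fcoef_torus
  by (simp add: algebra_simps integrable_mult_ee Bochner_Integration.integral_diff)

section \<open>Trigonometric polynomials and Bessel's inequality\<close>

definition trig_poly :: "(int \<times> int) set \<Rightarrow> (int \<times> int \<Rightarrow> complex) \<Rightarrow> real \<times> real \<Rightarrow> complex" where
  "trig_poly F c x = (\<Sum>k\<in>F. c k * ee k x)"

lemma ee_mult_cnj: "ee k x * cnj (ee l x) = ee (k - l) x"
  using ee_add[of k "- l" x] by (simp add: ee_uminus)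

text \<open>Expand the square; orthogonality leaves the diagonal, and completing the square in the
  coefficients does the rest. The choice \<open>c = fcoef f\<close> yields Bessel's inequality, and
  a general \<open>c\<close> shows that the Fourier coefficients approximate best, which is the
  other half of Parseval's identity.\<close>

lemma L2_dist_trig_poly:
  assumes f: "in_L2 f" and F: "finite F"
  shows "(LINT x|torus. (norm (of_real (f x) - trig_poly F c x))\<^sup>2)
     = Int2 (\<lambda>x. (f x)\<^sup>2) - (\<Sum>k\<in>F. (norm (fcoef f k))\<^sup>2) + (\<Sum>k\<in>F. (norm (fcoef f k - c k))\<^sup>2)"
proof -
  let ?P = "trig_poly F c"
  have int_f: "integrable torus f" using f by (rule in_L2_imp_integrable)
  have i1: "integrable torus (\<lambda>x. complex_of_real ((f x)\<^sup>2))"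
    using f unfolding in_L2_torus by (intro integrable_of_real) simp
  have i2: "integrable torus (\<lambda>x. \<Sum>k\<in>F. cnj (c k) * (complex_of_real (f x) * cnj (ee k x)))"
    by (intro Bochner_Integration.integrable_sum integrable_mult_right integrable_mult_ee int_f)
  hence i3: "integrable torus (\<lambda>x. cnj (\<Sum>k\<in>F. cnj (c k) * (complex_of_real (f x) * cnj (ee k x))))"
    by (rule Bochner_Integration.integrable_cnj)
  have int_ee: "integrable torus (ee k)" for k
    by (rule integrable_bounded_torus[where B = 1]) simp_all
  have i4: "integrable torus (\<lambda>x. \<Sum>k\<in>F. \<Sum>l\<in>F. c k * cnj (c l) * ee (k - l) x)"
    by (intro Bochner_Integration.integrable_sum integrable_mult_right int_ee)
  have eq: "complex_of_real ((norm (of_real (f x) - ?P x))\<^sup>2) =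
      complex_of_real ((f x)\<^sup>2) - (\<Sum>k\<in>F. cnj (c k) * (complex_of_real (f x) * cnj (ee k x)))
      - cnj (\<Sum>k\<in>F. cnj (c k) * (complex_of_real (f x) * cnj (ee k x)))
      + (\<Sum>k\<in>F. \<Sum>l\<in>F. c k * cnj (c l) * ee (k - l) x)" for x
  proof -
    have "?P x * cnj (?P x) = (\<Sum>k\<in>F. \<Sum>l\<in>F. c k * cnj (c l) * ee (k - l) x)"
      unfolding trig_poly_def cnj_sum sum_product
      by (intro sum.cong refl) (simp add: ee_mult_cnj[symmetric])
    thus ?thesis
      unfolding complex_norm_square
      by (simp add: algebra_simps trig_poly_def sum_distrib_left power2_eq_square)
  qed
  have "complex_of_real (LINT x|torus. (norm (of_real (f x) - ?P x))\<^sup>2)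
     = (LINT x|torus. complex_of_real ((norm (of_real (f x) - ?P x))\<^sup>2))"
    unfolding integral_complex_of_real ..
  also have "\<dots> = complex_of_real (Int2 (\<lambda>x. (f x)\<^sup>2)) - (\<Sum>k\<in>F. cnj (c k) * fcoef f k)
     - cnj (\<Sum>k\<in>F. cnj (c k) * fcoef f k) + (\<Sum>k\<in>F. \<Sum>l\<in>F. c k * cnj (c l) * (if k - l = 0 then 1 else 0))"
  proof -
    have J2: "(LINT x|torus. (\<Sum>k\<in>F. cnj (c k) * (complex_of_real (f x) * cnj (ee k x)))) = (\<Sum>k\<in>F. cnj (c k) * fcoef f k)"
      unfolding fcoef_torus
      by (subst Bochner_Integration.integral_sum)
         (auto intro!: integrable_mult_right integrable_mult_ee int_f)
    have J4: "(LINT x|torus. (\<Sum>k\<in>F. \<Sum>l\<in>F. c k * cnj (c l) * ee (k - l) x)) = (\<Sum>k\<in>F. \<Sum>l\<in>F. c k * cnj (c l) * (if k - l = 0 then 1 else 0))"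
    proof (subst Bochner_Integration.integral_sum)
      show "(\<Sum>k\<in>F. (LINT x|torus. (\<Sum>l\<in>F. c k * cnj (c l) * ee (k - l) x))) = (\<Sum>k\<in>F. \<Sum>l\<in>F. c k * cnj (c l) * (if k - l = 0 then 1 else 0))"
        by (subst Bochner_Integration.integral_sum) (simp_all add: integral_ee int_ee)
    qed (intro Bochner_Integration.integrable_sum integrable_mult_right int_ee)
    show ?thesis
      unfolding eq
      apply (subst Bochner_Integration.integral_add, (intro Bochner_Integration.integrable_diff i1 i2 i3 i4)+)
      apply (subst Bochner_Integration.integral_diff, (intro Bochner_Integration.integrable_diff i1 i2 i3)+)
      apply (subst Bochner_Integration.integral_diff, (intro i1 i2)+)
      apply (subst Bochner_Integration.integral_cnj)
      unfolding J2 J4 Int2_torus integral_complex_of_real ..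
  qed
  also have "(\<Sum>k\<in>F. \<Sum>l\<in>F. c k * cnj (c l) * (if k - l = 0 then 1 else 0)) = (\<Sum>k\<in>F. c k * cnj (c k))"
    using F by (intro sum.cong refl) (simp add: if_distrib[of "\<lambda>x. _ * x"] cong: if_cong)
  also have "complex_of_real (Int2 (\<lambda>x. (f x)\<^sup>2)) - (\<Sum>k\<in>F. cnj (c k) * fcoef f k)
     - cnj (\<Sum>k\<in>F. cnj (c k) * fcoef f k) + (\<Sum>k\<in>F. c k * cnj (c k))
     = complex_of_real (Int2 (\<lambda>x. (f x)\<^sup>2) - (\<Sum>k\<in>F. (norm (fcoef f k))\<^sup>2) + (\<Sum>k\<in>F. (norm (fcoef f k - c k))\<^sup>2))"
    unfolding of_real_add of_real_diff of_real_sum complex_norm_square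
    by (simp add: algebra_simps sum.distrib sum_subtractf)
  finally show ?thesis unfolding of_real_eq_iff .
qed

lemma Bessel:
  assumes "in_L2 f" "finite F"
  shows "(\<Sum>k\<in>F. (norm (fcoef f k))\<^sup>2) \<le> Int2 (\<lambda>x. (f x)\<^sup>2)"
proof -
  have "0 \<le> (LINT x|torus. (norm (of_real (f x) - trig_poly F (fcoef f) x))\<^sup>2)" by simp
  thus ?thesis unfolding L2_dist_trig_poly[OF assms] by simp
qed

definition trig_polynomial :: "(real \<times> real \<Rightarrow> complex) \<Rightarrow> bool" where
  "trig_polynomial P \<longleftrightarrow> (\<exists>F c. finite F \<and> P = trig_poly F c)"

lemma trig_polynomial_monom: "trig_polynomial (\<lambda>x. c * ee k x)"
  unfolding trig_polynomial_def trig_poly_def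
  by (intro exI[of _ "{k}"] exI[of _ "\<lambda>_. c"]) auto

lemma trig_polynomial_add:
  assumes "trig_polynomial P" "trig_polynomial Q"
  shows "trig_polynomial (\<lambda>x. P x + Q x)"
proof -
  obtain F c G d where F: "finite F" "P = trig_poly F c" and G: "finite G" "Q = trig_poly G d"
    using assms unfolding trig_polynomial_def by blast
  have "P x + Q x = trig_poly (F \<union> G) (\<lambda>k. (if k \<in> F then c k else 0) + (if k \<in> G then d k else 0)) x" for x
  proof -
    have "P x = (\<Sum>k\<in>F\<union>G. (if k \<in> F then c k else 0) * ee k x)"
      unfolding F(2) trig_poly_def using F(1) G(1) by (intro sum.mono_neutral_cong_left) auto
    moreover have "Q x = (\<Sum>k\<in>F\<union>G. (if k \<in> G then d k else 0) * ee k x)"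
      unfolding G(2) trig_poly_def using F(1) G(1) by (intro sum.mono_neutral_cong_left) auto
    ultimately show ?thesis
      by (simp only: trig_poly_def sum.distrib distrib_right)
  qed
  hence "(\<lambda>x. P x + Q x) = trig_poly (F \<union> G) (\<lambda>k. (if k \<in> F then c k else 0) + (if k \<in> G then d k else 0))"
    by (rule ext)
  thus ?thesis unfolding trig_polynomial_def using F(1) G(1)
    by (intro exI conjI) (auto intro: finite_UnI)
qed

lemma trig_polynomial_sum:
  "finite I \<Longrightarrow> (\<And>i. i \<in> I \<Longrightarrow> trig_polynomial (P i)) \<Longrightarrow> trig_polynomial (\<lambda>x. \<Sum>i\<in>I. P i x)"
proof (induction I rule: finite_induct)
  case empty
  show ?case using trig_polynomial_monom[of 0 0] by simp
next
  case (insert i I)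
  thus ?case using trig_polynomial_add[of "P i" "\<lambda>x. \<Sum>i\<in>I. P i x"] by simp
qed

lemma trig_polynomial_mult:
  assumes "trig_polynomial P" "trig_polynomial Q"
  shows "trig_polynomial (\<lambda>x. P x * Q x)"
proof -
  obtain F c G d where F: "finite F" "P = trig_poly F c" and G: "finite G" "Q = trig_poly G d"
    using assms unfolding trig_polynomial_def by blast
  have "(\<lambda>x. P x * Q x) = (\<lambda>x. \<Sum>k\<in>F. \<Sum>l\<in>G. (c k * d l) * ee (k + l) x)"
    unfolding F(2) G(2) trig_poly_def sum_product ee_add by (intro ext sum.cong refl) (simp only: mult_ac)
  moreover have "trig_polynomial \<dots>"
    by (intro trig_polynomial_sum F(1) G(1) trig_polynomial_monom)
  ultimately show ?thesis by simp
qed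

text \<open>This carries the Stone-Weierstrass theorem over from the product of two circles. Only
  the linear case has content: a real-linear functional of (z, w) is a combination of z, w and their
  conjugates, and conjugating a character negates its frequency.\<close>

lemma trig_polynomial_real_polynomial_function:
  fixes g :: "complex \<times> complex \<Rightarrow> real"
  assumes "real_polynomial_function g"
  shows "trig_polynomial (\<lambda>x. of_real (g (ee (1,0) x, ee (0,1) x)))"
  using assms
proof (induction rule: real_polynomial_function.induct)
  case (linear h)
  interpret h: bounded_linear h by fact
  define p q r t where pq: "p = h (1,0)" "q = h (\<i>,0)" "r = h (0,1)" "t = h (0,\<i>)"
  have h: "h (z, w) = Re z * p + Im z * q + Re w * r + Im w * t" for z w
  proof -
    have "(z, w) = Re z *\<^sub>R (1,0) + Im z *\<^sub>R (\<i>,0) + Re w *\<^sub>R (0,1) + Im w *\<^sub>R (0,\<i>)"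
      by (simp add: complex_eq_iff)
    thus ?thesis unfolding pq by (simp only: h.add h.scaleR real_scaleR_def)
  qed
  have *: "complex_of_real (h (z, w)) = ((p - \<i> * q) / 2 * z + (p + \<i> * q) / 2 * cnj z)
     + ((r - \<i> * t) / 2 * w + (r + \<i> * t) / 2 * cnj w)" for z w
    unfolding h by (simp add: complex_eq_iff) (simp add: field_simps)?
  have **: "(\<lambda>x. complex_of_real (h (ee (1,0) x, ee (0,1) x))) = (\<lambda>x. 
     ((p - \<i> * q) / 2 * ee (1,0) x + (p + \<i> * q) / 2 * ee (-(1,0)) x)
     + ((r - \<i> * t) / 2 * ee (0,1) x + (r + \<i> * t) / 2 * ee (-(0,1)) x))"
    unfolding ee_uminus by (rule ext) (rule *)
  show ?case unfolding ** by (intro trig_polynomial_add trig_polynomial_monom)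
next
  case (const c)
  show ?case using trig_polynomial_monom[of c 0] by simp
next
  case (add f g)
  from trig_polynomial_add[OF add.IH] show ?case by (simp only: of_real_add)
next
  case (mult f g)
  from trig_polynomial_mult[OF mult.IH] show ?case by (simp only: of_real_mult)
qed

text \<open>A function vanishing on the boundary of the cell factors continuously through the
  quotient map of the cell onto the product of two circles, because the cell is compact.\<close>
lemma trig_polynomial_dense_uniform:
  fixes h :: "real \<times> real \<Rightarrow> real"
  assumes h: "continuous_on Tbox h" and "e > 0"
    and bd: "\<And>x. x \<in> Tbox \<Longrightarrow> fst x \<in> {0,1} \<or> snd x \<in> {0,1} \<Longrightarrow> h x = 0"
  obtains P where "trig_polynomial P" "\<And>x. x \<in> Tbox \<Longrightarrow> norm (of_real (h x) - P x) < e"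
proof -
  define E where "E = (\<lambda>x. (ee (1,0) x, ee (0,1) x))"
  define H where "H p = h (SOME x. x \<in> Tbox \<and> E x = p)" for p
  have cis_inj: "s = t \<or> s \<in> {0,1} \<and> t \<in> {0,1}" if "cis (2 * pi * s) = cis (2 * pi * t)" "s \<in> {0..1}" "t \<in> {0..1}" for s t :: real
  proof -
    have "sin (2 * pi * s) = sin (2 * pi * t) \<and> cos (2 * pi * s) = cos (2 * pi * t)"
      using that(1) by (simp add: complex_eq_iff)
    then obtain n :: int where "2 * pi * s = 2 * pi * t + 2 * pi * n"
      unfolding sin_cos_eq_iff by auto
    hence "2 * pi * (s - t) = 2 * pi * n" by (simp add: algebra_simps)
    hence n: "s - t = n" by simp
    hence "n = 0 \<or> n = 1 \<or> n = -1" using that(2,3) by auto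
    thus ?thesis using n that(2,3) by auto
  qed
  have HE: "H (E x) = h x" if x: "x \<in> Tbox" for x
  proof -
    define y where "y = (SOME y. y \<in> Tbox \<and> E y = E x)"
    have y: "y \<in> Tbox \<and> E y = E x" unfolding y_def by (rule someI[of _ x]) (use x in auto)
    have "cis (2 * pi * fst y) = cis (2 * pi * fst x)" "cis (2 * pi * snd y) = cis (2 * pi * snd x)"
      "fst y \<in> {0..1}" "snd y \<in> {0..1}" "fst x \<in> {0..1}" "snd x \<in> {0..1}"
      using y x by (simp_all add: E_def ee_def Tbox_def mem_Times_iff)
    note cis_inj[OF this(1,3,5)] cis_inj[OF this(2,4,6)]
    hence "y = x \<or> (fst y \<in> {0,1} \<and> fst x \<in> {0,1}) \<or> (snd y \<in> {0,1} \<and> snd x \<in> {0,1})"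
      by (auto simp: prod_eq_iff)
    thus ?thesis using bd[of x] bd[of y] x y unfolding H_def y_def[symmetric] by metis
  qed
  have comp: "compact Tbox" by (simp add: Tbox_def compact_Times)
  have contE: "continuous_on Tbox E"
    unfolding E_def ee_def cis_conv_exp by (intro continuous_intros)
  have "continuous_on (E ` Tbox) H"
    unfolding continuous_on_closed_vimage[OF compact_imp_closed[OF compact_continuous_image[OF contE comp]]]
  proof (intro allI impI)
    fix B :: "real set" assume "closed B"
    hence "closed (h -` B \<inter> Tbox)"
      using h continuous_on_closed_vimage[OF compact_imp_closed[OF comp]] by blast
    hence "compact (h -` B \<inter> Tbox)" 
      using compact_Int_closed[OF comp, of "h -` B \<inter> Tbox"] by (simp add: Int_absorb1 Int_commute)
    hence "compact (E ` (h -` B \<inter> Tbox))"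
      by (intro compact_continuous_image continuous_on_subset[OF contE]) auto
    moreover have "E ` (h -` B \<inter> Tbox) = H -` B \<inter> E ` Tbox"
      using HE by auto
    ultimately show "closed (H -` B \<inter> E ` Tbox)" using compact_imp_closed by metis
  qed
  then obtain g where g: "real_polynomial_function g" "\<And>p. p \<in> E ` Tbox \<Longrightarrow> \<bar>H p - g p\<bar> < e"
    using Stone_Weierstrass_real_polynomial_function[OF compact_continuous_image[OF contE comp]] \<open>e > 0\<close> by metis
  show ?thesis
  proof (rule that[OF trig_polynomial_real_polynomial_function[OF g(1)]])
    fix x assume "x \<in> Tbox"
    thus "norm (of_real (h x) - complex_of_real (g (ee (1,0) x, ee (0,1) x))) < e"
      using g(2)[of "E x"] HE[of x] unfolding of_real_diff[symmetric] norm_of_real by (simp add: E_def)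
  qed
qed

lemma trig_polynomial_measurable:
  assumes "trig_polynomial P" shows "P \<in> borel_measurable torus"
proof -
  obtain F c where "P = trig_poly F c" using assms unfolding trig_polynomial_def by blast
  thus ?thesis unfolding trig_poly_def
    by (simp only:) (intro borel_measurable_sum borel_measurable_times borel_measurable_const ee_measurable)
qed

lemma trig_polynomial_bounded:
  assumes "trig_polynomial P" obtains C where "\<And>x. norm (P x) \<le> C"
proof -
  obtain F c where P: "P = trig_poly F c" using assms unfolding trig_polynomial_def by blast
  have "norm (P x) \<le> (\<Sum>k\<in>F. norm (c k))" for x
    unfolding P trig_poly_def by (rule order_trans[OF norm_sum]) (simp add: norm_mult)
  thus ?thesis by (rule that)
qed

section \<open>Density of trigonometric polynomials in L^2\<close>

lemma L2_approx_step:
  assumes f: "in_L2 f" and g: "in_L2 g" and P: "trig_polynomial P"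
  shows "(LINT x|torus. (norm (of_real (f x) - P x))\<^sup>2)
    \<le> 2 * (LINT x|torus. (f x - g x)\<^sup>2) + 2 * (LINT x|torus. (norm (of_real (g x) - P x))\<^sup>2)"
proof -
  obtain C where C: "\<And>x. norm (P x) \<le> C" using trig_polynomial_bounded[OF P] by blast
  have sq: "(a + b)\<^sup>2 \<le> 2 * a\<^sup>2 + 2 * b\<^sup>2" for a b :: real
    using sum_squares_bound[of a b] by (simp add: power2_sum)
  have int: "integrable torus (\<lambda>x. (norm (complex_of_real (h x) - P x))\<^sup>2)" if h: "in_L2 h" for h
  proof (rule Bochner_Integration.integrable_bound)
    show "integrable torus (\<lambda>x. 2 * (h x)\<^sup>2 + 2 * C\<^sup>2)" using h by (simp add: in_L2_torus)
    have [measurable]: "h \<in> borel_measurable torus" using h by (simp add: in_L2_torus)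
    note [measurable] = trig_polynomial_measurable[OF P]
    show "(\<lambda>x. (norm (complex_of_real (h x) - P x))\<^sup>2) \<in> borel_measurable torus" by measurable
    show "AE x in torus. norm ((norm (complex_of_real (h x) - P x))\<^sup>2) \<le> norm (2 * (h x)\<^sup>2 + 2 * C\<^sup>2)"
    proof (intro AE_I2)
      fix x
      have "norm (complex_of_real (h x) - P x) \<le> \<bar>h x\<bar> + C"
        using norm_triangle_ineq4[of "complex_of_real (h x)" "P x"] C[of x] by simp
      hence "(norm (complex_of_real (h x) - P x))\<^sup>2 \<le> (\<bar>h x\<bar> + C)\<^sup>2" by (rule power_mono) simp
      also have "\<dots> \<le> 2 * (h x)\<^sup>2 + 2 * C\<^sup>2" using sq[of "\<bar>h x\<bar>" C] by simp
      finally show "norm ((norm (complex_of_real (h x) - P x))\<^sup>2) \<le> norm (2 * (h x)\<^sup>2 + 2 * C\<^sup>2)" by simp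
    qed
  qed
  have "integrable torus (\<lambda>x. (f x - g x)\<^sup>2)" using in_L2_diff[OF f g] by (simp add: in_L2_torus)
  note ints = this int[OF f] int[OF g]
  have "(LINT x|torus. (norm (of_real (f x) - P x))\<^sup>2)
     \<le> (LINT x|torus. 2 * (f x - g x)\<^sup>2 + 2 * (norm (complex_of_real (g x) - P x))\<^sup>2)"
  proof (intro integral_mono)
    fix x
    have "norm (complex_of_real (f x) - P x) \<le> \<bar>f x - g x\<bar> + norm (complex_of_real (g x) - P x)"
      using norm_triangle_ineq[of "complex_of_real (f x - g x)" "of_real (g x) - P x"]
      unfolding norm_of_real by simp
    hence "(norm (complex_of_real (f x) - P x))\<^sup>2 \<le> (\<bar>f x - g x\<bar> + norm (complex_of_real (g x) - P x))\<^sup>2"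
      by (rule power_mono) simp
    also have "\<dots> \<le> 2 * (f x - g x)\<^sup>2 + 2 * (norm (complex_of_real (g x) - P x))\<^sup>2"
      using sq[of "\<bar>f x - g x\<bar>"] by simp
    finally show "(norm (complex_of_real (f x) - P x))\<^sup>2 \<le> 2 * (f x - g x)\<^sup>2 + 2 * (norm (complex_of_real (g x) - P x))\<^sup>2" .
  qed (use ints in auto)
  thus ?thesis using ints by simp
qed

lemma AE_torus_interior:
  "AE x in torus. 0 < fst x \<and> fst x < 1 \<and> 0 < snd x \<and> snd x < 1"
proof -
  have "negligible ({x :: real \<times> real. (1,0) \<bullet> x = 0} \<union> {x. (1,0) \<bullet> x = 1} \<union> {x. (0,1) \<bullet> x = 0} \<union> {x. (0,1) \<bullet> x = 1})"
    by (intro negligible_Un negligible_hyperplane) (simp_all add: zero_prod_def)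
  hence "AE x :: real \<times> real in lebesgue. x \<notin> ({x. (1,0) \<bullet> x = 0} \<union> {x. (1,0) \<bullet> x = 1} \<union> {x. (0,1) \<bullet> x = 0} \<union> {x. (0,1) \<bullet> x = 1})"
    unfolding negligible_iff_null_sets by (rule AE_not_in)
  hence "AE x :: real \<times> real in lborel. x \<notin> ({x. (1,0) \<bullet> x = 0} \<union> {x. (1,0) \<bullet> x = 1} \<union> {x. (0,1) \<bullet> x = 0} \<union> {x. (0,1) \<bullet> x = 1})"
    unfolding AE_completion_iff .
  hence "AE x :: real \<times> real in lborel. x \<in> Tbox \<longrightarrow> (0 < fst x \<and> fst x < 1 \<and> 0 < snd x \<and> snd x < 1)"
    by eventually_elim (auto simp: Tbox_def inner_prod_def less_le)
  thus ?thesis unfolding torus_def by (subst AE_restrict_space_iff) simp_all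
qed

text \<open>Uniform approximation is available for continuous functions that vanish on the boundary
  of the cell. Measurability provides continuous functions converging to f almost everywhere;
  clamping them to [-B, B] gives a dominating constant, and a cutoff increasing to 1 in the interior
  gives the boundary values.\<close>

lemma trig_polynomial_dense_bounded:
  assumes f: "in_L2 f" and B: "\<And>x. \<bar>f x\<bar> \<le> B" and e: "e > 0"
  obtains P where "trig_polynomial P" "(LINT x|torus. (norm (of_real (f x) - P x))\<^sup>2) < e"
proof -
  have "0 \<le> B" using B[of "(0,0)"] by simp
  have fm: "f \<in> borel_measurable torus" using f by (simp add: in_L2_torus)
  hence "(\<lambda>x. indicator Tbox x *\<^sub>R f x) \<in> borel_measurable lborel"
    unfolding torus_def by (subst (asm) borel_measurable_restrict_space_iff) simp_all
  hence "(\<lambda>x. indicator Tbox x *\<^sub>R f x) \<in> borel_measurable lebesgue"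
    by (rule measurable_completion)
  hence "(\<lambda>x. indicator Tbox x *\<^sub>R f x) measurable_on UNIV"
    by (rule lebesgue_measurable_imp_measurable_on_real) simp
  then obtain N g where N: "negligible N" and g: "\<And>n. continuous_on UNIV (g n)"
    and lim: "\<And>x. x \<notin> N \<Longrightarrow> (\<lambda>n. g n x) \<longlonglongrightarrow> indicator Tbox x *\<^sub>R f x"
    unfolding measurable_on_def by auto
  define b where "b x = fst x * (1 - fst x) * (snd x * (1 - snd x))" for x :: "real \<times> real"
  define h where "h n x = max (- B) (min B (g n x)) * max 0 (min 1 (real n * b x))" for n x
  have hcont: "continuous_on UNIV (h n)" for n
    unfolding h_def b_def by (intro continuous_intros g)
  have hB: "\<bar>h n x\<bar> \<le> B" for n x
  proof -
    have "\<bar>h n x\<bar> \<le> B * 1" unfolding h_def abs_mult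
      using \<open>0 \<le> B\<close> by (intro mult_mono) auto
    thus ?thesis by simp
  qed
  have hm [measurable]: "h n \<in> borel_measurable torus" for n
    by (intro measurable_torus borel_measurable_continuous_onI hcont)
  note [measurable] = fm
  have AEN: "AE x in torus. x \<notin> N"
  proof -
    have "AE x in lebesgue. x \<notin> N" using N unfolding negligible_iff_null_sets by (rule AE_not_in)
    hence "AE x in lborel. x \<notin> N" unfolding AE_completion_iff .
    hence "AE x in lborel. x \<in> Tbox \<longrightarrow> x \<notin> N" by eventually_elim simp
    thus ?thesis unfolding torus_def by (subst AE_restrict_space_iff) simp_all
  qed
  have "(\<lambda>n. LINT x|torus. (f x - h n x)\<^sup>2) \<longlonglongrightarrow> (LINT x|torus. 0)"
  proof (rule integral_dominated_convergence[where w = "\<lambda>_. (2 * B)\<^sup>2"])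
    show "AE x in torus. norm ((f x - h n x)\<^sup>2) \<le> (2 * B)\<^sup>2" for n
    proof (intro AE_I2)
      fix x
      have "\<bar>f x - h n x\<bar> \<le> 2 * B" using B[of x] hB[of n x] by linarith
      from power_mono[OF this, of 2] show "norm ((f x - h n x)\<^sup>2) \<le> (2 * B)\<^sup>2" by simp
    qed
    show "AE x in torus. (\<lambda>n. (f x - h n x)\<^sup>2) \<longlonglongrightarrow> 0"
      using AEN AE_torus_interior AE_space[of torus]
    proof eventually_elim
      case (elim x)
      have g1: "(\<lambda>n. g n x) \<longlonglongrightarrow> f x" using lim[of x] elim by simp
      have bx: "b x > 0" using elim unfolding b_def by simp
      have "eventually (\<lambda>n. 1 \<le> real n * b x) sequentially"
      proof -
        obtain n0 :: nat where "1 / b x \<le> n0" using real_arch_simple by blast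
        hence n0: "1 \<le> real n0 * b x" using bx by (simp add: divide_le_eq)
        have "1 \<le> real n * b x" if "n \<ge> n0" for n
          by (rule order_trans[OF n0 mult_right_mono]) (use that bx in simp_all)
        thus ?thesis unfolding eventually_sequentially by blast
      qed
      hence "eventually (\<lambda>n. max (- B) (min B (g n x)) = h n x) sequentially"
        by eventually_elim (simp add: h_def)
      moreover have "(\<lambda>n. max (- B) (min B (g n x))) \<longlonglongrightarrow> max (- B) (min B (f x))"
        by (intro tendsto_intros g1)
      moreover have "max (- B) (min B (f x)) = f x" using B[of x] by auto
      ultimately have "(\<lambda>n. h n x) \<longlonglongrightarrow> f x" by (auto intro: Lim_transform_eventually)
      hence "(\<lambda>n. (f x - h n x)\<^sup>2) \<longlonglongrightarrow> (f x - f x)\<^sup>2" by (intro tendsto_intros)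
      thus ?case by simp
    qed
  qed simp_all
  hence "eventually (\<lambda>n. (LINT x|torus. (f x - h n x)\<^sup>2) < e / 8) sequentially"
    using e by (intro order_tendstoD(2)[where y = 0]) simp_all
  then obtain n where n: "(LINT x|torus. (f x - h n x)\<^sup>2) < e / 8"
    by (auto simp: eventually_sequentially)
  have "h n x = 0" if "x \<in> Tbox" "fst x \<in> {0,1} \<or> snd x \<in> {0,1}" for x
    using that by (auto simp: h_def b_def)
  then obtain P where P: "trig_polynomial P" "\<And>x. x \<in> Tbox \<Longrightarrow> norm (of_real (h n x) - P x) < sqrt (e / 8)"
    using trig_polynomial_dense_uniform[OF continuous_on_subset[OF hcont[of n]], of "sqrt (e / 8)"] e by auto
  have hL2: "in_L2 (h n)" unfolding in_L2_torus
    by (intro conjI hm integrable_bounded_torus[where B = "B\<^sup>2"]) 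
       (use hB[of n] in \<open>auto simp: abs_le_square_iff[symmetric] intro: order_trans[OF _ abs_ge_self]\<close>)
  have "(LINT x|torus. (norm (of_real (h n x) - P x))\<^sup>2) \<le> (LINT x|torus. e / 8)"
  proof (rule integral_mono_AE')
    show "AE x in torus. (norm (complex_of_real (h n x) - P x))\<^sup>2 \<le> e / 8"
    proof (intro AE_I2)
      fix x assume "x \<in> space torus"
      hence "norm (complex_of_real (h n x) - P x) \<le> sqrt (e / 8)" using P(2)[of x] by simp
      from power_mono[OF this, of 2] show "(norm (complex_of_real (h n x) - P x))\<^sup>2 \<le> e / 8" using e by simp
    qed
  qed (use e in auto)
  hence "(LINT x|torus. (norm (of_real (h n x) - P x))\<^sup>2) \<le> e / 8" by simp
  with L2_approx_step[OF f hL2 P(1)] n e have "(LINT x|torus. (norm (of_real (f x) - P x))\<^sup>2) < e"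
    by linarith
  thus ?thesis using that P(1) by blast
qed

text \<open>Truncating f at height n reduces to the bounded case, with the square of f itself as
  dominating function.\<close>

lemma trig_polynomial_dense_L2:
  assumes f: "in_L2 f" and e: "e > 0"
  obtains P where "trig_polynomial P" "(LINT x|torus. (norm (of_real (f x) - P x))\<^sup>2) < e"
proof -
  define g where "g n x = max (- real n) (min (real n) (f x))" for n x
  have [measurable]: "f \<in> borel_measurable torus" using f by (simp add: in_L2_torus)
  have gm [measurable]: "g n \<in> borel_measurable torus" for n
    unfolding g_def by measurable
  have gB: "\<bar>g n x\<bar> \<le> real n" for n x by (auto simp: g_def)
  have gL2: "in_L2 (g n)" for n
    unfolding in_L2_torus
    by (intro conjI gm integrable_bounded_torus[where B = "(real n)\<^sup>2"]) 
       (use gB[of n] in \<open>auto simp: abs_le_square_iff[symmetric] intro: order_trans[OF _ abs_ge_self]\<close>)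
  have "(\<lambda>n. LINT x|torus. (f x - g n x)\<^sup>2) \<longlonglongrightarrow> (LINT x|torus. 0)"
  proof (rule integral_dominated_convergence[where w = "\<lambda>x. (f x)\<^sup>2"])
    show "AE x in torus. norm ((f x - g n x)\<^sup>2) \<le> (f x)\<^sup>2" for n
      by (intro AE_I2) (auto simp: abs_le_square_iff[symmetric] g_def)
    show "AE x in torus. (\<lambda>n. (f x - g n x)\<^sup>2) \<longlonglongrightarrow> 0"
    proof (intro AE_I2)
      fix x
      obtain n0 :: nat where "\<bar>f x\<bar> \<le> n0" using real_arch_simple by blast
      hence "(f x - g n x)\<^sup>2 = 0" if "n \<ge> n0" for n using that by (auto simp: g_def)
      thus "(\<lambda>n. (f x - g n x)\<^sup>2) \<longlonglongrightarrow> 0"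
        by (intro tendsto_eventually) (auto simp: eventually_sequentially)
    qed
  qed (use f in \<open>simp_all add: in_L2_torus\<close>)
  hence "eventually (\<lambda>n. (LINT x|torus. (f x - g n x)\<^sup>2) < e / 4) sequentially"
    using e by (intro order_tendstoD(2)[where y = 0]) simp_all
  then obtain n where n: "(LINT x|torus. (f x - g n x)\<^sup>2) < e / 4"
    by (auto simp: eventually_sequentially)
  obtain P where P: "trig_polynomial P" "(LINT x|torus. (norm (of_real (g n x) - P x))\<^sup>2) < e / 4"
    using trig_polynomial_dense_bounded[OF gL2 gB, of "e / 4"] e by auto
  with L2_approx_step[OF f gL2 P(1), of n] n have "(LINT x|torus. (norm (of_real (f x) - P x))\<^sup>2) < e"
    by linarith
  thus ?thesis using that P(1) by blast
qed

section \<open>Parseval's identity, products and convolution\<close>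

theorem Parseval:
  assumes f: "in_L2 f"
  shows "((\<lambda>k. (norm (fcoef f k))\<^sup>2) has_sum Int2 (\<lambda>x. (f x)\<^sup>2)) UNIV"
proof -
  let ?S = "Int2 (\<lambda>x. (f x)\<^sup>2)" and ?g = "\<lambda>k. (norm (fcoef f k))\<^sup>2"
  have sm: "?g summable_on UNIV"
    by (rule nonneg_bdd_above_summable_on) (auto simp: bdd_above_def intro!: exI[of _ ?S] Bessel[OF f])
  have "infsum ?g UNIV \<le> ?S"
    by (rule infsum_le_finite_sums[OF sm]) (use Bessel[OF f] in auto)
  moreover have "?S \<le> infsum ?g UNIV"
  proof (rule field_le_epsilon)
    fix e :: real assume e: "e > 0"
    obtain P where P: "trig_polynomial P" "(LINT x|torus. (norm (of_real (f x) - P x))\<^sup>2) < e"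
      using trig_polynomial_dense_L2[OF f e] by blast
    then obtain F c where F: "finite F" "P = trig_poly F c" unfolding trig_polynomial_def by blast
    \<comment> \<open>In the distance formula the term containing \<open>c\<close> is nonnegative,
      so the energy missed by the frequencies of P is at most the squared distance from f to
      P.\<close>
    have "?S - sum ?g F \<le> e"
      using P(2) L2_dist_trig_poly[OF f F(1), of c] sum_nonneg[of F "\<lambda>k. (norm (fcoef f k - c k))\<^sup>2"]
      unfolding F(2) by simp
    moreover have "sum ?g F \<le> infsum ?g UNIV"
      by (intro finite_sum_le_infsum sm F(1)) auto
    ultimately show "?S \<le> infsum ?g UNIV + e" by simp
  qed
  ultimately show ?thesis using has_sum_infsum[OF sm] by simp
qed

lemma L2_summable: "in_L2 f \<Longrightarrow> (\<lambda>k. (norm (fcoef f k))\<^sup>2) summable_on UNIV"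
  using Parseval has_sum_imp_summable by blast

lemma summable_on_mult_l2:
  fixes a b :: "'a \<Rightarrow> complex"
  assumes "(\<lambda>k. (norm (a k))\<^sup>2) summable_on UNIV" "(\<lambda>k. (norm (b k))\<^sup>2) summable_on UNIV"
  shows "(\<lambda>k. norm (a k * b k)) summable_on UNIV"
proof (rule summable_on_comparison_test)
  show "(\<lambda>k. (norm (a k))\<^sup>2 + (norm (b k))\<^sup>2) summable_on UNIV"
    by (intro summable_on_add assms)
  show "norm (a k * b k) \<le> (norm (a k))\<^sup>2 + (norm (b k))\<^sup>2" for k
  proof -
    have "2 * norm (a k) * norm (b k) \<le> (norm (a k))\<^sup>2 + (norm (b k))\<^sup>2" by (rule sum_squares_bound)
    moreover have "0 \<le> norm (a k) * norm (b k)" by simp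
    ultimately show ?thesis unfolding norm_mult by linarith
  qed
qed auto

text \<open>Polarisation yields only the real part. The imaginary part of the sum vanishes because f
  and g are real: reflecting the frequency conjugates every term, so the sum equals its own
  conjugate.\<close>

lemma Parseval_mult:
  assumes f: "in_L2 f" and g: "in_L2 g"
  shows "((\<lambda>m. fcoef f m * cnj (fcoef g m)) has_sum complex_of_real (Int2 (\<lambda>x. f x * g x))) UNIV"
proof -
  let ?a = "\<lambda>m. fcoef f m * cnj (fcoef g m)"
  have i: "integrable torus f" "integrable torus g" using f g by (simp_all add: in_L2_imp_integrable)
  have "((\<lambda>k. (norm (fcoef (\<lambda>x. f x + g x) k))\<^sup>2 - (norm (fcoef (\<lambda>x. f x - g x) k))\<^sup>2) has_sum
      (Int2 (\<lambda>x. (f x + g x)\<^sup>2) - Int2 (\<lambda>x. (f x - g x)\<^sup>2))) UNIV"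
    using has_sum_add[OF Parseval[OF in_L2_add[OF f g]] has_sum_uminusI[OF Parseval[OF in_L2_diff[OF f g]]]] by simp
  also have "(\<lambda>k. (norm (fcoef (\<lambda>x. f x + g x) k))\<^sup>2 - (norm (fcoef (\<lambda>x. f x - g x) k))\<^sup>2) = (\<lambda>k. 4 * Re (?a k))"
  proof
    fix k
    show "(norm (fcoef (\<lambda>x. f x + g x) k))\<^sup>2 - (norm (fcoef (\<lambda>x. f x - g x) k))\<^sup>2 = 4 * Re (?a k)"
      unfolding fcoef_add[OF i] fcoef_diff[OF i] cmod_power2 by (simp add: power2_eq_square algebra_simps)
  qed
  also have "Int2 (\<lambda>x. (f x + g x)\<^sup>2) - Int2 (\<lambda>x. (f x - g x)\<^sup>2) = 4 * Int2 (\<lambda>x. f x * g x)"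
  proof -
    have "Int2 (\<lambda>x. (f x + g x)\<^sup>2) - Int2 (\<lambda>x. (f x - g x)\<^sup>2) = Int2 (\<lambda>x. (f x + g x)\<^sup>2 - (f x - g x)\<^sup>2)"
      using in_L2_add[OF f g] in_L2_diff[OF f g] unfolding Int2_torus
      by (subst Bochner_Integration.integral_diff) (simp_all add: in_L2_torus)
    also have "(\<lambda>x. (f x + g x)\<^sup>2 - (f x - g x)\<^sup>2) = (\<lambda>x. 4 * (f x * g x))"
      by (simp add: power2_eq_square algebra_simps)
    finally show ?thesis by (simp add: Int2_torus)
  qed
  finally have "((\<lambda>k. 4 * Re (?a k)) has_sum 4 * Int2 (\<lambda>x. f x * g x)) UNIV" .
  note * = this
  have re: "((\<lambda>k. Re (?a k)) has_sum Int2 (\<lambda>x. f x * g x)) UNIV"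
  proof -
    have quarter: "1/4 * (4 * x) = x" for x :: real by simp
    show ?thesis using has_sum_cmult_right[OF *, of "1/4"] unfolding quarter .
  qed
  have "(\<lambda>m. norm (?a m)) summable_on UNIV"
    by (rule summable_on_mult_l2) (use L2_summable[OF f] L2_summable[OF g] in auto)
  hence sa: "(?a has_sum infsum ?a UNIV) UNIV"
    by (rule has_sum_infsum[OF abs_summable_summable])
  have "((\<lambda>m. ?a (- m)) has_sum infsum ?a UNIV) UNIV"
    using has_sum_reindex_bij_betw[of uminus UNIV UNIV ?a] sa bij_uminus by blast
  moreover have "((\<lambda>m. ?a (- m)) has_sum cnj (infsum ?a UNIV)) UNIV"
  proof -
    have "(\<lambda>m. ?a (- m)) = (\<lambda>m. cnj (?a m))" by (simp add: fcoef_uminus_index)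
    thus ?thesis using sa by (simp only: has_sum_cnj_iff)
  qed
  ultimately have "infsum ?a UNIV = cnj (infsum ?a UNIV)" using has_sum_unique by blast
  hence "Im (infsum ?a UNIV) = 0" by (simp add: complex_eq_iff)
  moreover have "Re (infsum ?a UNIV) = Int2 (\<lambda>x. f x * g x)"
    using has_sum_unique[OF has_sum_Re[OF sa] re] .
  ultimately have "infsum ?a UNIV = complex_of_real (Int2 (\<lambda>x. f x * g x))"
    by (simp add: complex_eq_iff)
  thus ?thesis using sa by simp
qed

text \<open>The test functions of the weak formulation are real, so complex coefficients are reached
  through real waves with a phase b; the phases 0 and pi/2 recover the real and the imaginary
  part.\<close>

definition wave :: "real \<Rightarrow> int \<times> int \<Rightarrow> real \<times> real \<Rightarrow> real" where
  "wave b k x = cos (2 * pi * (of_int (fst k) * fst x + of_int (snd k) * snd x) + b)"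

lemma wave_Re: "wave b k x = Re (cis b * ee k x)"
  unfolding wave_def ee_def by (simp add: cis_mult add_ac)

lemma wave_ee: "complex_of_real (wave b k x) = (cis b * ee k x + cis (- b) * cnj (ee k x)) / 2"
proof -
  have "cis (- b) * cnj (ee k x) = cnj (cis b * ee k x)" by (simp add: cis_cnj)
  thus ?thesis unfolding wave_Re by (simp add: complex_eq_iff)
qed

lemma wave_bound: "\<bar>wave b k x\<bar> \<le> 1"
  by (simp add: wave_def)

lemma wave_measurable [measurable]: "wave b k \<in> borel_measurable torus"
  unfolding wave_def
  by (intro measurable_torus borel_measurable_continuous_onI continuous_intros)

lemma in_L2_mult_wave: "in_L2 f \<Longrightarrow> in_L2 (\<lambda>x. f x * wave b k x)"
  by (rule in_L2_mult_bounded[OF _ _ wave_bound]) simp_all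

lemma fcoef_mult_wave:
  assumes "integrable torus f"
  shows "fcoef (\<lambda>x. f x * wave b k x) m = (cis b * fcoef f (m - k) + cis (- b) * fcoef f (m + k)) / 2"
proof -
  have "complex_of_real (f x * wave b k x) * cnj (ee m x)
     = cis b / 2 * (of_real (f x) * cnj (ee (m - k) x)) + cis (- b) / 2 * (of_real (f x) * cnj (ee (m + k) x))" for x
    unfolding of_real_mult wave_ee ee_uminus[symmetric] 
    by (simp add: ee_add ee_uminus add_divide_distrib algebra_simps flip: ee_mult_cnj)
  thus ?thesis
    unfolding fcoef_torus
    by (simp only: Bochner_Integration.integral_add[OF integrable_mult_right[OF integrable_mult_ee[OF assms]] integrable_mult_right[OF integrable_mult_ee[OF assms]]]
        Bochner_Integration.integral_mult_right_zero)
       (simp add: add_divide_distrib)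
qed

lemma Int2_mult_wave:
  assumes "integrable torus f"
  shows "Int2 (\<lambda>x. f x * wave b k x) = Re (cis (- b) * fcoef f k)"
proof -
  have "complex_of_real (Int2 (\<lambda>x. f x * wave b k x)) = fcoef (\<lambda>x. f x * wave b k x) 0"
    unfolding Int2_torus fcoef_torus integral_complex_of_real[symmetric] by (simp del: of_real_mult)
  also have "\<dots> = (cis b * cnj (fcoef f k) + cis (- b) * fcoef f k) / 2"
    unfolding fcoef_mult_wave[OF assms] by (simp add: fcoef_uminus_index)
  finally show ?thesis by (simp add: complex_eq_iff)
qed

text \<open>Parseval's identity is applied to f and g times a wave of frequency k, for the phases 0
  and -pi/2. Adding -i times the second to the first cancels the coefficients of g at m + k and
  leaves the conjugates of those at m - k, that is, those at k - m.\<close>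

theorem fcoef_mult:
  assumes f: "in_L2 f" and g: "in_L2 g"
  shows "((\<lambda>m. fcoef f m * fcoef g (k - m)) has_sum fcoef (\<lambda>x. f x * g x) k) UNIV"
proof -
  let ?h = "\<lambda>b x. g x * wave b k x"
  have ig: "integrable torus g" using g by (rule in_L2_imp_integrable)
  have ifg: "integrable torus (\<lambda>x. f x * g x)" using f g by (rule integrable_mult_L2)
  have "((\<lambda>m. fcoef f m * cnj (fcoef (?h 0) m) + (- \<i>) * (fcoef f m * cnj (fcoef (?h (- pi / 2)) m))) has_sum
     (complex_of_real (Int2 (\<lambda>x. f x * ?h 0 x)) + (- \<i>) * complex_of_real (Int2 (\<lambda>x. f x * ?h (- pi / 2) x)))) UNIV"
    by (intro has_sum_add has_sum_cmult_right Parseval_mult f in_L2_mult_wave g)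
  also have "(\<lambda>m. fcoef f m * cnj (fcoef (?h 0) m) + (- \<i>) * (fcoef f m * cnj (fcoef (?h (- pi / 2)) m)))
     = (\<lambda>m. fcoef f m * fcoef g (k - m))"
  proof
    fix m
    have "fcoef g (k - m) = cnj (fcoef g (m - k))" by (simp flip: fcoef_uminus_index)
    thus "fcoef f m * cnj (fcoef (?h 0) m) + (- \<i>) * (fcoef f m * cnj (fcoef (?h (- pi / 2)) m)) = fcoef f m * fcoef g (k - m)"
      unfolding fcoef_mult_wave[OF ig] by (simp add: cis_minus_pi_half field_simps)
  qed
  also have "complex_of_real (Int2 (\<lambda>x. f x * ?h 0 x)) + (- \<i>) * complex_of_real (Int2 (\<lambda>x. f x * ?h (- pi / 2) x))
     = fcoef (\<lambda>x. f x * g x) k"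
  proof -
    have "Int2 (\<lambda>x. f x * ?h b x) = Re (cis (- b) * fcoef (\<lambda>x. f x * g x) k)" for b
      using Int2_mult_wave[OF ifg, of b k] by (simp add: mult.assoc)
    thus ?thesis by (simp add: complex_eq_iff)
  qed
  finally show ?thesis .
qed

section \<open>Lattice sums and the logarithmic weight\<close>

text \<open>The sup norm, taken as a natural number so that it can be the argument of
  \<open>harm\<close> and group lattice sums into square shells.\<close>

definition knat :: "int \<times> int \<Rightarrow> nat" where
  "knat k = nat (max \<bar>fst k\<bar> \<bar>snd k\<bar>)"

abbreviation kn :: "int \<times> int \<Rightarrow> real" where
  "kn k \<equiv> real (knat k)"

lemma kn_eq: "kn k = max \<bar>real_of_int (fst k)\<bar> \<bar>real_of_int (snd k)\<bar>"
  unfolding knat_def by (subst of_nat_nat) (simp_all add: of_int_max)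

lemma knat_0 [simp]: "knat 0 = 0"
  by (simp add: knat_def)

lemma knat_uminus [simp]: "knat (- k) = knat k"
  by (simp add: knat_def)

lemma knat_eq_0_iff [simp]: "knat k = 0 \<longleftrightarrow> k = 0"
  by (auto simp: knat_def prod_eq_iff)

lemma knat_pos: "k \<noteq> 0 \<Longrightarrow> 1 \<le> kn k"
  using knat_eq_0_iff[of k] by linarith

lemma knat_pos_iff [simp]: "0 < knat k \<longleftrightarrow> k \<noteq> 0"
  using knat_eq_0_iff[of k] by linarith

lemma knat_triangle: "knat k \<le> knat l + knat (k - l)"
proof -
  have "kn k \<le> kn l + kn (k - l)"
    unfolding kn_eq fst_diff snd_diff of_int_diff
  proof (rule max.boundedI)
    have tri: "\<bar>a\<bar> \<le> \<bar>c\<bar> + \<bar>a - c\<bar>" for a c :: real by linarith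
    show "\<bar>real_of_int (fst k)\<bar> \<le> max \<bar>real_of_int (fst l)\<bar> \<bar>real_of_int (snd l)\<bar> +
      max \<bar>real_of_int (fst k) - real_of_int (fst l)\<bar> \<bar>real_of_int (snd k) - real_of_int (snd l)\<bar>"
      by (rule order_trans[OF tri add_mono]) (rule max.cobounded1)+
    show "\<bar>real_of_int (snd k)\<bar> \<le> max \<bar>real_of_int (fst l)\<bar> \<bar>real_of_int (snd l)\<bar> +
      max \<bar>real_of_int (fst k) - real_of_int (fst l)\<bar> \<bar>real_of_int (snd k) - real_of_int (snd l)\<bar>"
      by (rule order_trans[OF tri add_mono]) (rule max.cobounded2)+
  qed
  thus ?thesis by (simp flip: of_nat_add)
qed

lemma knat_diff_commute: "knat (k - l) = knat (l - k)"
  using knat_uminus[of "k - l"] by simp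

lemma finite_knat_le: "finite {k. knat k \<le> n}"
proof (rule finite_subset)
  show "{k. knat k \<le> n} \<subseteq> {- int n..int n} \<times> {- int n..int n}"
    by (auto simp: knat_def)
qed simp

lemma card_knat_eq: "card {k. knat k = n} \<le> 4 * (2 * n + 1)"
proof -
  let ?I = "{- int n..int n}"
  let ?A = "{int n} \<times> ?I" and ?B = "{- int n} \<times> ?I" and ?C = "?I \<times> {int n}" and ?D = "?I \<times> {- int n}"
  have "{k. knat k = n} \<subseteq> ?A \<union> ?B \<union> ?C \<union> ?D"
  proof
    fix k assume "k \<in> {k. knat k = n}"
    hence m: "max \<bar>fst k\<bar> \<bar>snd k\<bar> = int n" unfolding knat_def by simp
    hence "\<bar>fst k\<bar> = int n \<and> \<bar>snd k\<bar> \<le> int n \<or> \<bar>snd k\<bar> = int n \<and> \<bar>fst k\<bar> \<le> int n"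
      by (metis max.cobounded1 max.cobounded2 max_def)
    hence "(fst k = int n \<or> fst k = - int n) \<and> snd k \<in> ?I \<or> (snd k = int n \<or> snd k = - int n) \<and> fst k \<in> ?I"
      by (simp add: abs_le_iff minus_le_iff) linarith
    thus "k \<in> ?A \<union> ?B \<union> ?C \<union> ?D" unfolding Un_iff mem_Times_iff singleton_iff by blast
  qed
  hence "card {k. knat k = n} \<le> card (?A \<union> ?B \<union> ?C \<union> ?D)"
    by (intro card_mono) simp_all
  also have "\<dots> \<le> card ?A + card ?B + card ?C + card ?D"
    by (meson add_mono card_Un_le le_refl order_trans)
  also have "\<dots> = 4 * (2 * n + 1)" by (simp add: card_cartesian_product)
  finally show ?thesis .
qed

text \<open>Grouping a radial sum by shells: the shell of radius n consists of four sides with at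
  most 2n + 1 points each. Counting the corners twice costs only a constant.\<close>

lemma lattice_sum_le:
  fixes g :: "nat \<Rightarrow> real"
  assumes g: "\<And>n. 0 \<le> g n" and B: "\<And>N. (\<Sum>n\<le>N. real (2 * n + 1) * g n) \<le> B" and F: "finite F"
  shows "(\<Sum>k\<in>F. g (knat k)) \<le> 4 * B"
proof -
  obtain N where N: "knat ` F \<subseteq> {..N}"
    using F finite_nat_set_iff_bounded_le[of "knat ` F"] by (auto simp: image_subset_iff)
  have "(\<Sum>k\<in>F. g (knat k)) \<le> (\<Sum>k\<in>{k. knat k \<le> N}. g (knat k))"
    using N g by (intro sum_mono2 finite_knat_le) auto
  also have "\<dots> = (\<Sum>n\<le>N. \<Sum>k\<in>{k\<in>{k. knat k \<le> N}. knat k = n}. g (knat k))"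
    by (rule sum.group[symmetric]) (auto simp: finite_knat_le)
  also have "\<dots> = (\<Sum>n\<le>N. real (card {k. knat k = n}) * g n)"
  proof (intro sum.cong refl)
    fix n assume "n \<in> {..N}"
    hence "{k\<in>{k. knat k \<le> N}. knat k = n} = {k. knat k = n}" by auto
    thus "(\<Sum>k\<in>{k\<in>{k. knat k \<le> N}. knat k = n}. g (knat k)) = real (card {k. knat k = n}) * g n"
      by simp
  qed
  also have "\<dots> \<le> (\<Sum>n\<le>N. real (4 * (2 * n + 1)) * g n)"
    by (intro sum_mono mult_right_mono g of_nat_mono card_knat_eq)
  also have "\<dots> = 4 * (\<Sum>n\<le>N. real (2 * n + 1) * g n)"
    by (simp add: sum_distrib_left algebra_simps)
  finally show ?thesis using B[of N] by linarith
qed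

text \<open>The shell sum is comparable to that of 1/n^2. Division by zero gives 0, so the origin
  contributes nothing, here and in all later sums with negative powers of \<open>kn\<close>.\<close>

lemma lattice_sum_inverse_cube:
  obtains C where "C \<ge> 0" "\<And>F. finite F \<Longrightarrow> (\<Sum>k\<in>F. 1 / kn k ^ 3) \<le> C"
proof -
  have sm: "summable (\<lambda>n. 3 * inverse (real n ^ 2))"
    by (intro summable_mult inverse_power_summable) simp
  let ?B = "\<Sum>n. 3 * inverse (real n ^ 2)"
  have B: "(\<Sum>n\<le>N. real (2 * n + 1) * (1 / real n ^ 3)) \<le> ?B" for N
  proof -
    have "real (2 * n + 1) * (1 / real n ^ 3) \<le> 3 * inverse (real n ^ 2)" for n
    proof (cases "n = 0")
      case False
      hence "real (2 * n + 1) * (1 / real n ^ 3) \<le> (3 * real n) * (1 / real n ^ 3)"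
        by (intro mult_right_mono) auto
      also have "\<dots> = 3 * inverse (real n ^ 2)" using False by (simp add: field_simps power2_eq_square power3_eq_cube)
      finally show ?thesis .
    qed simp
    hence "(\<Sum>n\<le>N. real (2 * n + 1) * (1 / real n ^ 3)) \<le> (\<Sum>n\<le>N. 3 * inverse (real n ^ 2))"
      by (intro sum_mono)
    also have "\<dots> \<le> ?B" by (intro sum_le_suminf sm) auto
    finally show ?thesis .
  qed
  show ?thesis
  proof (rule that[of "4 * ?B"])
    show "4 * ?B \<ge> 0" using suminf_nonneg[OF sm] by simp
    show "(\<Sum>k\<in>F. 1 / kn k ^ 3) \<le> 4 * ?B" if "finite F" for F
      using lattice_sum_le[of "\<lambda>n. 1 / real n ^ 3", OF _ B that] by simp
  qed
qed

text \<open>The majorant of the commutator of the weight \<open>om\<close>. It is the frequency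
  divided by a quantity of size N + log of the frequency; the logarithm is what makes its square,
  divided by the fourth power of the frequency, summable over the lattice, with a sum of order
  1/N.\<close>

definition cw :: "nat \<Rightarrow> int \<times> int \<Rightarrow> real" where
  "cw N k = 4 * kn k / (2 * real N + harm (knat k))"

lemma cw_nonneg: "0 \<le> cw N k"
  by (simp add: cw_def harm_nonneg)

text \<open>With b_n = 2N + harm n, the shell sum has terms at most 48 / (n b_n^2). Since b_n
  exceeds its predecessor by exactly 1/n, such a term is at most 48 (1/b_(n-1) - 1/b_n), which
  telescopes to at most 48 / (2N). The four sides of a shell turn 24/N into 96/N.\<close>

lemma lattice_sum_cw:
  assumes N: "N > 0" and F: "finite F"
  shows "(\<Sum>k\<in>F. (cw N k)\<^sup>2 / kn k ^ 4) \<le> 96 / real N"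
proof -
  define g where "g n = 16 / ((2 * real N + harm n)\<^sup>2 * real n ^ 2)" for n
  have pos: "2 * real N + harm n > 0" for n :: nat
    using N harm_nonneg[of n, where ?'a = real] by simp
  have tel: "(\<Sum>n\<le>M. real (2 * n + 1) * g n) \<le> 48 * (1 / (2 * real N) - 1 / (2 * real N + harm M))" for M
  proof (induction M)
    case 0
    show ?case by (simp add: g_def harm_def)
  next
    case (Suc M)
    let ?a = "2 * real N + harm M" and ?b = "2 * real N + harm (Suc M)"
    have ab: "?b - ?a = 1 / real (Suc M)" by (simp add: harm_Suc field_simps)
    have le: "?a \<le> ?b" by (simp add: harm_Suc)
    have "real (2 * Suc M + 1) * g (Suc M) \<le> (3 * real (Suc M)) * g (Suc M)"
      by (intro mult_right_mono) (auto simp: g_def)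
    also have "\<dots> = 48 * ((1 / real (Suc M)) / ?b\<^sup>2)"
    proof -
      have "(3 * n) * (16 / (b * n ^ 2)) = 48 * ((1 / n) / b)" if "n > 0" for n b :: real
        using that by (cases "b = 0") (simp_all add: field_simps power2_eq_square)
      from this[of "real (Suc M)" "?b\<^sup>2"] show ?thesis unfolding g_def by simp
    qed
    also have "\<dots> = 48 * ((?b - ?a) / ?b\<^sup>2)" unfolding ab ..
    also have "(?b - ?a) / ?b\<^sup>2 \<le> (?b - ?a) / (?a * ?b)"
      using le pos[of M] pos[of "Suc M"] unfolding power2_eq_square
      by (intro divide_left_mono mult_right_mono mult_pos_pos) auto
    also have "\<dots> = 1 / ?a - 1 / ?b"
      using pos[of M] pos[of "Suc M"] by (simp add: diff_frac_eq)
    finally have "real (2 * Suc M + 1) * g (Suc M) \<le> 48 * (1 / ?a - 1 / ?b)" by simp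
    with Suc.IH show ?case by simp
  qed
  have "(\<Sum>n\<le>M. real (2 * n + 1) * g n) \<le> 24 / real N" for M
  proof -
    have "0 \<le> 1 / (2 * real N + harm M)" using pos[of M] by simp
    moreover have "48 * (1 / (2 * real N)) = 24 / real N" by simp
    ultimately show ?thesis using tel[of M] unfolding right_diff_distrib by linarith
  qed
  hence "(\<Sum>k\<in>F. g (knat k)) \<le> 4 * (24 / real N)"
    by (intro lattice_sum_le F) (simp_all add: g_def)
  moreover have "(cw N k)\<^sup>2 / kn k ^ 4 = g (knat k)" for k
    unfolding cw_def g_def
    by (cases "k = 0") (simp_all add: power_divide power_mult_distrib eval_nat_numeral)
  ultimately show ?thesis by simp
qed

text \<open>The logarithmic profile makes the commutator with transport small: a weight that is
  flatter than any power is needed because \<open>H\<^sup>2\<close> barely fails to control Lipschitz norms in two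
  dimensions.\<close>
definition om :: "nat \<Rightarrow> int \<times> int \<Rightarrow> real" where
  "om N k = max 0 (1 - harm (knat k) / real N)"

lemma om_nonneg: "0 \<le> om N k" and om_le_1: "om N k \<le> 1"
  by (simp_all add: om_def harm_nonneg)

text \<open>Every increment between a and b is at most 1/a and at most 1. The first inequality is
  the discrete form of a log(b/a) <= b - a.\<close>

lemma harm_diff_le:
  assumes "a \<le> b"
  shows "real a * (harm b - harm a) \<le> real b - real a" "harm b - harm a \<le> real b - real a"
        "(0::real) \<le> harm b - harm a"
proof -
  have "real a * (harm b - harm a) \<le> real b - real a \<and> harm b - harm a \<le> real b - real a \<and> (0::real) \<le> harm b - harm a"
    using assms
  proof (induction b rule: dec_induct)
    case (step n)
    define i where "i = inverse (real (Suc n))"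
    have "real a * i \<le> 1" "i \<le> 1" "0 \<le> i"
      unfolding i_def using step.hyps by (simp_all add: field_simps)
    moreover have "real (Suc n) = real n + 1" "harm (Suc n) = harm n + i"
      by (simp_all add: harm_Suc i_def)
    ultimately show ?case using step.IH by (auto simp: algebra_simps)
  qed simp
  thus "real a * (harm b - harm a) \<le> real b - real a" "harm b - harm a \<le> real b - real a"
        "(0::real) \<le> harm b - harm a" by auto
qed

lemma om_diff_aux:
  assumes N: "N > 0" and le: "knat l \<le> knat k"
  shows "\<bar>om N k - om N l\<bar> * kn l \<le> cw N (k - l)" "\<bar>om N k - om N l\<bar> \<le> kn (k - l) / real N"
proof -
  let ?a = "knat l" and ?b = "knat k" and ?m = "knat (k - l)"
  have m: "real ?b - real ?a \<le> real ?m" using knat_triangle[of k l] by linarith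
  note h = harm_diff_le[OF le]
  have d: "\<bar>om N k - om N l\<bar> \<le> (harm ?b - harm ?a) / real N"
  proof -
    have "\<bar>max 0 (1 - y) - max 0 (1 - x)\<bar> \<le> y - x" if "x \<le> y" for x y :: real using that by auto
    from this[of "harm ?a / real N" "harm ?b / real N"] show ?thesis
      using h(3) N by (simp add: om_def divide_right_mono diff_divide_distrib)
  qed
  have "(harm ?b - harm ?a) / real N \<le> kn (k - l) / real N" using h(2) m by (intro divide_right_mono) auto
  with d show "\<bar>om N k - om N l\<bar> \<le> kn (k - l) / real N" by linarith
  have hm: "(0::real) \<le> harm ?m" by (rule harm_nonneg)
  show "\<bar>om N k - om N l\<bar> * kn l \<le> cw N (k - l)"
  \<comment> \<open>If \<open>harm ?m\<close> is at most 2N, the denominator of \<open>cw\<close> is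
    at most 4N and the slope of the weight suffices; the factor 4 in \<open>cw\<close> accommodates
    this case.\<close>
  proof (cases "harm ?m \<le> 2 * real N")
    case True
    have "\<bar>om N k - om N l\<bar> * kn l \<le> (harm ?b - harm ?a) / real N * kn l"
      by (intro mult_right_mono d) simp
    also have "\<dots> = (kn l * (harm ?b - harm ?a)) / real N" by simp
    also have "\<dots> \<le> real ?m / real N"
      using h(1) m by (intro divide_right_mono) linarith+
    also have "\<dots> = 4 * real ?m / (4 * real N)" by simp
    also have "\<dots> \<le> cw N (k - l)"
      unfolding cw_def using N hm True by (intro divide_left_mono mult_pos_pos) auto
    finally show ?thesis .
  next
    case False
    have "0 \<le> 2 * real N" "2 * real N < harm ?m" using False by simp_all
    hence hpos: "(0::real) < harm ?m" by (rule le_less_trans)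
    show ?thesis
    proof (cases "harm ?a \<ge> real N")
      case True
      hence "harm ?b \<ge> real N" using h(3) by linarith
      hence "om N k = 0" "om N l = 0" using True N by (auto simp: om_def)
      thus ?thesis using cw_nonneg by simp
    next
      \<comment> \<open>Now \<open>harm ?a\<close> lies below half of \<open>harm ?m\<close>, so l
        is much shorter than k - l, and the trivial bound 1 on the difference of the weights is
        enough.\<close>
      case a: False
      have am: "?a \<le> ?m"
      proof (rule ccontr)
        assume "\<not> ?a \<le> ?m"
        hence "harm ?m \<le> (harm ?a :: real)" using harm_diff_le(3)[of ?m ?a] by simp
        thus False using a False N by linarith
      qed
      have "\<bar>om N k - om N l\<bar> \<le> 1" using om_nonneg[of N k] om_le_1[of N k] om_nonneg[of N l] om_le_1[of N l] by linarith
      hence "\<bar>om N k - om N l\<bar> * kn l \<le> 1 * kn l" by (intro mult_right_mono) auto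
      also have "kn l * harm ?m \<le> 2 * real ?m"
      proof -
        have "real ?a * (harm ?m / 2) \<le> real ?a * (harm ?m - harm ?a)"
          using a False by (intro mult_left_mono) auto
        also have "\<dots> \<le> real ?m - real ?a" by (rule harm_diff_le(1)[OF am])
        finally show ?thesis by simp
      qed
      hence "1 * kn l \<le> 2 * real ?m / harm ?m" using hpos by (subst pos_le_divide_eq) simp_all
      also have "\<dots> = 4 * real ?m / (2 * harm ?m)" by simp
      also have "\<dots> \<le> cw N (k - l)"
        unfolding cw_def using N hm False hpos by (intro divide_left_mono mult_pos_pos) auto
      finally show ?thesis .
    qed
  qed
qed

text \<open>The minimum is what incompressibility offers: in the transport term the derivative can
  be charged to either of the two frequencies.\<close>

lemma om_commutator:
  assumes "N > 0"
  shows "\<bar>om N k - om N l\<bar> * min (kn k) (kn l) \<le> cw N (k - l)"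
proof (cases "knat l \<le> knat k")
  case True
  thus ?thesis using om_diff_aux(1)[OF assms True] by (simp add: min_def)
next
  case False
  hence "knat k \<le> knat l" by simp
  from om_diff_aux(1)[OF assms this] False show ?thesis
    by (simp add: min_def cw_def knat_diff_commute[of k l] abs_minus_commute)
qed

text \<open>Interpolation between the Lipschitz bound and the trivial bound 1. It asks for half a
  derivative of the Euler state, which \<open>H^3\<close> can spare: the resulting sum is controlled
  by that of \<open>1 / kn k ^ 3\<close>. Using the Lipschitz bound alone would cost a full
  derivative and lead to the divergent sum of \<open>1 / kn k ^ 2\<close>.\<close>

lemma om_diff_le_sqrt:
  assumes "N > 0"
  shows "om N k \<le> om N l + sqrt (kn (k - l)) / sqrt (real N)"
proof -
  have "om N k - om N l \<le> kn (k - l) / real N"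
  proof (cases "knat l \<le> knat k")
    case True
    thus ?thesis using om_diff_aux(2)[OF assms True] by simp
  next
    case False
    hence "knat k \<le> knat l" by simp
    from om_diff_aux(2)[OF assms this] show ?thesis by (simp add: knat_diff_commute[of k l])
  qed
  moreover have "om N k - om N l \<le> 1" using om_le_1[of N k] om_nonneg[of N l] by linarith
  moreover have "min 1 x \<le> sqrt x" if "0 \<le> x" for x :: real
  proof (cases "x \<le> 1")
    case True
    have "x = sqrt x * sqrt x" using that by simp
    also have "\<dots> \<le> sqrt x * 1" using True that by (intro mult_left_mono) auto
    finally show ?thesis by simp
  qed auto
  from this[of "kn (k - l) / real N"] have "min 1 (kn (k - l) / real N) \<le> sqrt (kn (k - l)) / sqrt (real N)"
    by (simp add: real_sqrt_divide)
  ultimately show ?thesis by linarith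
qed

text \<open>Harmonic numbers dominate the logarithm, so the weight vanishes beyond radius exp N. The
  support is finite but exponentially large, so no estimate may depend on its size.\<close>

lemma finite_om_support:
  assumes "N > 0" shows "finite {k. om N k \<noteq> 0}"
proof (rule finite_subset[OF _ finite_knat_le])
  show "{k. om N k \<noteq> 0} \<subseteq> {k. knat k \<le> nat \<lceil>exp (real N)\<rceil>}"
  proof
    fix k assume "k \<in> {k. om N k \<noteq> 0}"
    hence "harm (knat k) < real N" using assms by (auto simp: om_def max_def field_simps split: if_splits)
    hence "ln (real (knat k) + 1) < real N" using ln_le_harm[of "knat k"] by (simp add: add_ac)
    hence "exp (ln (real (knat k) + 1)) < exp (real N)" by (simp only: exp_less_cancel_iff)
    moreover have "exp (ln (real (knat k) + 1)) = real (knat k) + 1" by (rule exp_ln) simp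
    ultimately have "real (knat k) + 1 < exp (real N)" by (simp only:)
    thus "k \<in> {k. knat k \<le> nat \<lceil>exp (real N)\<rceil>}" by simp linarith
  qed
qed

lemma om_tendsto: "(\<lambda>N. om N k) \<longlonglongrightarrow> 1"
proof -
  have "(\<lambda>N. max 0 (1 - harm (knat k) / real N)) \<longlonglongrightarrow> max 0 (1 - 0)"
    by (intro tendsto_intros lim_const_over_n)
  thus ?thesis by (simp add: om_def)
qed

section \<open>Fourier coefficients of weak solutions\<close>

text \<open>By Weierstrass, D is within e of a polynomial, which is orthogonal to D; so the integral
  of D^2 is at most e times that of its modulus.\<close>

lemma continuous_orthogonal_powers_eq_0:
  fixes D :: "real \<Rightarrow> real"
  assumes T: "0 < T" and D: "continuous_on {0..T} D"
    and orth: "\<And>n. integral {0..T} (\<lambda>s. D s * s ^ n) = 0"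
    and t: "t \<in> {0..T}"
  shows "D t = 0"
proof -
  have pw: "(\<lambda>s. D s * (\<Sum>i\<le>n. a i * s ^ i)) integrable_on {0..T}"
    and po: "integral {0..T} (\<lambda>s. D s * (\<Sum>i\<le>n. a i * s ^ i)) = 0" for a :: "nat \<Rightarrow> real" and n
  proof -
    have "continuous_on {0..T} (\<lambda>s. D s * (\<Sum>i\<le>n. a i * s ^ i))"
      by (intro continuous_intros D)
    thus "(\<lambda>s. D s * (\<Sum>i\<le>n. a i * s ^ i)) integrable_on {0..T}" by (rule integrable_continuous_real)
    have "(\<lambda>s. D s * s ^ i) integrable_on {0..T}" for i
      by (intro integrable_continuous_real continuous_intros D)
    hence "integral {0..T} (\<lambda>s. \<Sum>i\<le>n. a i * (D s * s ^ i)) = (\<Sum>i\<le>n. integral {0..T} (\<lambda>s. a i * (D s * s ^ i)))"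
      by (intro integral_sum integrable_on_mult_right) auto
    also have "\<dots> = 0" by (simp add: orth)
    finally show "integral {0..T} (\<lambda>s. D s * (\<Sum>i\<le>n. a i * s ^ i)) = 0"
      by (simp add: sum_distrib_left mult_ac)
  qed
  have cD2: "continuous_on {0..T} (\<lambda>s. (D s)\<^sup>2)" by (intro continuous_intros D)
  hence iD2: "(\<lambda>s. (D s)\<^sup>2) integrable_on {0..T}" by (rule integrable_continuous_real)
  have cA: "continuous_on {0..T} (\<lambda>s. \<bar>D s\<bar>)" by (intro continuous_intros D)
  hence iA: "(\<lambda>s. \<bar>D s\<bar>) integrable_on {0..T}" by (rule integrable_continuous_real)
  let ?A = "integral {0..T} (\<lambda>s. \<bar>D s\<bar>)"
  have A0: "?A \<ge> 0" by (rule integral_nonneg[OF iA]) simp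
  have "integral {0..T} (\<lambda>s. (D s)\<^sup>2) \<le> e * ?A" if e: "e > 0" for e
  proof -
    obtain g where g: "real_polynomial_function g" "\<And>x. x \<in> {0..T} \<Longrightarrow> \<bar>D x - g x\<bar> < e"
      using Stone_Weierstrass_real_polynomial_function[OF compact_Icc D e] by blast
    then obtain a n where an: "g = (\<lambda>x. \<Sum>i\<le>n. a i * x ^ i)"
      using real_polynomial_function_iff_sum by metis
    have "integral {0..T} (\<lambda>s. (D s)\<^sup>2) = integral {0..T} (\<lambda>s. (D s)\<^sup>2 - D s * g s)"
      using iD2 pw po by (subst Henstock_Kurzweil_Integration.integral_diff) (simp_all add: an)
    also have "\<dots> \<le> integral {0..T} (\<lambda>s. e * \<bar>D s\<bar>)"
    proof (rule integral_le)
      show "(\<lambda>s. (D s)\<^sup>2 - D s * g s) integrable_on {0..T}"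
        unfolding an by (intro integrable_diff iD2 pw)
      show "(\<lambda>s. e * \<bar>D s\<bar>) integrable_on {0..T}" by (intro integrable_on_mult_right iA)
      fix s assume "s \<in> {0..T}"
      have "(D s)\<^sup>2 - D s * g s = D s * (D s - g s)" by (simp add: algebra_simps power2_eq_square)
      also have "\<dots> \<le> \<bar>D s\<bar> * \<bar>D s - g s\<bar>" by (metis abs_ge_self abs_mult)
      also have "\<dots> \<le> \<bar>D s\<bar> * e" using g(2)[OF \<open>s \<in> {0..T}\<close>] by (intro mult_left_mono) auto
      finally show "(D s)\<^sup>2 - D s * g s \<le> e * \<bar>D s\<bar>" by (simp add: mult.commute)
    qed
    finally show ?thesis by simp
  qed
  hence le: "integral {0..T} (\<lambda>s. (D s)\<^sup>2) \<le> 0 + e" if "e > 0" for e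
  proof -
    have "integral {0..T} (\<lambda>s. (D s)\<^sup>2) \<le> (e / (?A + 1)) * ?A" 
      using \<open>\<And>e. 0 < e \<Longrightarrow> _ \<le> e * ?A\<close>[of "e / (?A + 1)"] that A0 by simp
    also have "\<dots> = e * (?A / (?A + 1))" by simp
    also have "\<dots> \<le> e * 1" using that A0 by (intro mult_left_mono) auto
    finally show ?thesis by simp
  qed
  have "integral {0..T} (\<lambda>s. (D s)\<^sup>2) \<le> 0" by (rule field_le_epsilon) (rule le)
  moreover have "integral {0..T} (\<lambda>s. (D s)\<^sup>2) \<ge> 0" by (rule integral_nonneg[OF iD2]) simp
  ultimately have "integral {0..T} (\<lambda>s. (D s)\<^sup>2) = 0" by simp
  hence "((\<lambda>s. (D s)\<^sup>2) has_integral 0) (cbox 0 T)" using iD2 by (metis cbox_interval integrable_integral)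
  hence "(D t)\<^sup>2 = 0"
    by (intro has_integral_0_cbox_imp_0[of 0 T "\<lambda>s. (D s)\<^sup>2"]) (use cD2 t T in auto)
  thus ?thesis by simp
qed

text \<open>Polynomials in time are admissible test functions, since smoothness and vanishing at the
  final time are all that is required of them.\<close>
lemma weak_derivative_polynomial_tests:
  fixes G H :: "real \<Rightarrow> real"
  assumes T: "0 < T" and G: "continuous_on {0..T} G" and H: "continuous_on {0..T} H"
    and weak: "\<And>p :: real poly. poly p T = 0 \<Longrightarrow>
       - (LINT s:{0..T}|lborel. G s * poly (pderiv p) s) - (LINT s:{0..T}|lborel. H s * poly p s) = g0 * poly p 0"
  shows "t \<in> {0..T} \<Longrightarrow> (G has_vector_derivative H t) (at t within {0..T})" "G 0 = g0"
proof -
  define J where "J s = integral {0..s} H" for s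
  have J: "(J has_vector_derivative H s) (at s within {0..T})" if "s \<in> {0..T}" for s
    unfolding J_def using integral_has_vector_derivative[OF H that] .
  have cJ: "continuous_on {0..T} J"
    using J by (meson continuous_on_vector_derivative)
  have J0: "J 0 = 0" by (simp add: J_def)
  \<comment> \<open>The defect in the integrated equation; it is shown to be orthogonal to all
    powers of s.\<close>
  define D where "D s = G s - g0 - J s" for s
  have cD: "continuous_on {0..T} D" unfolding D_def by (intro continuous_intros G cJ)
  have lebesgue: "(LINT s:{0..T}|lborel. f s) = integral {0..T} f" if "continuous_on {0..T} f" for f :: "real \<Rightarrow> real"
    by (rule set_borel_integral_eq_integral(2)[OF borel_integrable_atLeastAtMost'[OF that]])
  have "integral {0..T} (\<lambda>s. D s * s ^ n) = 0" for n
  proof -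
    \<comment> \<open>A primitive of (n + 1) s^n, with the constant chosen so that it vanishes at T
      and is therefore an admissible test. Integrating J by parts against it turns the weak equation
      into orthogonality of D to s^n.\<close>
    define p :: "real poly" where "p = monom 1 (Suc n) - [:T ^ Suc n:]"
    have pT: "poly p T = 0" by (simp add: p_def poly_monom)
    have p': "poly (pderiv p) s = real (Suc n) * s ^ n" for s
      by (simp add: p_def pderiv_diff pderiv_monom poly_monom pderiv_pCons)
    have cp: "continuous_on {0..T} (poly p)" "continuous_on {0..T} (poly (pderiv p))"
      by (intro continuous_intros)+
    have dp: "(poly p has_vector_derivative poly (pderiv p) s) (at s within {0..T})" for s
      using poly_DERIV[of p s] has_real_derivative_iff_has_vector_derivative has_vector_derivative_at_within by blast
    have i1: "integral {0..T} (\<lambda>s. J s * poly (pderiv p) s + H s * poly p s) = J T * poly p T - J 0 * poly p 0"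
      by (intro integral_unique fundamental_theorem_of_calculus)
         (use T J dp in \<open>auto intro!: has_vector_derivative_mult\<close>)
    have i2: "integral {0..T} (poly (pderiv p)) = poly p T - poly p 0"
      by (intro integral_unique fundamental_theorem_of_calculus) (use T dp in auto)
    have w: "- integral {0..T} (\<lambda>s. G s * poly (pderiv p) s) - integral {0..T} (\<lambda>s. H s * poly p s) = g0 * poly p 0"
      using weak[OF pT] by (subst (asm) (1 2) lebesgue) (intro continuous_intros G H cp)+
    have int: "(\<lambda>s. G s * poly (pderiv p) s) integrable_on {0..T}" "(\<lambda>s. H s * poly p s) integrable_on {0..T}"
       "(\<lambda>s. J s * poly (pderiv p) s) integrable_on {0..T}" "(\<lambda>s. g0 * poly (pderiv p) s) integrable_on {0..T}"
      by (intro integrable_continuous_real continuous_intros G H cJ cp)+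
    have "integral {0..T} (\<lambda>s. D s * poly (pderiv p) s) = 
       integral {0..T} (\<lambda>s. G s * poly (pderiv p) s) - integral {0..T} (\<lambda>s. g0 * poly (pderiv p) s) - integral {0..T} (\<lambda>s. J s * poly (pderiv p) s)"
      unfolding D_def left_diff_distrib
      using int by (simp add: Henstock_Kurzweil_Integration.integral_diff integrable_diff)
    also have "\<dots> = 0"
      using i1 i2 w pT J0 int(2,3) by (simp add: Henstock_Kurzweil_Integration.integral_add)
    finally have "integral {0..T} (\<lambda>s. real (Suc n) * (D s * s ^ n)) = 0"
      by (simp add: p' mult_ac del: of_nat_Suc)
    thus ?thesis by (simp del: of_nat_Suc)
  qed
  hence D0: "D t = 0" if "t \<in> {0..T}" for t
    using continuous_orthogonal_powers_eq_0[OF T cD] that by blast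
  hence GJ: "G s = g0 + J s" if "s \<in> {0..T}" for s using that by (force simp: D_def)
  show "G 0 = g0" using GJ[of 0] T J0 by simp
  assume t: "t \<in> {0..T}"
  have "((\<lambda>s. g0 + J s) has_vector_derivative 0 + H t) (at t within {0..T})"
    by (intro has_vector_derivative_add J t has_vector_derivative_const)
  thus "(G has_vector_derivative H t) (at t within {0..T})"
    using has_vector_derivative_transform[OF t GJ] by simp
qed

section \<open>Test functions: a polynomial in time, one wave in space, a constant amplitude\<close>

definition tw :: "real poly \<Rightarrow> real \<Rightarrow> int \<times> int \<Rightarrow> 'b::real_normed_vector \<Rightarrow> real \<times> (real \<times> real) \<Rightarrow> 'b" where
  "tw p b k c z = (poly p (fst z) * wave b k (snd z)) *\<^sub>R c"

lemma wave_add_pi: "wave (b + pi / 2 + pi / 2) k x = - wave b k x"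
  unfolding wave_def by (simp add: add.assoc[symmetric] cos_add)

lemma wave_line_derivative:
  "((\<lambda>t. wave b k (x + t *\<^sub>R v)) has_real_derivative
     2 * pi * (of_int (fst k) * fst v + of_int (snd k) * snd v) * wave (b + pi / 2) k x) (at 0)"
proof -
  have w: "wave (b + pi / 2) k x = - sin (2 * pi * (of_int (fst k) * fst x + of_int (snd k) * snd x) + b)"
    unfolding wave_def add.assoc[symmetric] by (simp add: cos_add)
  show ?thesis unfolding w unfolding wave_def
    by (auto intro!: derivative_eq_intros simp: algebra_simps)
qed

lemma tw_line_derivative:
  "((\<lambda>t. tw p b k c (z + t *\<^sub>R v)) has_vector_derivative
     (tw (smult (fst v) (pderiv p)) b k c z +
      tw (smult (2 * pi * (of_int (fst k) * fst (snd v) + of_int (snd k) * snd (snd v))) p) (b + pi / 2) k c z)) (at 0)"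
proof -
  have 1: "((\<lambda>t. poly p (fst z + t * fst v)) has_real_derivative fst v * poly (pderiv p) (fst z)) (at 0)"
    using DERIV_chain2[of "poly p" _ "\<lambda>t. fst z + t * fst v" 0 "fst v" UNIV] poly_DERIV[of p "fst z"]
    by (auto intro!: derivative_eq_intros)
  have 2: "((\<lambda>t. wave b k (snd z + t *\<^sub>R snd v)) has_real_derivative
     2 * pi * (of_int (fst k) * fst (snd v) + of_int (snd k) * snd (snd v)) * wave (b + pi / 2) k (snd z)) (at 0)"
    by (rule wave_line_derivative)
  note 3 = has_vector_derivative_scaleR[OF DERIV_mult[OF 1 2] has_vector_derivative_const[of c]]
  have "(\<lambda>t. (poly p (fst (z + t *\<^sub>R v)) * wave b k (snd (z + t *\<^sub>R v))) *\<^sub>R c)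
     = (\<lambda>t. (poly p (fst z + t * fst v) * wave b k (snd z + t *\<^sub>R snd v)) *\<^sub>R c)" by simp
  thus ?thesis unfolding tw_def
    by (simp only:) (rule has_vector_derivative_eq_rhs[OF 3], simp add: algebra_simps flip: scaleR_add_left)
qed

lemma continuous_tw: "continuous_on UNIV (tw p b k c)"
  unfolding tw_def wave_def by (intro continuous_intros)

text \<open>Sums of two such functions with phases b and b + pi/2 form a family closed under
  directional derivatives: a derivative in space shifts the phase by pi/2, and two shifts merely
  change the sign.\<close>

lemma smooth_fun_tw: "smooth_fun (tw p b k c)"
  unfolding smooth_fun_def
proof (intro exI[of _ "{\<lambda>z. tw p b k c z + tw q (b + pi / 2) k c z | p q. True}"] conjI ballI allI)
  have "tw p b k c = (\<lambda>z. tw p b k c z + tw 0 (b + pi / 2) k c z)" by (simp add: fun_eq_iff tw_def)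
  thus "tw p b k c \<in> {\<lambda>z. tw p b k c z + tw q (b + pi / 2) k c z | p q. True}" by blast
next
  fix g assume "g \<in> {\<lambda>z. tw p b k c z + tw q (b + pi / 2) k c z | p q. True}"
  thus "continuous_on UNIV g" by (auto intro!: continuous_intros continuous_tw)
next
  fix g and v :: "real \<times> (real \<times> real)"
  assume "g \<in> {\<lambda>z. tw p b k c z + tw q (b + pi / 2) k c z | p q. True}"
  then obtain p q where g: "g = (\<lambda>z. tw p b k c z + tw q (b + pi / 2) k c z)" by blast
  define m where "m = 2 * pi * (of_int (fst k) * fst (snd v) + of_int (snd k) * snd (snd v))"
  define g' where "g' = (\<lambda>z. tw (smult (fst v) (pderiv p) - smult m q) b k c z + tw (smult m p + smult (fst v) (pderiv q)) (b + pi / 2) k c z)"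
  show "\<exists>g'\<in>{\<lambda>z. tw p b k c z + tw q (b + pi / 2) k c z | p q. True}.
     \<forall>z. ((\<lambda>t. g (z + t *\<^sub>R v)) has_vector_derivative g' z) (at 0)"
  proof (intro bexI[of _ g'] allI)
    fix z
    define b2 where "b2 = b + pi / 2 + pi / 2"
    have w: "wave b2 k x = - wave b k x" for x
      unfolding b2_def by (rule wave_add_pi)
    thus "((\<lambda>t. g (z + t *\<^sub>R v)) has_vector_derivative g' z) (at 0)"
      unfolding g
      by (intro has_vector_derivative_eq_rhs[OF has_vector_derivative_add[OF tw_line_derivative tw_line_derivative]])
         (unfold b2_def[symmetric] m_def[symmetric], simp add: g'_def tw_def w algebra_simps)
  qed (auto simp: g'_def)
qed

lemma pd_tw:
  "pd_t (tw p b k c) s x = (poly (pderiv p) s * wave b k x) *\<^sub>R c"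
  "pd_1 (tw p b k c) s x = (2 * pi * of_int (fst k) * poly p s * wave (b + pi / 2) k x) *\<^sub>R c"
  "pd_2 (tw p b k c) s x = (2 * pi * of_int (snd k) * poly p s * wave (b + pi / 2) k x) *\<^sub>R c"
proof -
  have shift: "((\<lambda>t. f (t + y)) has_vector_derivative d) (at 0) \<Longrightarrow> (f has_vector_derivative d) (at y)" for f d and y :: real
  proof -
    assume d: "((\<lambda>t. f (t + y)) has_vector_derivative d) (at 0)"
    have "((\<lambda>t. t - y) has_vector_derivative 1) (at y)" by (auto intro!: derivative_eq_intros)
    from vector_diff_chain_at[OF this, of "\<lambda>t. f (t + y)" d] d
    show "(f has_vector_derivative d) (at y)" by (simp add: o_def)
  qed
  show "pd_t (tw p b k c) s x = (poly (pderiv p) s * wave b k x) *\<^sub>R c"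
    unfolding pd_t_def
    by (rule vector_derivative_at, rule shift)
       (use tw_line_derivative[of p b k c "(s, x)" "(1, (0, 0))"] in \<open>simp add: tw_def add_ac flip: zero_prod_def\<close>)
  show "pd_1 (tw p b k c) s x = (2 * pi * of_int (fst k) * poly p s * wave (b + pi / 2) k x) *\<^sub>R c"
    unfolding pd_1_def
    by (rule vector_derivative_at, rule shift)
       (use tw_line_derivative[of p b k c "(s, x)" "(0, (1, 0))"] in \<open>cases x, simp add: tw_def add_ac\<close>)
  show "pd_2 (tw p b k c) s x = (2 * pi * of_int (snd k) * poly p s * wave (b + pi / 2) k x) *\<^sub>R c"
    unfolding pd_2_def
    by (rule vector_derivative_at, rule shift)
       (use tw_line_derivative[of p b k c "(s, x)" "(0, (0, 1))"] in \<open>cases x, simp add: tw_def add_ac\<close>)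
qed

lemma periodic_tw: "periodic_st (tw p b k c)"
proof -
  have "wave b k (x + 1, y) = wave b k (x, y)" "wave b k (x, y + 1) = wave b k (x, y)" for x y
  proof -
    have "wave b k (x + 1, y) = cos (2 * pi * (of_int (fst k) * x + of_int (snd k) * y) + b + 2 * pi * of_int (fst k))"
      unfolding wave_def by (simp add: algebra_simps)
    thus "wave b k (x + 1, y) = wave b k (x, y)" unfolding wave_def cos_add cos_int_2pin sin_int_2pin by simp
    have "wave b k (x, y + 1) = cos (2 * pi * (of_int (fst k) * x + of_int (snd k) * y) + b + 2 * pi * of_int (snd k))"
      unfolding wave_def by (simp add: algebra_simps)
    thus "wave b k (x, y + 1) = wave b k (x, y)" unfolding wave_def cos_add cos_int_2pin sin_int_2pin by simp
  qed
  thus ?thesis by (simp add: periodic_st_def tw_def)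
qed

lemma fcoef_1: "fcoef (\<lambda>_. 1) k = (if k = 0 then 1 else 0)"
  unfolding fcoef_torus using integral_ee[of "- k"] by (simp add: ee_uminus)

lemma fcoef_const: "fcoef (\<lambda>_. a) k = (if k = 0 then of_real a else 0)"
  using fcoef_cmult[of a "\<lambda>_. 1" k] by (simp add: fcoef_1)

lemma Int2_wave: "k \<noteq> 0 \<Longrightarrow> Int2 (\<lambda>x. a * wave b k x) = 0"
  by (subst Int2_mult_wave) (simp_all add: fcoef_const)

lemma fcoef_wave: "fcoef (\<lambda>x. a * wave b k x) m = 
   of_real a * ((if m = k then cis b else 0) + (if m = - k then cis (- b) else 0)) / 2"
  by (subst fcoef_mult_wave) (auto simp: fcoef_const eq_neg_iff_add_eq_0 algebra_simps)

lemma stest_tw: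
  assumes "k \<noteq> 0" "poly p T = 0" shows "stest T (tw p b k 1)"
  unfolding stest_def 
  by (intro conjI smooth_fun_tw periodic_tw) (use assms in \<open>simp_all add: tw_def Int2_wave\<close>)

text \<open>The amplitude is orthogonal to the frequency, which makes the field divergence free.
  Testing with it projects the momentum equation onto that direction and removes the
  pressure.\<close>

lemma vtest_tw:
  assumes "k \<noteq> 0" "poly p T = 0" 
  shows "vtest T (tw p b k (- of_int (snd k), of_int (fst k)))"
proof -
  have "Int2 (\<lambda>x. poly p s * wave b k x * a) = 0" for s a
    using Int2_wave[OF assms(1), of "poly p s * a" b] by (simp add: mult_ac)
  from this[of _ "- of_int (snd k)"] this[of _ "of_int (fst k)"] show ?thesis
    unfolding vtest_def pd_tw
    by (intro conjI smooth_fun_tw periodic_tw) (use assms in \<open>simp_all add: tw_def zero_prod_def mult_ac\<close>)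
qed

section \<open>Convolution of coefficient sequences and the transport nonlinearity\<close>

definition cv :: "(int \<times> int \<Rightarrow> complex) \<Rightarrow> (int \<times> int \<Rightarrow> complex) \<Rightarrow> int \<times> int \<Rightarrow> complex" where
  "cv f g k = (\<Sum>\<^sub>\<infinity>m. f m * g (k - m))"

text \<open>The \<open>k\<close>-th Fourier coefficient of \<open>- div (v c)\<close>.\<close>
definition adv :: "(int \<times> int \<Rightarrow> complex) \<Rightarrow> (int \<times> int \<Rightarrow> complex) \<Rightarrow> (int \<times> int \<Rightarrow> complex) \<Rightarrow> int \<times> int \<Rightarrow> complex" where
  "adv v1 v2 c k = - 2 * pi * \<i> * (of_int (fst k) * cv v1 c k + of_int (snd k) * cv v2 c k)"

text \<open>Since \<open>v\<close> is orthogonal to \<open>k\<close>, it is recovered from its component along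
  \<open>(- k\<^sub>2, k\<^sub>1)\<close>, so the pressure never has to be introduced.\<close>
definition perp :: "int \<times> int \<Rightarrow> complex \<Rightarrow> complex \<Rightarrow> complex" where
  "perp k a b = - of_int (snd k) * a + of_int (fst k) * b"

lemma cv_fcoef: "in_L2 f \<Longrightarrow> in_L2 g \<Longrightarrow> cv (fcoef f) (fcoef g) k = fcoef (\<lambda>x. f x * g x) k"
  unfolding cv_def using fcoef_mult by (rule infsumI)

lemma sum_norm_mult_le:
  fixes a b :: "'a \<Rightarrow> complex"
  assumes "(\<Sum>m\<in>P. (norm (a m))\<^sup>2) \<le> A" "(\<Sum>m\<in>P. (norm (b m))\<^sup>2) \<le> B"
  shows "(\<Sum>m\<in>P. norm (a m) * norm (b m)) \<le> (A + B) / 2"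
proof -
  have "(\<Sum>m\<in>P. norm (a m) * norm (b m)) \<le> (\<Sum>m\<in>P. ((norm (a m))\<^sup>2 + (norm (b m))\<^sup>2) / 2)"
  proof (rule sum_mono)
    fix m
    show "norm (a m) * norm (b m) \<le> ((norm (a m))\<^sup>2 + (norm (b m))\<^sup>2) / 2"
      using sum_squares_bound[of "norm (a m)" "norm (b m)"] by (simp add: field_simps)
  qed
  also have "\<dots> = ((\<Sum>m\<in>P. (norm (a m))\<^sup>2) + (\<Sum>m\<in>P. (norm (b m))\<^sup>2)) / 2"
    by (simp add: sum.distrib flip: sum_divide_distrib)
  also have "\<dots> \<le> (A + B) / 2" by (intro divide_right_mono add_mono assms) simp
  finally show ?thesis .
qed

lemma sum_shift_le:
  fixes b :: "int \<times> int \<Rightarrow> real"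
  assumes "\<And>F. finite F \<Longrightarrow> sum b F \<le> B" "finite P"
  shows "(\<Sum>m\<in>P. b (k - m)) \<le> B"
proof -
  have "(\<Sum>m\<in>P. b (k - m)) = sum b ((\<lambda>m. k - m) ` P)"
    by (subst sum.reindex) (auto simp: inj_on_def)
  thus ?thesis using assms by simp
qed

lemma norm_summable_bounded:
  fixes h :: "'a \<Rightarrow> 'b::banach"
  assumes "\<And>F. finite F \<Longrightarrow> F \<subseteq> A \<Longrightarrow> (\<Sum>m\<in>F. norm (h m)) \<le> B"
  shows "(\<lambda>m. norm (h m)) summable_on A" "h summable_on A" "norm (infsum h A) \<le> B"
proof -
  show 1: "(\<lambda>m. norm (h m)) summable_on A"
    by (rule nonneg_bdd_above_summable_on) (auto simp: bdd_above_def intro!: exI[of _ B] assms)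
  show "h summable_on A" using 1 by (rule abs_summable_summable)
  have "norm (infsum h A) \<le> infsum (\<lambda>m. norm (h m)) A" by (rule norm_infsum_bound[OF 1])
  also have "\<dots> \<le> B" by (rule infsum_le_finite_sums[OF 1]) (rule assms)
  finally show "norm (infsum h A) \<le> B" .
qed

lemma cv_summable:
  assumes f: "\<And>F. finite F \<Longrightarrow> (\<Sum>m\<in>F. (norm (f m))\<^sup>2) \<le> A" and g: "\<And>F. finite F \<Longrightarrow> (\<Sum>m\<in>F. (norm (g m))\<^sup>2) \<le> B"
  shows "(\<lambda>m. norm (f m * g (k - m))) summable_on UNIV"
    "((\<lambda>m. f m * g (k - m)) has_sum cv f g k) UNIV"
proof -
  have *: "(\<Sum>m\<in>F. norm (f m * g (k - m))) \<le> (A + B) / 2" if F: "finite F" for F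
    unfolding norm_mult
    by (rule sum_norm_mult_le[OF f[OF F] sum_shift_le[OF g F]])
  show "(\<lambda>m. norm (f m * g (k - m))) summable_on UNIV"
    by (rule norm_summable_bounded(1)[OF *])
  show "((\<lambda>m. f m * g (k - m)) has_sum cv f g k) UNIV"
    unfolding cv_def by (intro has_sum_infsum norm_summable_bounded(2)[OF *])
qed

text \<open>The partial convolutions are finite sums of continuous functions. The weighted bound on
  f makes the tail beyond radius n at most of order 1/(n + 1), uniformly in t, so the convergence is
  uniform.\<close>

lemma continuous_on_cv:
  fixes f g :: "real \<Rightarrow> int \<times> int \<Rightarrow> complex"
  assumes f: "\<And>t F. t \<in> S \<Longrightarrow> finite F \<Longrightarrow> (\<Sum>m\<in>F. (kn m * norm (f t m))\<^sup>2) \<le> A"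
    and g: "\<And>t F. t \<in> S \<Longrightarrow> finite F \<Longrightarrow> (\<Sum>m\<in>F. (norm (g t m))\<^sup>2) \<le> B"
    and f0: "\<And>t. t \<in> S \<Longrightarrow> f t 0 = 0"
    and cf: "\<And>m. continuous_on S (\<lambda>t. f t m)" and cg: "\<And>m. continuous_on S (\<lambda>t. g t m)"
  shows "continuous_on S (\<lambda>t. cv (f t) (g t) k)"
proof (rule uniform_limit_theorem)
  show "\<forall>\<^sub>F n in sequentially. continuous_on S (\<lambda>t. \<Sum>m\<in>{m. knat m \<le> n}. f t m * g t (k - m))"
    by (intro always_eventually allI continuous_intros cf cg)
  show "uniform_limit S (\<lambda>n t. \<Sum>m\<in>{m. knat m \<le> n}. f t m * g t (k - m)) (\<lambda>t. cv (f t) (g t) k) sequentially"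
  proof (rule uniform_limitI)
    fix e :: real assume e: "e > 0"
    obtain N :: nat where N: "(A + B) / 2 / e < N" using reals_Archimedean2 by blast
    show "\<forall>\<^sub>F n in sequentially. \<forall>t\<in>S. dist (\<Sum>m\<in>{m. knat m \<le> n}. f t m * g t (k - m)) (cv (f t) (g t) k) < e"
    proof (rule eventually_sequentiallyI[of N], intro ballI)
      fix n t assume n: "N \<le> n" and t: "t \<in> S"
      have f': "(\<Sum>m\<in>F. (norm (f t m))\<^sup>2) \<le> A" if F: "finite F" for F
      proof -
        have "(\<Sum>m\<in>F. (norm (f t m))\<^sup>2) \<le> (\<Sum>m\<in>F. (kn m * norm (f t m))\<^sup>2)"
        proof (rule sum_mono)
          fix m show "(norm (f t m))\<^sup>2 \<le> (kn m * norm (f t m))\<^sup>2"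
          proof (cases "m = 0")
            case False
            hence "1 * norm (f t m) \<le> kn m * norm (f t m)" by (intro mult_right_mono knat_pos) auto
            thus ?thesis by (intro power_mono) auto
          qed (simp add: f0[OF t])
        qed
        thus ?thesis using f[OF t F] by linarith
      qed
      have fn: "finite {m. knat m \<le> n}" by (rule finite_knat_le)
      have sm: "(\<lambda>m. f t m * g t (k - m)) summable_on UNIV"
        using cv_summable(2)[OF f' g[OF t]] has_sum_imp_summable by blast
      have "cv (f t) (g t) k - (\<Sum>m\<in>{m. knat m \<le> n}. f t m * g t (k - m)) = (\<Sum>\<^sub>\<infinity>m\<in>UNIV - {m. knat m \<le> n}. f t m * g t (k - m))"
        unfolding cv_def using infsum_Diff[OF sm summable_on_finite[OF fn] subset_UNIV] fn by simp
      also have "norm \<dots> \<le> ((A + B) / 2) / (n + 1)"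
      proof (rule norm_summable_bounded(3))
        fix F assume F: "finite F" "F \<subseteq> UNIV - {m. knat m \<le> n}"
        have "(\<Sum>m\<in>F. norm (f t m * g t (k - m))) \<le> (\<Sum>m\<in>F. norm (complex_of_real (kn m) * f t m) * norm (g t (k - m)) / (n + 1))"
        proof (rule sum_mono)
          fix m assume "m \<in> F"
          hence "real n + 1 \<le> kn m" using F(2) by auto
          hence "(real n + 1) * (norm (f t m) * norm (g t (k - m))) \<le> kn m * (norm (f t m) * norm (g t (k - m)))"
            by (intro mult_right_mono) auto
          thus "norm (f t m * g t (k - m)) \<le> norm (complex_of_real (kn m) * f t m) * norm (g t (k - m)) / (n + 1)"
            by (simp add: norm_mult field_simps)
        qed
        also have "\<dots> \<le> ((A + B) / 2) / (n + 1)"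
          unfolding sum_divide_distrib[symmetric]
        proof (rule divide_right_mono[OF sum_norm_mult_le])
          show "(\<Sum>m\<in>F. (norm (complex_of_real (kn m) * f t m))\<^sup>2) \<le> A"
            using f[OF t F(1)] by (simp add: norm_mult)
          show "(\<Sum>m\<in>F. (norm (g t (k - m)))\<^sup>2) \<le> B"
            by (rule sum_shift_le[OF g[OF t] F(1)])
        qed simp
        finally show "(\<Sum>m\<in>F. norm (f t m * g t (k - m))) \<le> ((A + B) / 2) / (n + 1)" .
      qed
      also have "\<dots> < e"
      proof -
        have "(A + B) / 2 / e < real n + 1" using N n by linarith
        hence "(A + B) / 2 < (real n + 1) * e" using e by (simp add: divide_less_eq)
        thus ?thesis by (simp add: divide_less_eq algebra_simps)
      qed
      finally show "dist (\<Sum>m\<in>{m. knat m \<le> n}. f t m * g t (k - m)) (cv (f t) (g t) k) < e"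
        by (simp add: dist_norm norm_minus_commute)
    qed
  qed
qed simp

section \<open>Differential equations for the single modes\<close>

lemma has_vector_derivative_phases:
  fixes f :: "real \<Rightarrow> complex"
  assumes "\<And>b. ((\<lambda>t. Re (cis (- b) * f t)) has_vector_derivative Re (cis (- b) * d)) F"
  shows "(f has_vector_derivative d) F"
proof -
  have "((\<lambda>t. complex_of_real (Re (f t)) + \<i> * complex_of_real (Im (f t))) has_vector_derivative of_real (Re d) + \<i> * of_real (Im d)) F"
    using assms[of 0] assms[of "pi / 2"] 
    by (intro has_vector_derivative_add has_vector_derivative_mult_right has_vector_derivative_of_real)
       (simp_all add: has_real_derivative_iff_has_vector_derivative)
  thus ?thesis by (simp add: complex_eq[symmetric])
qed

lemma eq_phases: "(\<And>b. Re (cis (- b) * z) = Re (cis (- b) * w)) \<Longrightarrow> z = w"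
proof -
  assume *: "\<And>b. Re (cis (- b) * z) = Re (cis (- b) * w)"
  show "z = w" using *[of 0] *[of "pi / 2"] by (simp add: complex_eq_iff)
qed

lemma cis_quarter_shift: "cis (- (b + pi / 2)) = - \<i> * cis (- b)"
proof -
  have "cis (- (pi / 2)) * cis (- b) = cis (- (b + pi / 2))"
    unfolding cis_mult by (rule arg_cong[of _ _ cis]) simp
  thus ?thesis by simp
qed

lemma Re_of_real_mult: "Re (complex_of_real a * z) = a * Re z"
  by simp

text \<open>Testing with a wave of frequency k turns the space integrals into coefficients and
  leaves a one-dimensional weak equation in time. A space derivative shifts the phase of the wave by
  pi/2, which acts as the factor -i on the coefficient; this is where the imaginary unit in
  \<open>adv\<close> comes from.\<close>

lemma theta_ode:
  fixes u :: "real \<Rightarrow> real \<times> real \<Rightarrow> real \<times> real" and th :: "real \<Rightarrow> real \<times> real \<Rightarrow> real"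
  assumes T: "T > 0" and k: "k \<noteq> 0"
    and weak: "\<And>\<phi>. stest T \<phi> \<Longrightarrow>
       - (LINT s:{0..T}|lborel. L2i (th s) (pd_t \<phi> s))
       - (LINT s:{0..T}|lborel. Int2 (\<lambda>x. th s x * inner (u s x) (pd_1 \<phi> s x, pd_2 \<phi> s x)))
       = L2i th0 (\<lambda>x. \<phi> (0, x))"
    and L2: "\<And>s. s \<in> {0..T} \<Longrightarrow> in_L2 (th s)" "\<And>s. s \<in> {0..T} \<Longrightarrow> in_L2 (c1 (u s))"
      "\<And>s. s \<in> {0..T} \<Longrightarrow> in_L2 (c2 (u s))" and th0: "in_L2 th0"
    and cont: "continuous_on {0..T} (\<lambda>s. fcoef (th s) k)"
      "continuous_on {0..T} (\<lambda>s. cv (fcoef (c1 (u s))) (fcoef (th s)) k)"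
      "continuous_on {0..T} (\<lambda>s. cv (fcoef (c2 (u s))) (fcoef (th s)) k)"
  shows "t \<in> {0..T} \<Longrightarrow> ((\<lambda>s. fcoef (th s) k) has_vector_derivative
      adv (fcoef (c1 (u t))) (fcoef (c2 (u t))) (fcoef (th t)) k) (at t within {0..T})"
    and "fcoef (th 0) k = fcoef th0 k"
proof -
  define D where "D s = adv (fcoef (c1 (u s))) (fcoef (c2 (u s))) (fcoef (th s)) k" for s
  have cD: "continuous_on {0..T} D" unfolding D_def adv_def by (intro continuous_intros cont)
  have main: "(t \<in> {0..T} \<longrightarrow> ((\<lambda>s. Re (cis (- b) * fcoef (th s) k)) has_vector_derivative Re (cis (- b) * D t)) (at t within {0..T}))
       \<and> Re (cis (- b) * fcoef (th 0) k) = Re (cis (- b) * fcoef th0 k)" for b t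
  proof -
    have G: "L2i (th s) (pd_t (tw p b k 1) s) = Re (cis (- b) * fcoef (th s) k) * poly (pderiv p) s" if "s \<in> {0..T}" for s p
    proof -
      have "L2i (th s) (pd_t (tw p b k 1) s) = poly (pderiv p) s * Int2 (\<lambda>x. th s x * wave b k x)"
        unfolding L2i_def pd_tw Int2_torus by (simp add: mult_ac flip: Bochner_Integration.integral_mult_right_zero)
      thus ?thesis using that by (simp add: Int2_mult_wave in_L2_imp_integrable L2)
    qed
    have H: "Int2 (\<lambda>x. th s x * inner (u s x) (pd_1 (tw p b k (1::real)) s x, pd_2 (tw p b k (1::real)) s x)) = Re (cis (- b) * D s) * poly p s"
      if s: "s \<in> {0..T}" for s p
    proof -
      let ?f = "\<lambda>x. of_int (fst k) * (c1 (u s) x * th s x) + of_int (snd k) * (c2 (u s) x * th s x)"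
      have i: "integrable torus (\<lambda>x. c1 (u s) x * th s x)" "integrable torus (\<lambda>x. c2 (u s) x * th s x)"
        by (intro integrable_mult_L2 L2 s)+
      have if': "integrable torus ?f" using i by simp
      have ff: "fcoef ?f k = of_int (fst k) * cv (fcoef (c1 (u s))) (fcoef (th s)) k + of_int (snd k) * cv (fcoef (c2 (u s))) (fcoef (th s)) k"
        using i by (simp add: fcoef_add fcoef_cmult cv_fcoef[OF L2(2)[OF s] L2(1)[OF s]] cv_fcoef[OF L2(3)[OF s] L2(1)[OF s]])
      have "(\<lambda>x. th s x * inner (u s x) (pd_1 (tw p b k (1::real)) s x, pd_2 (tw p b k (1::real)) s x)) 
          = (\<lambda>x. 2 * pi * poly p s * (?f x * wave (b + pi / 2) k x))"
        unfolding pd_tw by (simp add: c1_def c2_def inner_prod_def algebra_simps)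
      hence "Int2 (\<lambda>x. th s x * inner (u s x) (pd_1 (tw p b k (1::real)) s x, pd_2 (tw p b k (1::real)) s x))
         = 2 * pi * poly p s * Int2 (\<lambda>x. ?f x * wave (b + pi / 2) k x)"
        unfolding Int2_torus by (simp only: Bochner_Integration.integral_mult_right_zero)
      also have "\<dots> = 2 * pi * poly p s * Re (- \<i> * cis (- b) * fcoef ?f k)"
        unfolding Int2_mult_wave[OF if'] cis_quarter_shift ..
      also have "\<dots> = Re (complex_of_real (2 * pi * poly p s) * (- \<i> * cis (- b) * fcoef ?f k))"
        by (simp only: Re_of_real_mult)
      also have "complex_of_real (2 * pi * poly p s) * (- \<i> * cis (- b) * fcoef ?f k) = complex_of_real (poly p s) * (cis (- b) * D s)"
        unfolding D_def adv_def ff by simp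
      also have "Re \<dots> = poly p s * Re (cis (- b) * D s)" by (simp only: Re_of_real_mult)
      finally show ?thesis by simp
    qed
    have w: "- (LINT s:{0..T}|lborel. Re (cis (- b) * fcoef (th s) k) * poly (pderiv p) s)
      - (LINT s:{0..T}|lborel. Re (cis (- b) * D s) * poly p s) = Re (cis (- b) * fcoef th0 k) * poly p 0" if p: "poly p T = 0" for p
    proof -
      have "L2i th0 (\<lambda>x. tw p b k 1 (0, x)) = poly p 0 * Int2 (\<lambda>x. th0 x * wave b k x)"
        unfolding L2i_def tw_def Int2_torus by (simp add: mult_ac flip: Bochner_Integration.integral_mult_right_zero)
      also have "\<dots> = Re (cis (- b) * fcoef th0 k) * poly p 0"
        by (simp add: Int2_mult_wave in_L2_imp_integrable th0)
      finally have r: "L2i th0 (\<lambda>x. tw p b k 1 (0, x)) = Re (cis (- b) * fcoef th0 k) * poly p 0" .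
      have "(LINT s:{0..T}|lborel. L2i (th s) (pd_t (tw p b k 1) s)) = (LINT s:{0..T}|lborel. Re (cis (- b) * fcoef (th s) k) * poly (pderiv p) s)"
        by (rule set_lebesgue_integral_cong) (simp, use G in blast)
      moreover have "(LINT s:{0..T}|lborel. Int2 (\<lambda>x. th s x * inner (u s x) (pd_1 (tw p b k (1::real)) s x, pd_2 (tw p b k (1::real)) s x)))
         = (LINT s:{0..T}|lborel. Re (cis (- b) * D s) * poly p s)"
        by (rule set_lebesgue_integral_cong) (simp, use H in blast)
      ultimately show ?thesis using weak[OF stest_tw[OF k p, of b]] r by simp
    qed
    have cG: "continuous_on {0..T} (\<lambda>s. Re (cis (- b) * fcoef (th s) k))" "continuous_on {0..T} (\<lambda>s. Re (cis (- b) * D s))"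
      by (intro continuous_intros cont cD)+
    show ?thesis
      using weak_derivative_polynomial_tests[OF T cG w] by blast
  qed
  show "fcoef (th 0) k = fcoef th0 k" by (rule eq_phases) (use main in blast)
  assume "t \<in> {0..T}"
  show "((\<lambda>s. fcoef (th s) k) has_vector_derivative
      adv (fcoef (c1 (u t))) (fcoef (c2 (u t))) (fcoef (th t)) k) (at t within {0..T})"
    unfolding D_def[symmetric] using main \<open>t \<in> {0..T}\<close> by (intro has_vector_derivative_phases) blast
qed

lemma dinner_wave:
  assumes k: "k \<noteq> 0"
  shows "dinner u (\<lambda>x. (a * wave b k x) *\<^sub>R (p, q)) =
    a * kweight k * Re (cis (- b) * (of_real p * fcoef (c1 u) k + of_real q * fcoef (c2 u) k))"
proof -
  let ?U = "fcoef (c1 u)" and ?V = "fcoef (c2 u)"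
  let ?g = "\<lambda>j. kweight j * Re (?U j * cnj (fcoef (c1 (\<lambda>x. (a * wave b k x) *\<^sub>R (p, q))) j)
      + ?V j * cnj (fcoef (c2 (\<lambda>x. (a * wave b k x) *\<^sub>R (p, q))) j))"
  have c: "c1 (\<lambda>x. (a * wave b k x) *\<^sub>R (p, q)) = (\<lambda>x. (a * p) * wave b k x)"
    "c2 (\<lambda>x. (a * wave b k x) *\<^sub>R (p, q)) = (\<lambda>x. (a * q) * wave b k x)"
    by (simp_all add: c1_def c2_def mult_ac)
  have ne: "k \<noteq> - k" using k by (auto simp: prod_eq_iff)
  have "dinner u (\<lambda>x. (a * wave b k x) *\<^sub>R (p, q)) = infsum ?g UNIV" by (simp add: dinner_def)
  \<comment> \<open>A real wave has only these two frequencies, and their contributions are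
    conjugate before real parts are taken.\<close>
  also have "\<dots> = infsum ?g {k, - k}"
    unfolding c fcoef_wave by (rule infsum_cong_neutral) auto
  also have "\<dots> = ?g k + ?g (- k)" using ne by simp
  also have "kweight (- k) = kweight k" by (simp add: kweight_def)
  hence "?g k + ?g (- k) = a * kweight k * Re (cis (- b) * (of_real p * ?U k + of_real q * ?V k))"
    using ne ne[symmetric] unfolding c fcoef_wave fcoef_uminus_index by (simp add: algebra_simps)
  finally show ?thesis .
qed

text \<open>Against a single wave the inner product of V is \<open>kweight k\<close> times that of
  L^2, so the regularisation appears only as a scalar factor in front of the time derivative. The
  factor is positive, hence the initial coefficient can be read off too.\<close>

lemma velocity_ode:
  fixes u :: "real \<Rightarrow> real \<times> real \<Rightarrow> real \<times> real" and th :: "real \<Rightarrow> real \<times> real \<Rightarrow> real"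
  assumes T: "T > 0" and k: "k \<noteq> 0"
    and weak: "\<And>F. vtest T F \<Longrightarrow>
       - (LINT s:{0..T}|lborel. L2iv (u s) (pd_t F s))
       - \<alpha>\<^sup>2 * (LINT s:{0..T}|lborel. dinner (u s) (pd_t F s))
       - (LINT s:{0..T}|lborel. Int2 (\<lambda>x. fst (u s x) * inner (u s x) (pd_1 F s x)
                                       + snd (u s x) * inner (u s x) (pd_2 F s x)))
       = L2iv u0 (\<lambda>x. F (0, x)) + \<alpha>\<^sup>2 * dinner u0 (\<lambda>x. F (0, x))
         + (LINT s:{0..T}|lborel. Int2 (\<lambda>x. th s x * snd (F (s, x))))"
    and L2: "\<And>s. s \<in> {0..T} \<Longrightarrow> in_L2 (th s)" "\<And>s. s \<in> {0..T} \<Longrightarrow> in_L2 (c1 (u s))"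
      "\<And>s. s \<in> {0..T} \<Longrightarrow> in_L2 (c2 (u s))" and u0: "in_L2 (c1 u0)" "in_L2 (c2 u0)"
    and cont: "continuous_on {0..T} (\<lambda>s. fcoef (th s) k)"
      "continuous_on {0..T} (\<lambda>s. fcoef (c1 (u s)) k)" "continuous_on {0..T} (\<lambda>s. fcoef (c2 (u s)) k)"
      "continuous_on {0..T} (\<lambda>s. cv (fcoef (c1 (u s))) (fcoef (c1 (u s))) k)"
      "continuous_on {0..T} (\<lambda>s. cv (fcoef (c1 (u s))) (fcoef (c2 (u s))) k)"
      "continuous_on {0..T} (\<lambda>s. cv (fcoef (c2 (u s))) (fcoef (c1 (u s))) k)"
      "continuous_on {0..T} (\<lambda>s. cv (fcoef (c2 (u s))) (fcoef (c2 (u s))) k)"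
  shows "t \<in> {0..T} \<Longrightarrow> ((\<lambda>s. of_real (1 + \<alpha>\<^sup>2 * kweight k) *
         perp k (fcoef (c1 (u s)) k) (fcoef (c2 (u s)) k)) has_vector_derivative
      perp k (adv (fcoef (c1 (u t))) (fcoef (c2 (u t))) (fcoef (c1 (u t))) k)
        (adv (fcoef (c1 (u t))) (fcoef (c2 (u t))) (fcoef (c2 (u t))) k + fcoef (th t) k)) (at t within {0..T})"
    and "perp k (fcoef (c1 (u 0)) k) (fcoef (c2 (u 0)) k) = perp k (fcoef (c1 u0) k) (fcoef (c2 u0) k)"
proof -
  define c :: real where "c = 1 + \<alpha>\<^sup>2 * kweight k"
  have kw: "0 \<le> kweight k" by (simp add: kweight_def)
  have c: "c > 0" unfolding c_def by (intro add_pos_nonneg mult_nonneg_nonneg kw) auto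
  define Z where "Z = (\<lambda>v. perp k (fcoef (c1 v) k) (fcoef (c2 v) k))"
  define A where "A s = perp k (adv (fcoef (c1 (u s))) (fcoef (c2 (u s))) (fcoef (c1 (u s))) k)
     (adv (fcoef (c1 (u s))) (fcoef (c2 (u s))) (fcoef (c2 (u s))) k)" for s
  define D where "D s = A s + of_int (fst k) * fcoef (th s) k" for s
  have cA: "continuous_on {0..T} A" unfolding A_def perp_def adv_def by (intro continuous_intros cont)
  have cD: "continuous_on {0..T} D" unfolding D_def by (intro continuous_intros cont cA)
  have cZ: "continuous_on {0..T} (\<lambda>s. Z (u s))" unfolding Z_def perp_def by (intro continuous_intros cont)
  let ?kp = "(- of_int (snd k) :: real, of_int (fst k) :: real)"
  have L2iv: "L2iv v (\<lambda>x. (a * wave b k x) *\<^sub>R ?kp) = a * Re (cis (- b) * Z v)"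
    if v: "in_L2 (c1 v)" "in_L2 (c2 v)" for v a b
  proof -
    let ?f = "\<lambda>x. - of_int (snd k) * c1 v x + of_int (fst k) * c2 v x"
    have i: "integrable torus (c1 v)" "integrable torus (c2 v)" using v by (simp_all add: in_L2_imp_integrable)
    have i1: "integrable torus (\<lambda>x. - of_int (snd k) * c1 v x)" "integrable torus (\<lambda>x. of_int (fst k) * c2 v x)"
      by (intro integrable_mult_right i)+
    have if': "integrable torus ?f" using i1 by (rule Bochner_Integration.integrable_add)
    have ff: "fcoef ?f k = Z v"
      unfolding fcoef_add[OF i1] fcoef_cmult Z_def perp_def by simp
    have "(\<lambda>x. inner (v x) ((a * wave b k x) *\<^sub>R ?kp)) = (\<lambda>x. a * (?f x * wave b k x))"
      by (simp add: c1_def c2_def inner_prod_def algebra_simps)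
    hence "L2iv v (\<lambda>x. (a * wave b k x) *\<^sub>R ?kp) = a * Int2 (\<lambda>x. ?f x * wave b k x)"
      unfolding L2iv_def Int2_torus by (simp only: Bochner_Integration.integral_mult_right_zero)
    thus ?thesis unfolding Int2_mult_wave[OF if'] ff .
  qed
  have main: "(t \<in> {0..T} \<longrightarrow> ((\<lambda>s. Re (cis (- b) * (of_real c * Z (u s)))) has_vector_derivative Re (cis (- b) * D t)) (at t within {0..T}))
       \<and> Re (cis (- b) * (of_real c * Z (u 0))) = Re (cis (- b) * (of_real c * Z u0))" for b t
  proof -
    have Rc: "Re (cis (- b) * (of_real c * z)) = c * Re (cis (- b) * z)" for z
      unfolding Re_of_real_mult[symmetric] by (simp only: mult_ac)
    have G: "L2iv (u s) (pd_t (tw p b k ?kp) s) = Re (cis (- b) * Z (u s)) * poly (pderiv p) s" if s: "s \<in> {0..T}" for s p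
      unfolding pd_tw using L2iv[OF L2(2)[OF s] L2(3)[OF s]] by simp
    have G': "dinner (u s) (pd_t (tw p b k ?kp) s) = kweight k * (Re (cis (- b) * Z (u s)) * poly (pderiv p) s)" for s p
      unfolding pd_tw dinner_wave[OF k] Z_def perp_def by simp
    have H: "Int2 (\<lambda>x. fst (u s x) * inner (u s x) (pd_1 (tw p b k ?kp) s x)
                 + snd (u s x) * inner (u s x) (pd_2 (tw p b k ?kp) s x)) = Re (cis (- b) * A s) * poly p s"
      if s: "s \<in> {0..T}" for s p
    proof -
      let ?u = "c1 (u s)" and ?v = "c2 (u s)"
      \<comment> \<open>The entries of the tensor product of k with (-k2, k1), that is, the
        coefficients with which the four products of velocity components meet the gradient of the
        test field.\<close>
      define a1 a2 a3 a4 :: real where a: "a1 = - (of_int (fst k) * of_int (snd k))" "a2 = (of_int (fst k))\<^sup>2"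
        "a3 = - (of_int (snd k))\<^sup>2" "a4 = of_int (fst k) * of_int (snd k)"
      let ?f = "\<lambda>x. a1 * (?u x * ?u x) + a2 * (?u x * ?v x) + (a3 * (?v x * ?u x) + a4 * (?v x * ?v x))"
      have i: "integrable torus (\<lambda>x. a * (?u x * ?u x))" "integrable torus (\<lambda>x. a * (?u x * ?v x))"
        "integrable torus (\<lambda>x. a * (?v x * ?u x))" "integrable torus (\<lambda>x. a * (?v x * ?v x))" for a
        by (intro integrable_mult_right integrable_mult_L2 L2 s)+
      have if': "integrable torus ?f" by (intro Bochner_Integration.integrable_add i)
      have fa: "fcoef ?f k = of_real a1 * cv (fcoef ?u) (fcoef ?u) k + of_real a2 * cv (fcoef ?u) (fcoef ?v) k
        + (of_real a3 * cv (fcoef ?v) (fcoef ?u) k + of_real a4 * cv (fcoef ?v) (fcoef ?v) k)"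
        using L2(2,3)[OF s] i by (simp add: fcoef_add fcoef_cmult cv_fcoef)
      have ff: "2 * pi * (- \<i>) * fcoef ?f k = A s"
        unfolding fa unfolding A_def perp_def adv_def a by (simp add: algebra_simps power2_eq_square)
      have "(\<lambda>x. fst (u s x) * inner (u s x) (pd_1 (tw p b k ?kp) s x) + snd (u s x) * inner (u s x) (pd_2 (tw p b k ?kp) s x))
          = (\<lambda>x. 2 * pi * poly p s * (?f x * wave (b + pi / 2) k x))"
        unfolding pd_tw a by (simp add: c1_def c2_def inner_prod_def algebra_simps power2_eq_square)
      hence "Int2 (\<lambda>x. fst (u s x) * inner (u s x) (pd_1 (tw p b k ?kp) s x) + snd (u s x) * inner (u s x) (pd_2 (tw p b k ?kp) s x))
         = 2 * pi * poly p s * Int2 (\<lambda>x. ?f x * wave (b + pi / 2) k x)"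
        unfolding Int2_torus by (simp only: Bochner_Integration.integral_mult_right_zero)
      also have "\<dots> = 2 * pi * poly p s * Re (- \<i> * cis (- b) * fcoef ?f k)"
        unfolding Int2_mult_wave[OF if'] cis_quarter_shift ..
      also have "\<dots> = Re (complex_of_real (2 * pi * poly p s) * (- \<i> * cis (- b) * fcoef ?f k))"
        by (simp only: Re_of_real_mult)
      also have "complex_of_real (2 * pi * poly p s) * (- \<i> * cis (- b) * fcoef ?f k) = complex_of_real (poly p s) * (cis (- b) * A s)"
        unfolding ff[symmetric] by (simp only: of_real_mult of_real_numeral mult_ac)
      also have "Re \<dots> = poly p s * Re (cis (- b) * A s)" by (simp only: Re_of_real_mult)
      finally show ?thesis by simp
    qed
    have Q: "Int2 (\<lambda>x. th s x * snd (tw p b k ?kp (s, x))) = Re (cis (- b) * (of_int (fst k) * fcoef (th s) k)) * poly p s"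
      if s: "s \<in> {0..T}" for s p
    proof -
      have "Int2 (\<lambda>x. th s x * snd (tw p b k ?kp (s, x))) = poly p s * of_int (fst k) * Int2 (\<lambda>x. th s x * wave b k x)"
        unfolding tw_def Int2_torus by (simp add: mult_ac flip: Bochner_Integration.integral_mult_right_zero)
      also have "\<dots> = poly p s * Re (complex_of_real (of_int (fst k)) * (cis (- b) * fcoef (th s) k))"
        by (simp only: Int2_mult_wave[OF in_L2_imp_integrable[OF L2(1)[OF s]]] Re_of_real_mult mult.assoc)
      finally show ?thesis by (simp only: of_real_of_int_eq mult_ac)
    qed
    have w: "- (LINT s:{0..T}|lborel. Re (cis (- b) * (of_real c * Z (u s))) * poly (pderiv p) s)
      - (LINT s:{0..T}|lborel. Re (cis (- b) * D s) * poly p s) = Re (cis (- b) * (of_real c * Z u0)) * poly p 0" if p: "poly p T = 0" for p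
    proof -
      have r1: "L2iv u0 (\<lambda>x. tw p b k ?kp (0, x)) = poly p 0 * Re (cis (- b) * Z u0)"
        using L2iv[OF u0] by (simp add: tw_def)
      have r2: "dinner u0 (\<lambda>x. tw p b k ?kp (0, x)) = poly p 0 * kweight k * Re (cis (- b) * Z u0)"
        unfolding tw_def fst_conv snd_conv dinner_wave[OF k] Z_def perp_def by simp
      let ?I = "\<lambda>f. (LINT s:{0..T}|lborel. f s)"
      have e1: "?I (\<lambda>s. L2iv (u s) (pd_t (tw p b k ?kp) s)) = ?I (\<lambda>s. Re (cis (- b) * Z (u s)) * poly (pderiv p) s)"
        by (rule set_lebesgue_integral_cong) (simp, use G in blast)
      have e2: "?I (\<lambda>s. dinner (u s) (pd_t (tw p b k ?kp) s)) = kweight k * ?I (\<lambda>s. Re (cis (- b) * Z (u s)) * poly (pderiv p) s)"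
        unfolding G' by (rule set_integral_mult_right)
      have e3: "?I (\<lambda>s. Int2 (\<lambda>x. fst (u s x) * inner (u s x) (pd_1 (tw p b k ?kp) s x)
                 + snd (u s x) * inner (u s x) (pd_2 (tw p b k ?kp) s x))) = ?I (\<lambda>s. Re (cis (- b) * A s) * poly p s)"
        by (rule set_lebesgue_integral_cong) (simp, use H in blast)
      have e4: "?I (\<lambda>s. Int2 (\<lambda>x. th s x * snd (tw p b k ?kp (s, x)))) = ?I (\<lambda>s. Re (cis (- b) * (of_int (fst k) * fcoef (th s) k)) * poly p s)"
        by (rule set_lebesgue_integral_cong) (simp, use Q in blast)
      have "?I (\<lambda>s. Re (cis (- b) * D s) * poly p s) = ?I (\<lambda>s. Re (cis (- b) * A s) * poly p s + Re (cis (- b) * (of_int (fst k) * fcoef (th s) k)) * poly p s)"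
        unfolding D_def by (simp only: distrib_left distrib_right plus_complex.simps)
      also have "\<dots> = ?I (\<lambda>s. Re (cis (- b) * A s) * poly p s) + ?I (\<lambda>s. Re (cis (- b) * (of_int (fst k) * fcoef (th s) k)) * poly p s)"
        by (rule set_integral_add(2); intro borel_integrable_atLeastAtMost' continuous_intros cA cont)
      finally have e5: "?I (\<lambda>s. Re (cis (- b) * D s) * poly p s) = \<dots>" .
      have e6: "?I (\<lambda>s. Re (cis (- b) * (of_real c * Z (u s))) * poly (pderiv p) s) = c * ?I (\<lambda>s. Re (cis (- b) * Z (u s)) * poly (pderiv p) s)"
        unfolding Rc mult.assoc by (rule set_integral_mult_right)
      have gen: "- X - a * (q * X) - Y = p0 * z0 + a * (p0 * q * z0) + Q \<Longrightarrow>
         - ((1 + a * q) * X) - (Y + Q) = ((1 + a * q) * z0) * p0" for X Y Q a q p0 z0 :: real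
        by (simp add: algebra_simps)
      from weak[OF vtest_tw[OF k p, of b]]
      have W: "- ?I (\<lambda>s. Re (cis (- b) * Z (u s)) * poly (pderiv p) s)
          - \<alpha>\<^sup>2 * (kweight k * ?I (\<lambda>s. Re (cis (- b) * Z (u s)) * poly (pderiv p) s))
          - ?I (\<lambda>s. Re (cis (- b) * A s) * poly p s)
        = poly p 0 * Re (cis (- b) * Z u0) + \<alpha>\<^sup>2 * (poly p 0 * kweight k * Re (cis (- b) * Z u0))
          + ?I (\<lambda>s. Re (cis (- b) * (of_int (fst k) * fcoef (th s) k)) * poly p s)"
        unfolding e1 e2 e3 e4 r1 r2 .
      show ?thesis unfolding e5 e6 unfolding Rc unfolding c_def by (rule gen[OF W])
    qed
    have cG: "continuous_on {0..T} (\<lambda>s. Re (cis (- b) * (of_real c * Z (u s))))" "continuous_on {0..T} (\<lambda>s. Re (cis (- b) * D s))"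
      by (intro continuous_intros cZ cD)+
    show ?thesis
      using weak_derivative_polynomial_tests[OF T cG w] by blast
  qed
  have "of_real c * Z (u 0) = of_real c * Z u0" by (rule eq_phases) (use main in blast)
  thus "perp k (fcoef (c1 (u 0)) k) (fcoef (c2 (u 0)) k) = perp k (fcoef (c1 u0) k) (fcoef (c2 u0) k)"
    using c unfolding Z_def by simp
  assume t: "t \<in> {0..T}"
  have "((\<lambda>s. of_real c * Z (u s)) has_vector_derivative D t) (at t within {0..T})"
    using main t by (intro has_vector_derivative_phases) blast
  moreover have "D t = perp k (adv (fcoef (c1 (u t))) (fcoef (c2 (u t))) (fcoef (c1 (u t))) k)
        (adv (fcoef (c1 (u t))) (fcoef (c2 (u t))) (fcoef (c2 (u t))) k + fcoef (th t) k)"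
    unfolding D_def A_def perp_def by (simp only: distrib_left add.assoc)
  ultimately show "((\<lambda>s. of_real (1 + \<alpha>\<^sup>2 * kweight k) *
         perp k (fcoef (c1 (u s)) k) (fcoef (c2 (u s)) k)) has_vector_derivative
      perp k (adv (fcoef (c1 (u t))) (fcoef (c2 (u t))) (fcoef (c1 (u t))) k)
        (adv (fcoef (c1 (u t))) (fcoef (c2 (u t))) (fcoef (c2 (u t))) k + fcoef (th t) k)) (at t within {0..T})"
    unfolding Z_def c_def by simp
qed

section \<open>Commutator and stretching estimates\<close>

text \<open>Bounds are kept as uniform bounds on finite partial sums, so that estimates of series
  can be added, scaled and compared without summability conditions; these are derived only where an
  infinite sum is actually exchanged.\<close>

definition bsum :: "('a \<Rightarrow> real) \<Rightarrow> real \<Rightarrow> bool" where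
  "bsum f B \<longleftrightarrow> (\<forall>F. finite F \<longrightarrow> sum f F \<le> B)"

lemma bsumD: "bsum f B \<Longrightarrow> finite F \<Longrightarrow> sum f F \<le> B"
  by (simp add: bsum_def)

lemma bsum_nonneg: "bsum f B \<Longrightarrow> 0 \<le> B"
  using bsumD[of f B "{}"] by simp

lemma bsum_mono: "bsum g B \<Longrightarrow> (\<And>x. f x \<le> g x) \<Longrightarrow> B \<le> C \<Longrightarrow> bsum f C"
  unfolding bsum_def by (meson order_trans sum_mono)

lemma bsum_add: "bsum f A \<Longrightarrow> bsum g B \<Longrightarrow> bsum (\<lambda>x. f x + g x) (A + B)"
  unfolding bsum_def sum.distrib by (blast intro: add_mono)

lemma bsum_cmult: "bsum f A \<Longrightarrow> 0 \<le> c \<Longrightarrow> bsum (\<lambda>x. c * f x) (c * A)"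
  unfolding bsum_def sum_distrib_left[symmetric] by (blast intro: mult_left_mono)

lemma bsum_Cauchy_Schwarz:
  assumes "bsum (\<lambda>x. (p x)\<^sup>2) A" "bsum (\<lambda>x. (q x)\<^sup>2) B"
  shows "bsum (\<lambda>x. p x * q x) (sqrt (A * B))"
  unfolding bsum_def
proof (intro allI impI)
  fix F :: "'a set" assume F: "finite F"
  have "(\<Sum>x\<in>F. p x * q x)\<^sup>2 \<le> (\<Sum>x\<in>F. (p x)\<^sup>2) * (\<Sum>x\<in>F. (q x)\<^sup>2)"
    by (rule Cauchy_Schwarz_ineq_sum)
  also have "\<dots> \<le> A * B"
    using bsum_nonneg[OF assms(1)] by (intro mult_mono bsumD[OF _ F] assms sum_nonneg) auto
  finally show "(\<Sum>x\<in>F. p x * q x) \<le> sqrt (A * B)" by (rule real_le_rsqrt)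
qed

lemma bsum_finite_support:
  assumes "finite S" "\<And>x. x \<notin> S \<Longrightarrow> f x = 0" "\<And>x. 0 \<le> f x"
  shows "bsum f (sum f S)"
  unfolding bsum_def
proof (intro allI impI)
  fix F :: "'a set" assume F: "finite F"
  have "sum f F = sum f (F \<inter> S)" using F assms(2) by (intro sum.mono_neutral_right) auto
  also have "\<dots> \<le> sum f S" using assms by (intro sum_mono2) auto
  finally show "sum f F \<le> sum f S" .
qed

text \<open>A finite set of pairs lies in the product of its projections, where nonnegativity allows
  summing first over the index that occurs only in a. This inner sum runs over a translate or a
  reflected translate of a.\<close>

lemma bsum_pairs:
  fixes a b :: "int \<times> int \<Rightarrow> real"
  assumes a: "bsum a A" "\<And>x. 0 \<le> a x" and b: "bsum b B" "\<And>x. 0 \<le> b x"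
  shows "bsum (\<lambda>(k, l). a (k - l) * b k) (A * B)" "bsum (\<lambda>(k, l). a (k - l) * b l) (A * B)"
proof -
  have *: "(\<Sum>(k, l)\<in>P. a (k - l) * b k) \<le> A * B" "(\<Sum>(k, l)\<in>P. a (k - l) * b l) \<le> A * B" if P: "finite P" for P
  proof -
    have sub: "P \<subseteq> fst ` P \<times> snd ` P" by force
    have fin: "finite (fst ` P)" "finite (snd ` P)" using P by simp_all
    have "(\<Sum>(k, l)\<in>P. a (k - l) * b k) \<le> (\<Sum>(k, l)\<in>fst ` P \<times> snd ` P. a (k - l) * b k)"
      using a(2) b(2) fin sub by (intro sum_mono2) auto
    also have "\<dots> = (\<Sum>k\<in>fst ` P. (\<Sum>l\<in>snd ` P. a (k - l)) * b k)"
      by (simp add: sum.cartesian_product[symmetric] sum_distrib_right)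
    also have "\<dots> \<le> (\<Sum>k\<in>fst ` P. A * b k)"
      using b(2) fin a(1) by (intro sum_mono mult_right_mono sum_shift_le) (auto simp: bsum_def)
    also have "\<dots> \<le> A * B"
      unfolding sum_distrib_left[symmetric]
      by (intro mult_left_mono bsumD[OF b(1)] fin bsum_nonneg[OF a(1)])
    finally show "(\<Sum>(k, l)\<in>P. a (k - l) * b k) \<le> A * B" .
    have a': "bsum (\<lambda>m. a (- m)) A"
      unfolding bsum_def
    proof (intro allI impI)
      fix F :: "(int \<times> int) set" assume "finite F"
      thus "(\<Sum>m\<in>F. a (- m)) \<le> A" using bsumD[OF a(1), of "uminus ` F"] by (simp add: sum.reindex)
    qed
    have "(\<Sum>(k, l)\<in>P. a (k - l) * b l) \<le> (\<Sum>(k, l)\<in>fst ` P \<times> snd ` P. a (k - l) * b l)"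
      using a(2) b(2) fin sub by (intro sum_mono2) auto
    also have "\<dots> = (\<Sum>l\<in>snd ` P. \<Sum>k\<in>fst ` P. a (k - l) * b l)"
      by (simp add: sum.cartesian_product[symmetric] sum.swap[of _ "snd ` P"])
    also have "\<dots> = (\<Sum>l\<in>snd ` P. (\<Sum>k\<in>fst ` P. a (- (l - k))) * b l)"
      by (simp add: sum_distrib_right)
    also have "\<dots> \<le> (\<Sum>l\<in>snd ` P. A * b l)"
      using b(2) fin a' by (intro sum_mono mult_right_mono sum_shift_le) (auto simp: bsum_def)
    also have "\<dots> \<le> A * B"
      unfolding sum_distrib_left[symmetric]
      by (intro mult_left_mono bsumD[OF b(1)] fin bsum_nonneg[OF a(1)])
    finally show "(\<Sum>(k, l)\<in>P. a (k - l) * b l) \<le> A * B" .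
  qed
  show "bsum (\<lambda>(k, l). a (k - l) * b k) (A * B)" unfolding bsum_def using *(1) by blast
  show "bsum (\<lambda>(k, l). a (k - l) * b l) (A * B)" unfolding bsum_def using *(2) by blast
qed

text \<open>Young's inequality for the trilinear form of one l^1 and two l^2 sequences. The
  arithmetic-geometric mean separates the l^2 factors, so that each pair sum contains only one of
  them.\<close>

lemma bsum_young:
  fixes a b c :: "int \<times> int \<Rightarrow> real"
  assumes a: "bsum a A" "\<And>x. 0 \<le> a x" and b: "bsum (\<lambda>x. (b x)\<^sup>2) B" and c: "bsum (\<lambda>x. (c x)\<^sup>2) C"
  shows "bsum (\<lambda>(k, l). a (k - l) * (b l * c k)) (A * ((B + C) / 2))"
proof (rule bsum_mono)
  show "bsum (\<lambda>x. 1 / 2 * ((\<lambda>(k, l). a (k - l) * (b l)\<^sup>2) x + (\<lambda>(k, l). a (k - l) * (c k)\<^sup>2) x)) (1 / 2 * (A * B + A * C))"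
    by (intro bsum_cmult bsum_add bsum_pairs a b c) auto
  fix x :: "(int \<times> int) \<times> (int \<times> int)"
  obtain k l where x: "x = (k, l)" by (cases x)
  have "b l * c k \<le> 1 / 2 * ((b l)\<^sup>2 + (c k)\<^sup>2)"
    using sum_squares_bound[of "b l" "c k"] by (simp add: field_simps)
  hence "a (k - l) * (b l * c k) \<le> a (k - l) * (1 / 2 * ((b l)\<^sup>2 + (c k)\<^sup>2))"
    by (intro mult_left_mono a)
  thus "(case x of (k, l) \<Rightarrow> a (k - l) * (b l * c k)) \<le>
      1 / 2 * ((\<lambda>(k, l). a (k - l) * (b l)\<^sup>2) x + (\<lambda>(k, l). a (k - l) * (c k)\<^sup>2) x)"
    unfolding x by (simp add: algebra_simps)
qed (simp add: algebra_simps)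

text \<open>The one lattice constant of the estimates. It serves for the third and for the fourth
  inverse power.\<close>

definition lat3 :: real where "lat3 = (\<Sum>\<^sub>\<infinity>k. 1 / kn k ^ 3)"

lemma bsum_lat3: "bsum (\<lambda>k. 1 / kn k ^ 3) lat3"
  and bsum_lat4: "bsum (\<lambda>k. 1 / kn k ^ 4) lat3"
  and lat3_nonneg: "0 \<le> lat3"
proof -
  obtain C where C: "\<And>F. finite F \<Longrightarrow> (\<Sum>k\<in>F. 1 / kn k ^ 3) \<le> C"
    using lattice_sum_inverse_cube by blast
  have sm: "(\<lambda>k. 1 / kn k ^ 3) summable_on UNIV"
    by (rule nonneg_bdd_above_summable_on) (auto simp: bdd_above_def intro!: exI[of _ C] C)
  show 3: "bsum (\<lambda>k. 1 / kn k ^ 3) lat3"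
    unfolding bsum_def lat3_def by (auto intro!: finite_sum_le_infsum sm)
  show "0 \<le> lat3" using 3 by (rule bsum_nonneg)
  show "bsum (\<lambda>k. 1 / kn k ^ 4) lat3"
  proof (rule bsum_mono[OF 3])
    fix k show "1 / kn k ^ 4 \<le> 1 / kn k ^ 3"
    proof (cases "k = 0")
      case False
      hence "kn k ^ 3 \<le> kn k ^ 4" by (intro power_increasing knat_pos) auto
      thus ?thesis using False by (intro divide_left_mono mult_pos_pos) auto
    qed simp
  qed simp
qed

text \<open>A bound on the squared homogeneous Sobolev norm of order n. For positive n the mode 0
  has weight 0 and is invisible, which is why comparisons between orders assume that it
  vanishes.\<close>

definition hb :: "nat \<Rightarrow> (int \<times> int \<Rightarrow> complex) \<Rightarrow> real \<Rightarrow> bool" where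
  "hb n v B \<longleftrightarrow> bsum (\<lambda>m. (kn m ^ n * norm (v m))\<^sup>2) B"

lemma hb_0: "hb 0 v B \<longleftrightarrow> bsum (\<lambda>m. (norm (v m))\<^sup>2) B"
  by (simp add: hb_def)

lemma hb_mono:
  assumes "hb n v B" "m \<le> n" "v 0 = 0"
  shows "hb m v B"
  unfolding hb_def
proof (rule bsum_mono[OF assms(1)[unfolded hb_def]])
  fix k
  show "(kn k ^ m * norm (v k))\<^sup>2 \<le> (kn k ^ n * norm (v k))\<^sup>2"
    using assms(2,3) by (cases "k = 0") (auto intro!: power_mono mult_right_mono power_increasing knat_pos)
qed simp

text \<open>Cauchy-Schwarz against the summable \<open>1 / kn m ^ 4\<close>: in two dimensions
  \<open>H^2\<close> embeds into the absolutely convergent Fourier series.\<close>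

lemma hb_l1:
  assumes "hb 2 v B" "v 0 = 0"
  shows "bsum (\<lambda>m. norm (v m)) (sqrt (lat3 * B))"
proof (rule bsum_mono)
  show "bsum (\<lambda>m. (1 / kn m ^ 2) * (kn m ^ 2 * norm (v m))) (sqrt (lat3 * B))"
    using assms(1) bsum_lat4 by (intro bsum_Cauchy_Schwarz) (simp_all add: hb_def power_divide flip: power_mult)
  fix m show "norm (v m) \<le> (1 / kn m ^ 2) * (kn m ^ 2 * norm (v m))"
    using assms(2) by (cases "m = 0") auto
qed simp

text \<open>The same embedding for the gradient. The second claim spends the sum of
  \<open>1 / kn m ^ 3\<close> instead, so half a derivative more is affordable; it pays for moving
  the weight in \<open>stretching_bound\<close>.\<close>

lemma hb_grad_l1:
  assumes "hb 3 v B"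
  shows "bsum (\<lambda>m. kn m * norm (v m)) (sqrt (lat3 * B))"
    and "bsum (\<lambda>m. sqrt (kn m) * (kn m * norm (v m))) (sqrt (lat3 * B))"
proof -
  show "bsum (\<lambda>m. kn m * norm (v m)) (sqrt (lat3 * B))"
  proof (rule bsum_mono)
    show "bsum (\<lambda>m. (1 / kn m ^ 2) * (kn m ^ 3 * norm (v m))) (sqrt (lat3 * B))"
      using assms bsum_lat4 by (intro bsum_Cauchy_Schwarz) (simp_all add: hb_def power_divide flip: power_mult)
    fix m show "kn m * norm (v m) \<le> (1 / kn m ^ 2) * (kn m ^ 3 * norm (v m))"
      by (cases "m = 0") (auto simp: power2_eq_square power3_eq_cube)
  qed simp
  show "bsum (\<lambda>m. sqrt (kn m) * (kn m * norm (v m))) (sqrt (lat3 * B))"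
  proof (rule bsum_mono)
    have "(1 / (sqrt (kn m)) ^ 3)\<^sup>2 = 1 / kn m ^ 3" for m
    proof -
      have "(1 / (sqrt (kn m)) ^ 3)\<^sup>2 = 1 / ((sqrt (kn m))\<^sup>2) ^ 3"
        by (simp only: power_divide power_mult[symmetric] power_one mult.commute)
      thus ?thesis by simp
    qed
    thus "bsum (\<lambda>m. (1 / (sqrt (kn m)) ^ 3) * (kn m ^ 3 * norm (v m))) (sqrt (lat3 * B))"
      using assms bsum_lat3 by (intro bsum_Cauchy_Schwarz) (simp_all add: hb_def)
    fix m show "sqrt (kn m) * (kn m * norm (v m)) \<le> (1 / (sqrt (kn m)) ^ 3) * (kn m ^ 3 * norm (v m))"
    proof (cases "m = 0")
      case False
      define r where "r = sqrt (kn m)"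
      have r: "r > 0" "kn m = r ^ 2" using False by (simp_all add: r_def)
      show ?thesis unfolding r_def[symmetric] r(2) using r(1)
        by (simp add: field_simps eval_nat_numeral)
    qed simp
  qed simp
qed

text \<open>The substitute for the missing embedding of the gradient of \<open>H^2\<close> fields.
  With \<open>cw\<close> in place of the frequency the sum converges, and its bound decays like
  N^(-1/2).\<close>

lemma hb_cw:
  assumes "hb 2 v B" "N > 0"
  shows "bsum (\<lambda>m. cw N m * norm (v m)) (sqrt (96 / real N * B))"
proof (rule bsum_mono)
  have "bsum (\<lambda>m. (cw N m / kn m ^ 2)\<^sup>2) (96 / real N)"
    unfolding bsum_def using lattice_sum_cw[OF assms(2)] by (simp add: power_divide flip: power_mult)
  thus "bsum (\<lambda>m. (cw N m / kn m ^ 2) * (kn m ^ 2 * norm (v m))) (sqrt (96 / real N * B))"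
    using assms(1) by (intro bsum_Cauchy_Schwarz) (simp_all add: hb_def)
  fix m show "cw N m * norm (v m) \<le> (cw N m / kn m ^ 2) * (kn m ^ 2 * norm (v m))"
    by (cases "m = 0") (auto simp: cw_def)
qed simp

section \<open>Weighted energy contributions of the transport terms\<close>

definition divfree :: "(int \<times> int \<Rightarrow> complex) \<Rightarrow> (int \<times> int \<Rightarrow> complex) \<Rightarrow> bool" where
  "divfree v1 v2 \<longleftrightarrow> (\<forall>k. of_int (fst k) * v1 k + of_int (snd k) * v2 k = 0)"

lemma adv_has_sum:
  assumes "hb 0 v1 A" "hb 0 v2 B" "hb 0 c C"
  shows "((\<lambda>m. - 2 * pi * \<i> * ((of_int (fst k) * v1 m + of_int (snd k) * v2 m) * c (k - m))) has_sum adv v1 v2 c k) UNIV"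
proof -
  have "((\<lambda>m. v1 m * c (k - m)) has_sum cv v1 c k) UNIV" "((\<lambda>m. v2 m * c (k - m)) has_sum cv v2 c k) UNIV"
    using assms by (auto intro!: cv_summable(2) simp: hb_0 bsum_def)
  hence "((\<lambda>m. - 2 * pi * \<i> * (of_int (fst k) * (v1 m * c (k - m)) + of_int (snd k) * (v2 m * c (k - m)))) has_sum adv v1 v2 c k) UNIV"
    unfolding adv_def by (intro has_sum_cmult_right has_sum_add)
  thus ?thesis by (simp add: algebra_simps)
qed

lemma has_sum_reflect:
  fixes f :: "int \<times> int \<Rightarrow> complex"
  assumes "(f has_sum s) UNIV" shows "((\<lambda>l. f (k - l)) has_sum s) UNIV"
proof -
  have "bij_betw (\<lambda>l. k - l) UNIV UNIV"
    by (rule bij_betwI[of _ _ _ "\<lambda>l. k - l"]) auto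
  from has_sum_reindex_bij_betw[OF this, of f s] assms show ?thesis by blast
qed

text \<open>Fubini for an absolutely convergent double series. Passing to a single series over all
  pairs is what later permits exchanging the two frequencies, although the support restricts only
  the first of them.\<close>

lemma infsum_pairs_finite_support:
  fixes h :: "'a \<times> 'b \<Rightarrow> complex"
  assumes h: "bsum (\<lambda>x. norm (h x)) R" and S: "finite S"
    and sup: "\<And>k l. k \<notin> S \<Longrightarrow> h (k, l) = 0"
    and H: "\<And>k. k \<in> S \<Longrightarrow> ((\<lambda>l. h (k, l)) has_sum H k) UNIV"
  shows "infsum h UNIV = (\<Sum>k\<in>S. H k)"
proof -
  have sm: "h summable_on (UNIV \<times> UNIV)"
    using norm_summable_bounded(2)[of UNIV h R] h by (simp add: bsum_def)
  have "infsum h UNIV = (\<Sum>\<^sub>\<infinity>k. \<Sum>\<^sub>\<infinity>l. h (k, l))"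
    using infsum_Sigma'_banach[of "\<lambda>k l. h (k, l)" UNIV "\<lambda>_. UNIV"] sm by simp
  also have "\<dots> = (\<Sum>\<^sub>\<infinity>k\<in>S. \<Sum>\<^sub>\<infinity>l. h (k, l))"
    by (rule infsum_cong_neutral) (auto simp: sup)
  also have "\<dots> = (\<Sum>k\<in>S. H k)" using S infsumI[OF H] by simp
  finally show ?thesis .
qed

lemma norm_dot_le: "norm (of_int (fst k) * a + of_int (snd k) * (b::complex)) \<le> kn k * (norm a + norm b)"
proof -
  have "norm (of_int (fst k) * a + of_int (snd k) * b) \<le> \<bar>real_of_int (fst k)\<bar> * norm a + \<bar>real_of_int (snd k)\<bar> * norm b"
    by (rule order_trans[OF norm_triangle_ineq]) (simp add: norm_mult)
  also have "\<dots> \<le> kn k * norm a + kn k * norm b"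
    unfolding kn_eq by (intro add_mono mult_right_mono) auto
  finally show ?thesis by (simp add: distrib_left)
qed

lemma norm_adv_term:
  "norm (cnj z * (- 2 * pi * \<i> * (d * w))) = 2 * pi * (norm d * (norm w * norm z))"
  by (simp add: norm_mult)

text \<open>Exchanging the two frequencies turns the sum into its negative conjugate, so only the
  difference of the two weights survives in the real part.\<close>
lemma transport_commutator:
  assumes N: "N > 0" and div: "divfree v1 v2"
    and sym: "\<And>k. v1 (- k) = cnj (v1 k)" "\<And>k. v2 (- k) = cnj (v2 k)"
    and v0: "v1 0 = 0" "v2 0 = 0" and v: "hb 2 v1 B" "hb 2 v2 B" and c: "hb 0 c C"
  shows "\<bar>Re (\<Sum>k | om N k \<noteq> 0. of_real (om N k) * (cnj (c k) * adv v1 v2 c k))\<bar> \<le> 2 * pi * sqrt (96 / real N * B) * C"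
proof -
  let ?S = "{k. om N k \<noteq> 0}"
  define T where "T k l = cnj (c k) * (- 2 * pi * \<i> * ((of_int (fst k) * v1 (k - l) + of_int (snd k) * v2 (k - l)) * c l))" for k l
  define a where "a m = norm (v1 m) + norm (v2 m)" for m
  have a0: "0 \<le> a m" for m by (simp add: a_def)
  have S: "finite ?S" using N by (rule finite_om_support)
  \<comment> \<open>The coefficient of v at k - l is orthogonal to k - l, so k may be replaced by l.
    This yields both bounds \<open>Tk\<close> and \<open>Tl\<close>, and with them the minimum of
    the two frequencies.\<close>
  have dot: "of_int (fst k) * v1 (k - l) + of_int (snd k) * v2 (k - l) = of_int (fst l) * v1 (k - l) + of_int (snd l) * v2 (k - l)" for k l
    using div[unfolded divfree_def, rule_format, of "k - l"] by (simp add: algebra_simps)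
  have Tk: "norm (T k l) \<le> 2 * pi * (kn k * (a (k - l) * (norm (c l) * norm (c k))))" for k l
    unfolding T_def norm_adv_term a_def mult.assoc[symmetric, of "kn k"]
    by (intro mult_left_mono mult_right_mono norm_dot_le) auto
  have Tl: "norm (T k l) \<le> 2 * pi * (kn l * (a (k - l) * (norm (c l) * norm (c k))))" for k l
    unfolding T_def norm_adv_term dot[of k l] a_def mult.assoc[symmetric, of "kn l"]
    by (intro mult_left_mono mult_right_mono norm_dot_le) auto
  have anti: "T l k = - cnj (T k l)" for k l
  proof -
    have "v1 (l - k) = cnj (v1 (k - l))" "v2 (l - k) = cnj (v2 (k - l))"
      using sym[of "k - l"] by simp_all
    thus ?thesis unfolding T_def dot[of k l] by simp
  qed
  have c': "bsum (\<lambda>x. (norm (c x))\<^sup>2) C" using c by (simp add: hb_0)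
  define X where "X = (\<Sum>k\<in>?S. of_real (om N k) * (cnj (c k) * adv v1 v2 c k))"
  define h where "h = (\<lambda>(k, l). of_real (om N k) * T k l)"
  \<comment> \<open>A crude bound of the weighted frequency. It grows with N, but serves only to
    establish absolute convergence and does not enter the final estimate.\<close>
  define R where "R = (\<Sum>k\<in>?S. kn k)"
  have "bsum a (sqrt (lat3 * B) + sqrt (lat3 * B))"
    unfolding a_def by (intro bsum_add hb_l1 v v0)
  from bsum_cmult[OF bsum_young[OF this a0 c' c'], of "2 * pi * R"]
  have hb': "bsum (\<lambda>x. norm (h x)) (2 * pi * R * ((sqrt (lat3 * B) + sqrt (lat3 * B)) * ((C + C) / 2)))"
  proof (rule bsum_mono)
    show "0 \<le> 2 * pi * R" by (simp add: R_def sum_nonneg)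
    fix x :: "(int \<times> int) \<times> (int \<times> int)"
    obtain k l where x: "x = (k, l)" by (cases x)
    have omR: "om N k * kn k \<le> R"
    proof (cases "om N k = 0")
      case False
      have "om N k * kn k \<le> 1 * kn k" by (intro mult_right_mono om_le_1) simp
      also have "1 * kn k \<le> R" unfolding R_def using member_le_sum[of k ?S kn] S False by simp
      finally show ?thesis .
    qed (simp add: R_def sum_nonneg)
    have "norm (h x) = om N k * norm (T k l)" by (simp add: h_def x norm_mult om_nonneg)
    also have "\<dots> \<le> om N k * (2 * pi * (kn k * (a (k - l) * (norm (c l) * norm (c k)))))"
      by (intro mult_left_mono Tk om_nonneg)
    also have "\<dots> = 2 * pi * (om N k * kn k) * (a (k - l) * (norm (c l) * norm (c k)))" by simp
    also have "\<dots> \<le> 2 * pi * R * (a (k - l) * (norm (c l) * norm (c k)))"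
      using omR a0 by (intro mult_right_mono mult_left_mono mult_nonneg_nonneg) auto
    finally show "norm (h x) \<le> 2 * pi * R * (case x of (k, l) \<Rightarrow> a (k - l) * (norm (c l) * norm (c k)))"
      by (simp add: x)
  qed simp
  have hsum: "h summable_on UNIV" by (rule norm_summable_bounded(2), rule bsumD[OF hb'])
  have X: "infsum h UNIV = X"
    unfolding X_def
  proof (rule infsum_pairs_finite_support[OF hb' S])
    fix k assume "k \<in> ?S"
    have "((\<lambda>l. - 2 * pi * \<i> * ((of_int (fst k) * v1 (k - l) + of_int (snd k) * v2 (k - l)) * c (k - (k - l)))) has_sum adv v1 v2 c k) UNIV"
      by (rule has_sum_reflect[OF adv_has_sum]) (use hb_mono[OF v(1) _ v0(1)] hb_mono[OF v(2) _ v0(2)] c in auto)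
    from has_sum_cmult_right[OF has_sum_cmult_right[OF this, of "cnj (c k)"], of "of_real (om N k)"]
    show "((\<lambda>l. h (k, l)) has_sum of_real (om N k) * (cnj (c k) * adv v1 v2 c k)) UNIV"
      by (simp add: h_def T_def)
  qed (simp add: h_def)
  have hs: "(h has_sum X) UNIV" using hsum X by (metis has_sum_infsum)
  hence "((\<lambda>x. h (prod.swap x)) has_sum X) UNIV"
    using has_sum_reindex_bij_betw[of prod.swap UNIV UNIV h X] bij_swap by blast
  hence "((\<lambda>x. cnj (h (prod.swap x))) has_sum cnj X) UNIV" by (simp only: has_sum_cnj_iff)
  from has_sum_add[OF hs this]
  have sum: "((\<lambda>x. h x + cnj (h (prod.swap x))) has_sum X + cnj X) UNIV" .
  have eq: "h x + cnj (h (prod.swap x)) = of_real (om N (fst x) - om N (snd x)) * T (fst x) (snd x)" for x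
  proof -
    have "cnj (T (snd x) (fst x)) = - T (fst x) (snd x)" unfolding anti[of "snd x" "fst x"] by simp
    thus ?thesis unfolding h_def by (simp add: case_prod_beta algebra_simps)
  qed
  have "bsum (\<lambda>m. cw N m * a m) (sqrt (96 / real N * B) + sqrt (96 / real N * B))"
    unfolding a_def distrib_left by (intro bsum_add hb_cw v N)
  from bsum_cmult[OF bsum_young[OF this _ c' c'], of "2 * pi"]
  have "bsum (\<lambda>x. norm (h x + cnj (h (prod.swap x)))) (2 * pi * ((sqrt (96 / real N * B) + sqrt (96 / real N * B)) * ((C + C) / 2)))"
  proof (rule bsum_mono)
    show "0 \<le> cw N x * a x" for x by (intro mult_nonneg_nonneg cw_nonneg a0)
    fix x :: "(int \<times> int) \<times> (int \<times> int)"
    obtain k l where x: "x = (k, l)" by (cases x)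
    let ?A = "a (k - l) * (norm (c l) * norm (c k))"
    have A0: "0 \<le> ?A" using a0 by simp
    have "norm (T k l) \<le> 2 * pi * (min (kn k) (kn l) * ?A)"
      using Tk[of k l] Tl[of k l] by (simp add: min_def)
    hence "\<bar>om N k - om N l\<bar> * norm (T k l) \<le> \<bar>om N k - om N l\<bar> * (2 * pi * (min (kn k) (kn l) * ?A))"
      by (intro mult_left_mono) auto
    also have "\<dots> = 2 * pi * ((\<bar>om N k - om N l\<bar> * min (kn k) (kn l)) * ?A)" by simp
    also have "\<dots> \<le> 2 * pi * (cw N (k - l) * ?A)"
      by (intro mult_left_mono mult_right_mono om_commutator N A0) simp
    finally show "norm (h x + cnj (h (prod.swap x))) \<le> 2 * pi * (case x of (k, l) \<Rightarrow> (cw N (k - l) * a (k - l)) * (norm (c l) * norm (c k)))"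
      unfolding eq x fst_conv snd_conv norm_mult norm_of_real by (simp add: mult.assoc)
  qed simp_all
  hence "norm (infsum (\<lambda>x. h x + cnj (h (prod.swap x))) UNIV) \<le> 2 * pi * ((sqrt (96 / real N * B) + sqrt (96 / real N * B)) * ((C + C) / 2))"
    by (intro norm_summable_bounded(3)) (simp add: bsum_def)
  hence "norm (X + cnj X) \<le> 2 * (2 * pi * sqrt (96 / real N * B) * C)"
    unfolding infsumI[OF sum] by simp
  moreover have "X + cnj X = of_real (2 * Re X)" by (simp add: complex_eq_iff)
  ultimately have "2 * \<bar>Re X\<bar> \<le> 2 * (2 * pi * sqrt (96 / real N * B) * C)"
    by (simp add: norm_of_real abs_mult del: of_real_mult)
  thus ?thesis unfolding X_def[symmetric] by linarith
qed

text \<open>Since w is divergence free, the derivative falls on g, whose gradient has absolutely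
  summable coefficients; Young's inequality then bounds the term by the weighted energies of c and
  w. The remainder of order N^(-1/2) is the price of evaluating the weight at the frequency of
  w.\<close>

lemma stretching_bound:
  assumes N: "N > 0" and div: "divfree w1 w2"
    and w: "hb 0 w1 W" "hb 0 w2 W" and c: "hb 0 c C" and g: "hb 3 g M" "g 0 = 0"
  shows "\<bar>Re (\<Sum>k | om N k \<noteq> 0. of_real (om N k) * (cnj (c k) * adv w1 w2 g k))\<bar>
    \<le> 2 * pi * sqrt (lat3 * M) * ((\<Sum>k | om N k \<noteq> 0. om N k * (norm (c k))\<^sup>2)
       + ((\<Sum>k | om N k \<noteq> 0. om N k * (norm (w1 k))\<^sup>2) + (\<Sum>k | om N k \<noteq> 0. om N k * (norm (w2 k))\<^sup>2)) / 2
       + W / sqrt (real N))"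
proof -
  let ?S = "{k. om N k \<noteq> 0}" and ?A = "sqrt (lat3 * M)"
  let ?Y = "\<lambda>z. \<Sum>k\<in>?S. om N k * (norm (z k :: complex))\<^sup>2"
  have S: "finite ?S" using N by (rule finite_om_support)
  define G where "G m = kn m * norm (g m)" for m
  have G0: "0 \<le> G m" for m by (simp add: G_def)
  have bG: "bsum G ?A" "bsum (\<lambda>m. sqrt (kn m) * G m) ?A"
    unfolding G_def by (rule hb_grad_l1[OF g(1)])+
  have bY: "bsum (\<lambda>k. om N k * (norm (z k))\<^sup>2) (?Y z)" for z :: "int \<times> int \<Rightarrow> complex"
    by (rule bsum_finite_support[OF S]) (auto simp: om_nonneg)
  define h where "h = (\<lambda>(k, m). of_real (om N k) * (cnj (c k) * (- 2 * pi * \<i> * ((of_int (fst k) * w1 m + of_int (snd k) * w2 m) * g (k - m)))))"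
  define R where "R z = 1 / 2 * (?A * ?Y c) + 1 / 2 * (?A * ?Y z) + 1 / (2 * sqrt (real N)) * (?A * W)" for z :: "int \<times> int \<Rightarrow> complex"
  define r where "r z = (\<lambda>x. 1 / 2 * (\<lambda>(k, m). G (k - m) * (om N k * (norm (c k))\<^sup>2)) x
     + 1 / 2 * (\<lambda>(k, m). G (k - m) * (om N m * (norm (z m))\<^sup>2)) x
     + 1 / (2 * sqrt (real N)) * (\<lambda>(k, m). (sqrt (kn (k - m)) * G (k - m)) * (norm (z m))\<^sup>2) x)" for z :: "int \<times> int \<Rightarrow> complex"
  have r: "bsum (r z) (R z)" if "hb 0 z W" for z
    unfolding r_def R_def
    using that
    by (intro bsum_add bsum_cmult bsum_pairs bsum_pairs(2)[of "\<lambda>m. sqrt (kn m) * G m"] bG bY)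
       (simp_all add: G0 om_nonneg hb_0)
  have rb: "G (k - m) * (om N k * (norm (c k) * norm (z m))) \<le> r z (k, m)" for z k m
  proof -
    let ?p = "norm (c k)" and ?q = "norm (z m)" and ?e = "sqrt (kn (k - m)) / sqrt (real N)"
    have "om N k * (?p * ?q) \<le> om N k * (1 / 2 * ?p\<^sup>2 + 1 / 2 * ?q\<^sup>2)"
      using sum_squares_bound[of ?p ?q] by (intro mult_left_mono om_nonneg) (simp add: field_simps)
    also have "\<dots> = 1 / 2 * (om N k * ?p\<^sup>2) + 1 / 2 * (om N k * ?q\<^sup>2)" by (simp add: algebra_simps)
    \<comment> \<open>The weight sits at frequency k but has to multiply w at frequency m. Moving it
      costs half a derivative of g, accounted for by the third term of \<open>r\<close>.\<close>
    also have "om N k * ?q\<^sup>2 \<le> (om N m + ?e) * ?q\<^sup>2"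
      by (intro mult_right_mono om_diff_le_sqrt N) simp
    finally have "om N k * (?p * ?q) \<le> 1 / 2 * (om N k * ?p\<^sup>2) + 1 / 2 * ((om N m + ?e) * ?q\<^sup>2)" by simp
    hence "G (k - m) * (om N k * (?p * ?q)) \<le> G (k - m) * (1 / 2 * (om N k * ?p\<^sup>2) + 1 / 2 * ((om N m + ?e) * ?q\<^sup>2))"
      by (intro mult_left_mono G0)
    also have "\<dots> = r z (k, m)" using N by (simp add: r_def field_simps)
    finally show ?thesis .
  qed
  from bsum_cmult[OF bsum_add[OF r[OF w(1)] r[OF w(2)]], of "2 * pi"]
  have hb': "bsum (\<lambda>x. norm (h x)) (2 * pi * (R w1 + R w2))"
  proof (rule bsum_mono)
    fix x :: "(int \<times> int) \<times> (int \<times> int)"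
    obtain k m where x: "x = (k, m)" by (cases x)
    have dot: "of_int (fst k) * w1 m + of_int (snd k) * w2 m = of_int (fst (k - m)) * w1 m + of_int (snd (k - m)) * w2 m"
      using div[unfolded divfree_def, rule_format, of m] by (simp add: algebra_simps)
    have "norm (h x) = om N k * (2 * pi * (norm (of_int (fst (k - m)) * w1 m + of_int (snd (k - m)) * w2 m) * (norm (g (k - m)) * norm (c k))))"
      unfolding h_def x prod.case dot norm_mult[of "of_real (om N k)"] norm_adv_term by (simp add: om_nonneg)
    also have "\<dots> \<le> om N k * (2 * pi * ((kn (k - m) * (norm (w1 m) + norm (w2 m))) * (norm (g (k - m)) * norm (c k))))"
      by (intro mult_left_mono mult_right_mono norm_dot_le om_nonneg) auto
    also have "\<dots> = 2 * pi * (G (k - m) * (om N k * (norm (c k) * norm (w1 m))) + G (k - m) * (om N k * (norm (c k) * norm (w2 m))))"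
      by (simp add: G_def algebra_simps)
    also have "\<dots> \<le> 2 * pi * (r w1 x + r w2 x)"
      unfolding x by (intro mult_left_mono add_mono rb) simp
    finally show "norm (h x) \<le> 2 * pi * (r w1 x + r w2 x)" .
  qed simp_all
  have "infsum h UNIV = (\<Sum>k\<in>?S. of_real (om N k) * (cnj (c k) * adv w1 w2 g k))"
  proof (rule infsum_pairs_finite_support[OF hb' S])
    fix k assume "k \<in> ?S"
    have "((\<lambda>m. - 2 * pi * \<i> * ((of_int (fst k) * w1 m + of_int (snd k) * w2 m) * g (k - m))) has_sum adv w1 w2 g k) UNIV"
      by (rule adv_has_sum[OF w hb_mono[OF g(1) _ g(2)]]) simp
    from has_sum_cmult_right[OF has_sum_cmult_right[OF this, of "cnj (c k)"], of "of_real (om N k)"]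
    show "((\<lambda>l. h (k, l)) has_sum of_real (om N k) * (cnj (c k) * adv w1 w2 g k)) UNIV"
      by (simp add: h_def)
  qed (simp add: h_def)
  moreover have "norm (infsum h UNIV) \<le> 2 * pi * (R w1 + R w2)"
    by (rule norm_summable_bounded(3), rule bsumD[OF hb'])
  ultimately have "\<bar>Re (\<Sum>k\<in>?S. of_real (om N k) * (cnj (c k) * adv w1 w2 g k))\<bar> \<le> 2 * pi * (R w1 + R w2)"
    using abs_Re_le_cmod order_trans by metis
  also have "\<dots> = 2 * pi * ?A * (?Y c + (?Y w1 + ?Y w2) / 2 + W / sqrt (real N))"
    unfolding R_def by (simp add: field_simps)
  finally show ?thesis .
qed

section \<open>Regularity of the regularised velocity\<close>

lemma DERIV_norm_sq:
  assumes "(f has_vector_derivative d) (at t within S)"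
  shows "((\<lambda>s. (norm (f s :: complex))\<^sup>2) has_real_derivative 2 * Re (cnj (f t) * d)) (at t within S)"
proof -
  have 1: "((\<lambda>s. Re (f s)) has_real_derivative Re d) (at t within S)"
    unfolding has_real_derivative_iff_has_vector_derivative
    by (rule bounded_linear.has_vector_derivative[OF bounded_linear_Re assms])
  have 2: "((\<lambda>s. Im (f s)) has_real_derivative Im d) (at t within S)"
    unfolding has_real_derivative_iff_has_vector_derivative
    by (rule bounded_linear.has_vector_derivative[OF bounded_linear_Im assms])
  show ?thesis unfolding cmod_power2
    by (rule DERIV_cong[OF DERIV_add[OF DERIV_power[OF 1, of 2] DERIV_power[OF 2, of 2]]])
       (simp add: algebra_simps)
qed

lemma gronwall:
  fixes y y' :: "real \<Rightarrow> real"
  assumes d: "\<And>s. s \<in> {0..T} \<Longrightarrow> (y has_real_derivative y' s) (at s within {0..T})"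
    and le: "\<And>s. s \<in> {0..T} \<Longrightarrow> y' s \<le> a * y s + b" and a: "a \<ge> 0" and b: "b \<ge> 0" and t: "t \<in> {0..T}"
  shows "y t \<le> (y 0 + b * t) * exp (a * t)"
proof (cases "t = 0")
  case False
  hence t0: "t > 0" using t by simp
  \<comment> \<open>The exponential removes the linear term, and since it is at most 1, the source
    adds at most b s; subtracting b s leaves a function that does not increase.\<close>
  define z where "z s = y s * exp (- a * s) - b * s" for s
  have dz: "(z has_real_derivative (y' s - a * y s) * exp (- a * s) - b) (at s within {0..T})" if "s \<in> {0..T}" for s
    unfolding z_def using d[OF that] by (auto intro!: derivative_eq_intros simp: algebra_simps)
  have "z t \<le> z 0"
  proof (rule DERIV_nonpos_imp_decreasing_open[OF less_imp_le[OF t0]])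
    fix s assume s: "0 < s" "s < t"
    hence sT: "s \<in> {0..T}" using t by simp
    have "(z has_real_derivative (y' s - a * y s) * exp (- a * s) - b) (at s)"
      using dz[OF sT] s t by (simp add: at_within_Icc_at)
    moreover have "(y' s - a * y s) * exp (- a * s) - b \<le> 0"
    proof -
      have "(y' s - a * y s) * exp (- a * s) \<le> b * exp (- a * s)"
        using le[OF sT] by (intro mult_right_mono) auto
      also have "\<dots> \<le> b * 1" using a b s by (intro mult_left_mono) auto
      finally show ?thesis by simp
    qed
    ultimately show "\<exists>y. (z has_real_derivative y) (at s) \<and> y \<le> 0" by blast
  next
    have "continuous_on {0..T} z" using dz by (intro DERIV_continuous_on) 
    thus "continuous_on {0..t} z" using t by (auto intro: continuous_on_subset)
  qed
  hence "y t * exp (- a * t) \<le> y 0 + b * t" by (simp add: z_def)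
  hence "y t * exp (- a * t) * exp (a * t) \<le> (y 0 + b * t) * exp (a * t)" by (intro mult_right_mono) auto
  thus ?thesis by (simp add: mult.assoc flip: exp_add)
qed simp

section \<open>Coefficient form of both systems\<close>

definition sq2 :: "int \<times> int \<Rightarrow> real" where
  "sq2 k = (of_int (fst k))\<^sup>2 + (of_int (snd k))\<^sup>2"

lemma kweight_sq2: "kweight k = 4 * pi\<^sup>2 * sq2 k"
  by (simp add: kweight_def sq2_def)

lemma sq2_ge: "(kn k)\<^sup>2 \<le> sq2 k"
  unfolding kn_eq sq2_def by (simp add: max_def)

lemma sq2_pos: "k \<noteq> 0 \<Longrightarrow> 0 < sq2 k"
  by (rule less_le_trans[OF _ sq2_ge]) simp

lemma pi_sq_ge_1: "1 \<le> 4 * pi\<^sup>2"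
proof -
  have "1 \<le> pi" using pi_ge_two by linarith
  from power_mono[OF this, of 2] show ?thesis by simp
qed

lemma kweight_ge: "(kn k)\<^sup>2 \<le> kweight k"
proof -
  have "1 * (kn k)\<^sup>2 \<le> 4 * pi\<^sup>2 * sq2 k" by (intro mult_mono pi_sq_ge_1 sq2_ge) auto
  thus ?thesis by (simp add: kweight_sq2)
qed

lemma kweight_nonneg: "0 \<le> kweight k"
  by (simp add: kweight_def)

text \<open>What the energy argument uses of a solution, for both systems at once: a = 0 is the
  Euler case. The velocity equation is imposed only on its component orthogonal to the frequency,
  and the reality of the velocity appears as the symmetry under k to -k.\<close>

definition fsol :: "real \<Rightarrow> real \<Rightarrow> (real \<Rightarrow> int \<times> int \<Rightarrow> complex) \<Rightarrow> (real \<Rightarrow> int \<times> int \<Rightarrow> complex) \<Rightarrow>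
    (real \<Rightarrow> int \<times> int \<Rightarrow> complex) \<Rightarrow> bool" where
  "fsol a T v1 v2 \<tau> \<longleftrightarrow>
    (\<forall>t\<in>{0..T}. divfree (v1 t) (v2 t) \<and> v1 t 0 = 0 \<and> v2 t 0 = 0 \<and> \<tau> t 0 = 0 \<and>
       (\<forall>k. v1 t (- k) = cnj (v1 t k) \<and> v2 t (- k) = cnj (v2 t k)) \<and>
       (\<forall>k. k \<noteq> 0 \<longrightarrow>
         ((\<lambda>s. of_real (1 + a\<^sup>2 * kweight k) * perp k (v1 s k) (v2 s k)) has_vector_derivative
            perp k (adv (v1 t) (v2 t) (v1 t) k) (adv (v1 t) (v2 t) (v2 t) k + \<tau> t k)) (at t within {0..T}) \<and>
         ((\<lambda>s. \<tau> s k) has_vector_derivative adv (v1 t) (v2 t) (\<tau> t) k) (at t within {0..T})))"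

lemma perp_recover:
  assumes "divfree v1 v2"
  shows "of_real (sq2 k) * v1 k = - of_int (snd k) * perp k (v1 k) (v2 k)"
    and "of_real (sq2 k) * v2 k = of_int (fst k) * perp k (v1 k) (v2 k)"
proof -
  have d: "of_int (fst k) * v1 k + of_int (snd k) * v2 k = 0" using assms unfolding divfree_def by blast
  have "of_int (fst k) * (of_int (fst k) * v1 k) = - (of_int (fst k) * (of_int (snd k) * v2 k))"
    using arg_cong[OF d, of "\<lambda>x. of_int (fst k) * x"] by (simp add: distrib_left eq_neg_iff_add_eq_0)
  thus "of_real (sq2 k) * v1 k = - of_int (snd k) * perp k (v1 k) (v2 k)"
    unfolding sq2_def perp_def by (simp add: algebra_simps power2_eq_square)
  have "of_int (snd k) * (of_int (snd k) * v2 k) = - (of_int (snd k) * (of_int (fst k) * v1 k))"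
    using arg_cong[OF d, of "\<lambda>x. of_int (snd k) * x"] by (simp add: distrib_left eq_neg_iff_add_eq_0 add.commute)
  thus "of_real (sq2 k) * v2 k = of_int (fst k) * perp k (v1 k) (v2 k)"
    unfolding sq2_def perp_def by (simp add: algebra_simps power2_eq_square)
qed

lemma norm_perp_le: "norm (perp k a b) \<le> kn k * (norm a + norm b)"
proof -
  have "norm (perp k a b) \<le> \<bar>real_of_int (snd k)\<bar> * norm a + \<bar>real_of_int (fst k)\<bar> * norm b"
    unfolding perp_def by (rule order_trans[OF norm_triangle_ineq]) (simp add: norm_mult)
  also have "\<dots> \<le> kn k * norm a + kn k * norm b"
    unfolding kn_eq by (intro add_mono mult_right_mono) auto
  finally show ?thesis by (simp add: distrib_left)
qed

text \<open>A convolution is the limit of its finite truncations, and for finite F the weighted sum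
  is continuous in them; hence a bound uniform in the truncation survives the limit.\<close>

lemma cv_norm_sum_le:
  assumes sm: "hb 0 p A" "hb 0 q B" and F: "finite F" and om: "\<And>k. 0 \<le> w k"
    and le: "\<And>M. finite M \<Longrightarrow> (\<Sum>k\<in>F. w k * (\<Sum>l\<in>M. norm (p l) * norm (q (k - l)))\<^sup>2) \<le> R"
  shows "(\<Sum>k\<in>F. w k * (norm (cv p q k))\<^sup>2) \<le> R"
proof (rule tendsto_upperbound)
  have "((\<lambda>l. p l * q (k - l)) has_sum cv p q k) UNIV" for k
    by (rule cv_summable(2)) (use sm in \<open>auto simp: hb_0 bsum_def\<close>)
  hence "((\<lambda>M. \<Sum>l\<in>M. p l * q (k - l)) \<longlongrightarrow> cv p q k) (finite_subsets_at_top UNIV)" for k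
    by (simp add: has_sum_def)
  thus "((\<lambda>M. \<Sum>k\<in>F. w k * (norm (\<Sum>l\<in>M. p l * q (k - l)))\<^sup>2) \<longlongrightarrow> (\<Sum>k\<in>F. w k * (norm (cv p q k))\<^sup>2)) (finite_subsets_at_top UNIV)"
    by (intro tendsto_intros)
  show "\<forall>\<^sub>F M in finite_subsets_at_top UNIV. (\<Sum>k\<in>F. w k * (norm (\<Sum>l\<in>M. p l * q (k - l)))\<^sup>2) \<le> R"
  proof (rule eventually_finite_subsets_at_top_weakI)
    fix M :: "(int \<times> int) set" assume M: "finite M"
    have "(\<Sum>k\<in>F. w k * (norm (\<Sum>l\<in>M. p l * q (k - l)))\<^sup>2) \<le> (\<Sum>k\<in>F. w k * (\<Sum>l\<in>M. norm (p l) * norm (q (k - l)))\<^sup>2)"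
      by (intro sum_mono mult_left_mono om power_mono sum_norm_le) (auto simp: norm_mult)
    thus "(\<Sum>k\<in>F. w k * (norm (\<Sum>l\<in>M. p l * q (k - l)))\<^sup>2) \<le> R" using le[OF M] by linarith
  qed
qed simp

text \<open>The product of two \<open>H^1\<close> functions lies in \<open>H\<close> of order 1/2.
  After Cauchy-Schwarz in l, the kernel |k| / (|l|^2 |k - l|^2) has to be summable over l uniformly
  in k, which \<open>sum4\<close> provides.\<close>

lemma cv_half_gain:
  assumes p: "hb 1 p D" "p 0 = 0" and q: "hb 1 q D" "q 0 = 0"
  shows "bsum (\<lambda>k. kn k * (norm (cv p q k))\<^sup>2) (4 * lat3 * (D * D))"
  unfolding bsum_def
proof (intro allI impI cv_norm_sum_le)
  show "hb 0 p D" "hb 0 q D" using hb_mono[OF p(1) _ p(2)] hb_mono[OF q(1) _ q(2)] by auto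
  fix F M :: "(int \<times> int) set" assume F: "finite F" and M: "finite M"
  define f where "f m = (kn m * norm (p m))\<^sup>2" for m
  define g where "g m = (kn m * norm (q m))\<^sup>2" for m
  have bf: "bsum f D" "bsum g D" using p q by (simp_all add: hb_def f_def[abs_def] g_def[abs_def])
  \<comment> \<open>By the triangle inequality the kernel is at most 1/(x y^2) + 1/(x^2 y), and each
    of these is at most the inverse cube of the smaller variable. If l = 0 or l = k, the left side
    is 0 by the convention on division.\<close>
  have tri: "kn k * (1 / (kn l * kn (k - l)))\<^sup>2 \<le> 2 * (1 / kn l ^ 3 + 1 / kn (k - l) ^ 3)" for k l
  proof (cases "l = 0 \<or> k = l")
    case False
    define x y where "x = kn l" and "y = kn (k - l)"
    have xy: "0 < x" "0 < y" using False by (auto simp: x_def y_def)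
    have "kn k \<le> x + y" using knat_triangle[of k l] unfolding x_def y_def by linarith
    hence "kn k * (1 / (x * y))\<^sup>2 \<le> (x + y) * (1 / (x * y))\<^sup>2" by (intro mult_right_mono) auto
    also have "\<dots> = 1 / (x * y\<^sup>2) + 1 / (x\<^sup>2 * y)" using xy by (simp add: field_simps power2_eq_square)
    also have "\<dots> \<le> 2 * (1 / x ^ 3 + 1 / y ^ 3)"
    proof -
      have m: "1 / (a * b\<^sup>2) \<le> 1 / a ^ 3 + 1 / b ^ 3" if "0 < a" "0 < b" for a b :: real
      proof (cases "a \<le> b")
        case True
        hence "a\<^sup>2 \<le> b\<^sup>2" using that by (intro power_mono) auto
        hence "a * a\<^sup>2 \<le> a * b\<^sup>2" using that by (intro mult_left_mono) auto
        hence "1 / (a * b\<^sup>2) \<le> 1 / a ^ 3" unfolding power3_eq_cube power2_eq_square using that by (intro divide_left_mono mult_pos_pos) auto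
        moreover have "0 \<le> 1 / b ^ 3" using that by simp
        ultimately show ?thesis by linarith
      next
        case False
        hence "b * b\<^sup>2 \<le> a * b\<^sup>2" using that by (intro mult_right_mono) auto
        hence "1 / (a * b\<^sup>2) \<le> 1 / b ^ 3" unfolding power3_eq_cube power2_eq_square using that by (intro divide_left_mono mult_pos_pos) auto
        moreover have "0 \<le> 1 / a ^ 3" using that by simp
        ultimately show ?thesis by linarith
      qed
      show ?thesis using m[OF xy] m[OF xy(2,1)] by (simp add: mult.commute)
    qed
    finally show ?thesis by (simp add: x_def y_def)
  qed auto
  have sum4: "(\<Sum>l\<in>M. kn k * (1 / (kn l * kn (k - l)))\<^sup>2) \<le> 4 * lat3" for k
  proof -
    have "(\<Sum>l\<in>M. kn k * (1 / (kn l * kn (k - l)))\<^sup>2) \<le> (\<Sum>l\<in>M. 2 * (1 / kn l ^ 3 + 1 / kn (k - l) ^ 3))"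
      by (intro sum_mono tri)
    also have "\<dots> = 2 * ((\<Sum>l\<in>M. 1 / kn l ^ 3) + (\<Sum>l\<in>M. 1 / kn (k - l) ^ 3))"
      by (simp add: sum_distrib_left sum.distrib distrib_left)
    also have "\<dots> \<le> 2 * (lat3 + lat3)"
      using bsum_lat3 M sum_shift_le[of "\<lambda>k. 1 / kn k ^ 3" lat3 M k]
      by (intro mult_left_mono add_mono) (auto simp: bsum_def)
    finally show ?thesis by simp
  qed
  have "kn k * (\<Sum>l\<in>M. norm (p l) * norm (q (k - l)))\<^sup>2 \<le> 4 * lat3 * (\<Sum>l\<in>M. g (k - l) * f l)" for k
  proof -
    have "(\<Sum>l\<in>M. norm (p l) * norm (q (k - l))) = (\<Sum>l\<in>M. (kn l * norm (p l) * (kn (k - l) * norm (q (k - l)))) * (1 / (kn l * kn (k - l))))"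
      by (intro sum.cong refl) (use p(2) q(2) in \<open>auto simp: field_simps\<close>)
    also have "\<dots>\<^sup>2 \<le> (\<Sum>l\<in>M. (kn l * norm (p l) * (kn (k - l) * norm (q (k - l))))\<^sup>2) * (\<Sum>l\<in>M. (1 / (kn l * kn (k - l)))\<^sup>2)"
      by (rule Cauchy_Schwarz_ineq_sum)
    also have "(\<Sum>l\<in>M. (kn l * norm (p l) * (kn (k - l) * norm (q (k - l))))\<^sup>2) = (\<Sum>l\<in>M. g (k - l) * f l)"
      by (simp add: f_def g_def power_mult_distrib mult_ac)
    finally have "kn k * (\<Sum>l\<in>M. norm (p l) * norm (q (k - l)))\<^sup>2 \<le> kn k * ((\<Sum>l\<in>M. g (k - l) * f l) * (\<Sum>l\<in>M. (1 / (kn l * kn (k - l)))\<^sup>2))"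
      by (intro mult_left_mono) auto
    also have "\<dots> = (\<Sum>l\<in>M. kn k * (1 / (kn l * kn (k - l)))\<^sup>2) * (\<Sum>l\<in>M. g (k - l) * f l)"
      by (simp add: sum_distrib_left mult_ac)
    also have "\<dots> \<le> 4 * lat3 * (\<Sum>l\<in>M. g (k - l) * f l)"
      by (intro mult_right_mono sum4 sum_nonneg) (simp add: f_def g_def)
    finally show ?thesis .
  qed
  hence "(\<Sum>k\<in>F. kn k * (\<Sum>l\<in>M. norm (p l) * norm (q (k - l)))\<^sup>2) \<le> (\<Sum>k\<in>F. 4 * lat3 * (\<Sum>l\<in>M. g (k - l) * f l))"
    by (intro sum_mono)
  also have "\<dots> = 4 * lat3 * (\<Sum>(k, l)\<in>F \<times> M. g (k - l) * f l)"
    by (simp add: sum_distrib_left sum.cartesian_product case_prod_beta)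
  also have "\<dots> \<le> 4 * lat3 * (D * D)"
    using F M lat3_nonneg by (intro mult_left_mono bsumD[OF bsum_pairs(2)[OF bf(2) _ bf(1)]]) (auto simp: f_def g_def)
  finally show "(\<Sum>k\<in>F. kn k * (\<Sum>l\<in>M. norm (p l) * norm (q (k - l)))\<^sup>2) \<le> 4 * lat3 * (D * D)" .
qed auto

text \<open>The n-th power of the output frequency is at most 2^n times the sum of the n-th powers
  of the two input frequencies. So all derivatives fall on one factor, and the other stays in l^1;
  Young's convolution inequality does the rest. The factor 4^n is the square of 2^n.\<close>

lemma cv_algebra:
  assumes p: "hb n p D" "p 0 = 0" "bsum (\<lambda>m. norm (p m)) A" and q: "hb n q D" "q 0 = 0" "bsum (\<lambda>m. norm (q m)) A"
  shows "bsum (\<lambda>k. (kn k ^ n * norm (cv p q k))\<^sup>2) (4 ^ n * (4 * (A * (A * D))))"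
proof -
  have "bsum (\<lambda>k. (kn k ^ n)\<^sup>2 * (norm (cv p q k))\<^sup>2) (4 ^ n * (4 * (A * (A * D))))"
    unfolding bsum_def
  proof (intro allI impI cv_norm_sum_le)
    show "hb 0 p D" "hb 0 q D" using hb_mono[OF p(1) _ p(2)] hb_mono[OF q(1) _ q(2)] by auto
    fix F M :: "(int \<times> int) set" assume F: "finite F" and M: "finite M"
    have A: "0 \<le> A" using p(3) by (rule bsum_nonneg)
    \<comment> \<open>Cauchy-Schwarz with the weight x split into two square roots; the total mass
      of x is at most A.\<close>
    have young: "(\<Sum>k\<in>F. (\<Sum>l\<in>M. x k l * y k l)\<^sup>2) \<le> A * (A * D)"
      if x: "\<And>k. (\<Sum>l\<in>M. x k l) \<le> A" "\<And>k l. 0 \<le> x k l"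
        and xy: "(\<Sum>(k, l)\<in>F \<times> M. x k l * (y k l)\<^sup>2) \<le> A * D" for x y :: "int \<times> int \<Rightarrow> int \<times> int \<Rightarrow> real"
    proof -
      have "(\<Sum>l\<in>M. x k l * y k l)\<^sup>2 \<le> A * (\<Sum>l\<in>M. x k l * (y k l)\<^sup>2)" for k
      proof -
        have "(\<Sum>l\<in>M. x k l * y k l)\<^sup>2 = (\<Sum>l\<in>M. sqrt (x k l) * (sqrt (x k l) * y k l))\<^sup>2"
          using x(2) by (simp flip: mult.assoc)
        also have "\<dots> \<le> (\<Sum>l\<in>M. (sqrt (x k l))\<^sup>2) * (\<Sum>l\<in>M. (sqrt (x k l) * y k l)\<^sup>2)"
          by (rule Cauchy_Schwarz_ineq_sum)
        also have "\<dots> = (\<Sum>l\<in>M. x k l) * (\<Sum>l\<in>M. x k l * (y k l)\<^sup>2)"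
          using x(2) by (simp add: power_mult_distrib)
        also have "\<dots> \<le> A * (\<Sum>l\<in>M. x k l * (y k l)\<^sup>2)"
          using x by (intro mult_right_mono sum_nonneg) auto
        finally show ?thesis .
      qed
      hence "(\<Sum>k\<in>F. (\<Sum>l\<in>M. x k l * y k l)\<^sup>2) \<le> (\<Sum>k\<in>F. A * (\<Sum>l\<in>M. x k l * (y k l)\<^sup>2))"
        by (intro sum_mono)
      also have "\<dots> = A * (\<Sum>(k, l)\<in>F \<times> M. x k l * (y k l)\<^sup>2)"
        by (simp add: sum_distrib_left sum.cartesian_product case_prod_beta)
      also have "\<dots> \<le> A * (A * D)"
        using xy A by (intro mult_left_mono) auto
      finally show ?thesis .
    qed
    have trm: "(kn k ^ n)\<^sup>2 * (\<Sum>l\<in>M. norm (p l) * norm (q (k - l)))\<^sup>2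
       \<le> 4 ^ n * (2 * (\<Sum>l\<in>M. norm (p l) * (kn (k - l) ^ n * norm (q (k - l))))\<^sup>2
          + 2 * (\<Sum>l\<in>M. (kn l ^ n * norm (p l)) * norm (q (k - l)))\<^sup>2)" for k
    proof -
      let ?X = "\<Sum>l\<in>M. norm (p l) * (kn (k - l) ^ n * norm (q (k - l)))"
      let ?Y = "\<Sum>l\<in>M. (kn l ^ n * norm (p l)) * norm (q (k - l))"
      have pw: "kn k ^ n \<le> 2 ^ n * (kn (k - l) ^ n + kn l ^ n)" for l
      proof -
        have "kn k \<le> kn l + kn (k - l)" using knat_triangle[of k l] by linarith
        also have "\<dots> \<le> 2 * max (kn l) (kn (k - l))" by simp
        finally have "kn k ^ n \<le> (2 * max (kn l) (kn (k - l))) ^ n" by (rule power_mono) simp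
        also have "\<dots> = 2 ^ n * (max (kn l) (kn (k - l))) ^ n" by (simp add: power_mult_distrib)
        also have "(max (kn l) (kn (k - l))) ^ n \<le> kn (k - l) ^ n + kn l ^ n" by (simp add: max_def)
        finally show ?thesis by simp
      qed
      have "kn k ^ n * (\<Sum>l\<in>M. norm (p l) * norm (q (k - l))) = (\<Sum>l\<in>M. kn k ^ n * (norm (p l) * norm (q (k - l))))"
        by (simp add: sum_distrib_left)
      also have "\<dots> \<le> (\<Sum>l\<in>M. (2 ^ n * (kn (k - l) ^ n + kn l ^ n)) * (norm (p l) * norm (q (k - l))))"
        by (intro sum_mono mult_right_mono pw) auto
      also have "\<dots> = 2 ^ n * (?X + ?Y)"
        by (simp add: sum_distrib_left sum.distrib algebra_simps)
      finally have "(kn k ^ n * (\<Sum>l\<in>M. norm (p l) * norm (q (k - l))))\<^sup>2 \<le> (2 ^ n * (?X + ?Y))\<^sup>2"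
        by (rule power_mono) (intro mult_nonneg_nonneg sum_nonneg; simp)
      also have "\<dots> = 4 ^ n * (?X + ?Y)\<^sup>2"
        by (simp add: power_mult_distrib power_mult[symmetric] mult.commute[of n 2]) (simp add: power_mult)
      also have "\<dots> \<le> 4 ^ n * (2 * ?X\<^sup>2 + 2 * ?Y\<^sup>2)"
        using sum_squares_bound[of ?X ?Y] by (intro mult_left_mono) (simp_all add: power2_sum)
      finally show ?thesis by (simp add: power_mult_distrib)
    qed
    have "(\<Sum>k\<in>F. (kn k ^ n)\<^sup>2 * (\<Sum>l\<in>M. norm (p l) * norm (q (k - l)))\<^sup>2)
       \<le> 4 ^ n * (2 * (\<Sum>k\<in>F. (\<Sum>l\<in>M. norm (p l) * (kn (k - l) ^ n * norm (q (k - l))))\<^sup>2)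
          + 2 * (\<Sum>k\<in>F. (\<Sum>l\<in>M. (kn l ^ n * norm (p l)) * norm (q (k - l)))\<^sup>2))"
      unfolding sum_distrib_left sum.distrib[symmetric] distrib_left[symmetric]
      by (rule order_trans[OF sum_mono[OF trm]]) (simp add: sum_distrib_left sum.distrib distrib_left)
    also have "\<dots> \<le> 4 ^ n * (2 * (A * (A * D)) + 2 * (A * (A * D)))"
    proof (intro mult_left_mono add_mono)
      show "(\<Sum>k\<in>F. (\<Sum>l\<in>M. norm (p l) * (kn (k - l) ^ n * norm (q (k - l))))\<^sup>2) \<le> A * (A * D)"
      proof (rule young)
        show "(\<Sum>(k, l)\<in>F \<times> M. norm (p l) * (kn (k - l) ^ n * norm (q (k - l)))\<^sup>2) \<le> A * D"
          using bsumD[OF bsum_pairs(2)[OF q(1)[unfolded hb_def] _ p(3)], of "F \<times> M"] F M by (simp add: mult.commute)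
      qed (use bsumD[OF p(3) M] in simp_all)
      have "(\<Sum>k\<in>F. (\<Sum>l\<in>M. norm (q (k - l)) * (kn l ^ n * norm (p l)))\<^sup>2) \<le> A * (A * D)"
      proof (rule young)
        show "(\<Sum>(k, l)\<in>F \<times> M. norm (q (k - l)) * (kn l ^ n * norm (p l))\<^sup>2) \<le> A * D"
          using bsumD[OF bsum_pairs(2)[OF q(3) _ p(1)[unfolded hb_def]], of "F \<times> M"] F M by simp
        show "(\<Sum>l\<in>M. norm (q (k - l))) \<le> A" for k
          using sum_shift_le[of "\<lambda>m. norm (q m)" A M k] q(3) M by (simp add: bsum_def)
      qed simp
      thus "(\<Sum>k\<in>F. (\<Sum>l\<in>M. (kn l ^ n * norm (p l)) * norm (q (k - l)))\<^sup>2) \<le> A * (A * D)"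
        by (simp add: mult.commute)
    qed auto
    finally show "(\<Sum>k\<in>F. (kn k ^ n)\<^sup>2 * (\<Sum>l\<in>M. norm (p l) * norm (q (k - l)))\<^sup>2) \<le> 4 ^ n * (4 * (A * (A * D)))" by simp
  qed auto
  thus ?thesis by (simp add: power_mult_distrib)
qed

section \<open>Regularity gained by inverting the regularised operator\<close>

lemma norm_adv_le: "norm (adv v1 v2 c k) \<le> 2 * pi * (kn k * (norm (cv v1 c k) + norm (cv v2 c k)))"
  unfolding adv_def using norm_dot_le[of k "cv v1 c k" "cv v2 c k"] by (simp add: norm_mult mult.assoc)

lemma sum_square_le_5:
  fixes x y z w u :: real
  shows "(x + y + z + w + u)\<^sup>2 \<le> 5 * (x\<^sup>2 + y\<^sup>2 + z\<^sup>2 + w\<^sup>2 + u\<^sup>2)"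
proof -
  have "0 \<le> (x - y)\<^sup>2 + (x - z)\<^sup>2 + (x - w)\<^sup>2 + (x - u)\<^sup>2 + (y - z)\<^sup>2 + (y - w)\<^sup>2 + (y - u)\<^sup>2 + (z - w)\<^sup>2 + (z - u)\<^sup>2 + (w - u)\<^sup>2"
    by (intro add_nonneg_nonneg) simp_all
  thus ?thesis by (simp add: power2_eq_square algebra_simps)
qed

text \<open>The equation governs a single scalar per mode; dividing by the squared length of k and
  by the symbol of the regularised operator recovers both components.\<close>

lemma velocity_derivative:
  assumes sol: "fsol a T v1 v2 \<tau>" and t: "t \<in> {0..T}" and k: "k \<noteq> 0"
  defines "Z \<equiv> perp k (adv (v1 t) (v2 t) (v1 t) k) (adv (v1 t) (v2 t) (v2 t) k + \<tau> t k)"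
  shows "((\<lambda>s. v1 s k) has_vector_derivative - of_int (snd k) * Z / of_real ((1 + a\<^sup>2 * kweight k) * sq2 k)) (at t within {0..T})"
    and "((\<lambda>s. v2 s k) has_vector_derivative of_int (fst k) * Z / of_real ((1 + a\<^sup>2 * kweight k) * sq2 k)) (at t within {0..T})"
proof -
  define c where "c = 1 + a\<^sup>2 * kweight k"
  have c: "c > 0" unfolding c_def by (intro add_pos_nonneg mult_nonneg_nonneg kweight_nonneg) auto
  have q: "sq2 k > 0" using k by (rule sq2_pos)
  have d: "((\<lambda>s. of_real c * perp k (v1 s k) (v2 s k)) has_vector_derivative Z) (at t within {0..T})"
    using sol t k unfolding fsol_def Z_def c_def by blast
  have r: "v1 s k = - of_int (snd k) / of_real (c * sq2 k) * (of_real c * perp k (v1 s k) (v2 s k))"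
    "v2 s k = of_int (fst k) / of_real (c * sq2 k) * (of_real c * perp k (v1 s k) (v2 s k))" if "s \<in> {0..T}" for s
  proof -
    have "divfree (v1 s) (v2 s)" using sol that unfolding fsol_def by blast
    from perp_recover[OF this, of k] c q
    show "v1 s k = - of_int (snd k) / of_real (c * sq2 k) * (of_real c * perp k (v1 s k) (v2 s k))"
      "v2 s k = of_int (fst k) / of_real (c * sq2 k) * (of_real c * perp k (v1 s k) (v2 s k))"
      by (simp_all add: field_simps)
  qed
  have "((\<lambda>s. - of_int (snd k) / of_real (c * sq2 k) * (of_real c * perp k (v1 s k) (v2 s k))) has_vector_derivative
      - of_int (snd k) / of_real (c * sq2 k) * Z) (at t within {0..T})"
    by (rule has_vector_derivative_mult_right[OF d])
  from has_vector_derivative_transform[OF t r(1) this]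
  show "((\<lambda>s. v1 s k) has_vector_derivative - of_int (snd k) * Z / of_real ((1 + a\<^sup>2 * kweight k) * sq2 k)) (at t within {0..T})"
    by (simp add: c_def)
  have "((\<lambda>s. of_int (fst k) / of_real (c * sq2 k) * (of_real c * perp k (v1 s k) (v2 s k))) has_vector_derivative
      of_int (fst k) / of_real (c * sq2 k) * Z) (at t within {0..T})"
    by (rule has_vector_derivative_mult_right[OF d])
  from has_vector_derivative_transform[OF t r(2) this]
  show "((\<lambda>s. v2 s k) has_vector_derivative of_int (fst k) * Z / of_real ((1 + a\<^sup>2 * kweight k) * sq2 k)) (at t within {0..T})"
    by (simp add: c_def)
qed

text \<open>Inverting 1 - a^2 times the Laplacian gains two derivatives, while the divergence form
  loses only one. Hence the second-order weight of the time derivative is bounded by a first-order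
  weight of the convolutions plus the plain buoyancy, divided by a^2, and Gronwall closes the
  estimate. The weight w is left open because the argument is run twice; w <= 1 keeps the buoyancy
  and the initial data under control.\<close>

lemma voigt_gain:
  assumes sol: "fsol a T v1 v2 \<tau>" and a: "a > 0"
    and w: "\<And>k. 0 \<le> w k" "\<And>k. w k \<le> 1"
    and cvb: "\<And>t p q. t \<in> {0..T} \<Longrightarrow> p \<in> {v1 t, v2 t} \<Longrightarrow> q \<in> {v1 t, v2 t} \<Longrightarrow>
        bsum (\<lambda>k. w k * (kn k * norm (cv p q k))\<^sup>2) K"
    and tau: "\<And>t. t \<in> {0..T} \<Longrightarrow> hb 0 (\<tau> t) M"
    and init: "hb 2 (v1 0) I" "hb 2 (v2 0) I"
  obtains B where "\<And>t. t \<in> {0..T} \<Longrightarrow> bsum (\<lambda>k. w k * (kn k ^ 2 * norm (v1 t k))\<^sup>2) B"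
    "\<And>t. t \<in> {0..T} \<Longrightarrow> bsum (\<lambda>k. w k * (kn k ^ 2 * norm (v2 t k))\<^sup>2) B"
proof -
  \<comment> \<open>The 5 comes from squaring a sum of five terms: four convolutions, each with a
    factor 2 pi, and the buoyancy. The gain 1/a^2 enters squared. In B the rate 1 and the factor 2
    of C come from 2 Re(cnj v d) <= |v|^2 + |d|^2, applied to both components.\<close>
  define C where "C = 5 / a ^ 4 * (4 * pi\<^sup>2 * (4 * K) + M)"
  define B where "B = (2 * I + 2 * C * T) * exp (1 * T)"
  have est: "(\<Sum>k\<in>F. w k * ((kn k ^ 2 * norm (v1 t k))\<^sup>2 + (kn k ^ 2 * norm (v2 t k))\<^sup>2)) \<le> B"
    if F: "finite F" and F0: "0 \<notin> F" and t: "t \<in> {0..T}" for F t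
  proof -
    define Z where "Z t k = perp k (adv (v1 t) (v2 t) (v1 t) k) (adv (v1 t) (v2 t) (v2 t) k + \<tau> t k)" for t k
    define d1 d2 where "d1 t k = - of_int (snd k) * Z t k / of_real ((1 + a\<^sup>2 * kweight k) * sq2 k)"
      and "d2 t k = of_int (fst k) * Z t k / of_real ((1 + a\<^sup>2 * kweight k) * sq2 k)" for t k
    define y where "y s = (\<Sum>k\<in>F. w k * kn k ^ 4 * ((norm (v1 s k))\<^sup>2 + (norm (v2 s k))\<^sup>2))" for s
    define y' where "y' s = (\<Sum>k\<in>F. w k * kn k ^ 4 * (2 * Re (cnj (v1 s k) * d1 s k) + 2 * Re (cnj (v2 s k) * d2 s k)))" for s
    have K0: "0 \<le> K" using bsum_nonneg[OF cvb[OF t, of "v1 t" "v1 t"]] by simp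
    have M0: "0 \<le> M" using bsum_nonneg tau[OF t] unfolding hb_def by blast
    have C0: "0 \<le> C" unfolding C_def using K0 M0 a by simp
    have dy: "(y has_real_derivative y' s) (at s within {0..T})" if s: "s \<in> {0..T}" for s
      unfolding y_def y'_def
    proof (intro DERIV_sum DERIV_cmult DERIV_add DERIV_norm_sq)
      fix k assume "k \<in> F"
      hence k: "k \<noteq> 0" using F0 by auto
      show "((\<lambda>s. v1 s k) has_vector_derivative d1 s k) (at s within {0..T})"
        "((\<lambda>s. v2 s k) has_vector_derivative d2 s k) (at s within {0..T})"
        unfolding d1_def d2_def Z_def by (rule velocity_derivative[OF sol s k])+
    qed
    have db: "kn k ^ 2 * norm (d1 s k) \<le> norm (Z s k) / (a\<^sup>2 * kn k)" "kn k ^ 2 * norm (d2 s k) \<le> norm (Z s k) / (a\<^sup>2 * kn k)"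
      if k: "k \<noteq> 0" for s k
    proof -
      define x where "x = kn k"
      have x: "x > 0" using k by (simp add: x_def)
      have cpos: "0 < 1 + a\<^sup>2 * kweight k" by (intro add_pos_nonneg mult_nonneg_nonneg kweight_nonneg) auto
      have "a\<^sup>2 * x\<^sup>2 * x\<^sup>2 \<le> (1 + a\<^sup>2 * kweight k) * sq2 k"
      proof (rule mult_mono)
        have "a\<^sup>2 * x\<^sup>2 \<le> a\<^sup>2 * kweight k" unfolding x_def by (intro mult_left_mono kweight_ge) simp
        thus "a\<^sup>2 * x\<^sup>2 \<le> 1 + a\<^sup>2 * kweight k" by linarith
        show "x\<^sup>2 \<le> sq2 k" unfolding x_def by (rule sq2_ge)
      qed (use cpos in simp_all)
      moreover have "0 < a\<^sup>2 * x\<^sup>2 * x\<^sup>2" using a x by simp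
      ultimately have le: "x\<^sup>2 * (x * norm (Z s k) / ((1 + a\<^sup>2 * kweight k) * sq2 k)) \<le> x\<^sup>2 * (x * norm (Z s k) / (a\<^sup>2 * x\<^sup>2 * x\<^sup>2))"
        using x cpos sq2_pos[OF k] by (intro mult_left_mono divide_left_mono mult_pos_pos) auto
      have eq: "x\<^sup>2 * (x * norm (Z s k) / (a\<^sup>2 * x\<^sup>2 * x\<^sup>2)) = norm (Z s k) / (a\<^sup>2 * x)"
        using x a by (simp add: field_simps power2_eq_square)
      have pos: "0 \<le> (1 + a\<^sup>2 * kweight k) * sq2 k"
        by (intro mult_nonneg_nonneg add_nonneg_nonneg kweight_nonneg) (auto simp: sq2_def)
      have "norm (d1 s k) \<le> x * norm (Z s k) / ((1 + a\<^sup>2 * kweight k) * sq2 k)"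
        "norm (d2 s k) \<le> x * norm (Z s k) / ((1 + a\<^sup>2 * kweight k) * sq2 k)"
        using pos unfolding d1_def d2_def x_def kn_eq norm_divide norm_mult norm_of_real norm_minus_cancel abs_of_nonneg[OF pos]
        by (auto intro!: divide_right_mono mult_right_mono)
      from this[THEN mult_left_mono[OF _ zero_le_power2], THEN order_trans, OF le[unfolded eq]]
      show "kn k ^ 2 * norm (d1 s k) \<le> norm (Z s k) / (a\<^sup>2 * kn k)" "kn k ^ 2 * norm (d2 s k) \<le> norm (Z s k) / (a\<^sup>2 * kn k)"
        unfolding x_def[symmetric] by blast+
    qed
    define Q where "Q s k = 4 * pi\<^sup>2 * ((kn k * norm (cv (v1 s) (v1 s) k))\<^sup>2 + (kn k * norm (cv (v2 s) (v1 s) k))\<^sup>2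
      + (kn k * norm (cv (v1 s) (v2 s) k))\<^sup>2 + (kn k * norm (cv (v2 s) (v2 s) k))\<^sup>2) + (norm (\<tau> s k))\<^sup>2" for s k
    have Zb: "(norm (Z s k) / (a\<^sup>2 * kn k))\<^sup>2 \<le> 5 / a ^ 4 * Q s k" if k: "k \<noteq> 0" for s k
    proof -
      let ?x = "\<lambda>p q. kn k * norm (cv p q k)"
      have "norm (Z s k) \<le> kn k * (norm (adv (v1 s) (v2 s) (v1 s) k) + norm (adv (v1 s) (v2 s) (v2 s) k + \<tau> s k))"
        unfolding Z_def by (rule norm_perp_le)
      also have "\<dots> \<le> kn k * (norm (adv (v1 s) (v2 s) (v1 s) k) + (norm (adv (v1 s) (v2 s) (v2 s) k) + norm (\<tau> s k)))"
        by (intro mult_left_mono add_left_mono norm_triangle_ineq) simp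
      also have "\<dots> \<le> kn k * (2 * pi * (kn k * (norm (cv (v1 s) (v1 s) k) + norm (cv (v2 s) (v1 s) k)))
           + (2 * pi * (kn k * (norm (cv (v1 s) (v2 s) k) + norm (cv (v2 s) (v2 s) k))) + norm (\<tau> s k)))"
        by (intro mult_left_mono add_mono norm_adv_le) auto
      also have "\<dots> = kn k * (2 * pi * ?x (v1 s) (v1 s) + 2 * pi * ?x (v2 s) (v1 s) + 2 * pi * ?x (v1 s) (v2 s) + 2 * pi * ?x (v2 s) (v2 s) + norm (\<tau> s k))"
        (is "_ = kn k * ?s") by (simp add: algebra_simps)
      finally have "norm (Z s k) \<le> kn k * ?s" .
      hence "norm (Z s k) / (a\<^sup>2 * kn k) \<le> (kn k * ?s) / (a\<^sup>2 * kn k)" by (intro divide_right_mono) auto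
      also have "\<dots> = ?s / a\<^sup>2" using k by simp
      finally have "(norm (Z s k) / (a\<^sup>2 * kn k))\<^sup>2 \<le> (?s / a\<^sup>2)\<^sup>2" by (rule power_mono) simp
      also have "\<dots> = 1 / a ^ 4 * ?s\<^sup>2" by (simp add: power_divide flip: power_mult)
      also have "\<dots> \<le> 1 / a ^ 4 * (5 * ((2 * pi * ?x (v1 s) (v1 s))\<^sup>2 + (2 * pi * ?x (v2 s) (v1 s))\<^sup>2 + (2 * pi * ?x (v1 s) (v2 s))\<^sup>2 + (2 * pi * ?x (v2 s) (v2 s))\<^sup>2 + (norm (\<tau> s k))\<^sup>2))"
        by (intro mult_left_mono sum_square_le_5) simp
      also have "\<dots> = 5 / a ^ 4 * Q s k"
        by (simp add: Q_def power_mult_distrib algebra_simps)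
      finally show ?thesis .
    qed
    have "y' s \<le> 1 * y s + 2 * C" if s: "s \<in> {0..T}" for s
    proof -
      have "y' s \<le> (\<Sum>k\<in>F. w k * kn k ^ 4 * ((norm (v1 s k))\<^sup>2 + (norm (v2 s k))\<^sup>2) + 2 * (w k * (norm (Z s k) / (a\<^sup>2 * kn k))\<^sup>2))"
        unfolding y'_def
      proof (rule sum_mono)
        fix k assume "k \<in> F"
        hence k: "k \<noteq> 0" using F0 by auto
        have 1: "2 * Re (cnj p * d) \<le> (norm p)\<^sup>2 + (norm d)\<^sup>2" for p d :: complex
          using sum_squares_bound[of "norm p" "norm d"] complex_Re_le_cmod[of "cnj p * d"]
          by (simp add: norm_mult)
        have 2: "kn k ^ 4 * (norm d)\<^sup>2 \<le> (norm (Z s k) / (a\<^sup>2 * kn k))\<^sup>2" if "kn k ^ 2 * norm d \<le> norm (Z s k) / (a\<^sup>2 * kn k)" for d :: complex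
          using power_mono[OF that, of 2] by (simp add: power_mult_distrib flip: power_mult)
        have "w k * kn k ^ 4 * (2 * Re (cnj (v1 s k) * d1 s k) + 2 * Re (cnj (v2 s k) * d2 s k))
           \<le> w k * kn k ^ 4 * (((norm (v1 s k))\<^sup>2 + (norm (d1 s k))\<^sup>2) + ((norm (v2 s k))\<^sup>2 + (norm (d2 s k))\<^sup>2))"
          by (intro mult_left_mono add_mono 1 mult_nonneg_nonneg w) auto
        also have "\<dots> = w k * kn k ^ 4 * ((norm (v1 s k))\<^sup>2 + (norm (v2 s k))\<^sup>2) + w k * (kn k ^ 4 * (norm (d1 s k))\<^sup>2 + kn k ^ 4 * (norm (d2 s k))\<^sup>2)"
          by (simp add: algebra_simps)
        also have "\<dots> \<le> w k * kn k ^ 4 * ((norm (v1 s k))\<^sup>2 + (norm (v2 s k))\<^sup>2) + w k * ((norm (Z s k) / (a\<^sup>2 * kn k))\<^sup>2 + (norm (Z s k) / (a\<^sup>2 * kn k))\<^sup>2)"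
          by (intro add_left_mono mult_left_mono add_mono 2 db k w)
        finally show "w k * kn k ^ 4 * (2 * Re (cnj (v1 s k) * d1 s k) + 2 * Re (cnj (v2 s k) * d2 s k))
           \<le> w k * kn k ^ 4 * ((norm (v1 s k))\<^sup>2 + (norm (v2 s k))\<^sup>2) + 2 * (w k * (norm (Z s k) / (a\<^sup>2 * kn k))\<^sup>2)" by simp
      qed
      also have "\<dots> = y s + 2 * (\<Sum>k\<in>F. w k * (norm (Z s k) / (a\<^sup>2 * kn k))\<^sup>2)"
        by (simp add: y_def sum.distrib sum_distrib_left)
      also have "(\<Sum>k\<in>F. w k * (norm (Z s k) / (a\<^sup>2 * kn k))\<^sup>2) \<le> C"
      proof -
        let ?x = "\<lambda>p q k. w k * (kn k * norm (cv p q k))\<^sup>2"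
        have Qb: "w k * Q s k \<le> 4 * pi\<^sup>2 * (?x (v1 s) (v1 s) k + ?x (v2 s) (v1 s) k + ?x (v1 s) (v2 s) k + ?x (v2 s) (v2 s) k) + (norm (\<tau> s k))\<^sup>2" for k
        proof -
          have "w k * (norm (\<tau> s k))\<^sup>2 \<le> 1 * (norm (\<tau> s k))\<^sup>2" by (intro mult_right_mono w) simp
          thus ?thesis unfolding Q_def by (simp only: distrib_left mult.left_commute[of "w k"])
        qed
        have "(\<Sum>k\<in>F. w k * (norm (Z s k) / (a\<^sup>2 * kn k))\<^sup>2) \<le> (\<Sum>k\<in>F. 5 / a ^ 4 * (w k * Q s k))"
        proof (rule sum_mono)
          fix k assume "k \<in> F"
          hence "k \<noteq> 0" using F0 by auto
          hence "w k * (norm (Z s k) / (a\<^sup>2 * kn k))\<^sup>2 \<le> w k * (5 / a ^ 4 * Q s k)"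
            by (intro mult_left_mono Zb w)
          also have "\<dots> = 5 / a ^ 4 * (w k * Q s k)" by (rule mult.left_commute)
          finally show "w k * (norm (Z s k) / (a\<^sup>2 * kn k))\<^sup>2 \<le> 5 / a ^ 4 * (w k * Q s k)" .
        qed
        also have "\<dots> \<le> (\<Sum>k\<in>F. 5 / a ^ 4 * (4 * pi\<^sup>2 * (?x (v1 s) (v1 s) k + ?x (v2 s) (v1 s) k + ?x (v1 s) (v2 s) k + ?x (v2 s) (v2 s) k) + (norm (\<tau> s k))\<^sup>2))"
          using a by (intro sum_mono mult_left_mono Qb) auto
        also have "\<dots> = 5 / a ^ 4 * (4 * pi\<^sup>2 * (sum (?x (v1 s) (v1 s)) F + sum (?x (v2 s) (v1 s)) F + sum (?x (v1 s) (v2 s)) F + sum (?x (v2 s) (v2 s)) F) + (\<Sum>k\<in>F. (norm (\<tau> s k))\<^sup>2))"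
          by (simp only: sum_distrib_left[symmetric] sum.distrib)
        also have "\<dots> \<le> 5 / a ^ 4 * (4 * pi\<^sup>2 * (K + K + K + K) + M)"
          using cvb[OF s] tau[OF s, unfolded hb_0] F a
          by (intro mult_left_mono add_mono) (auto intro: bsumD)
        finally show ?thesis by (simp add: C_def)
      qed
      finally show ?thesis by simp
    qed
    hence "y t \<le> (y 0 + (2 * C) * t) * exp (1 * t)"
      using dy C0 t by (intro gronwall[where y' = y' and T = T]) auto
    also have "y 0 \<le> I + I"
    proof -
      have "y 0 \<le> (\<Sum>k\<in>F. (kn k ^ 2 * norm (v1 0 k))\<^sup>2 + (kn k ^ 2 * norm (v2 0 k))\<^sup>2)"
        unfolding y_def
      proof (rule sum_mono)
        fix k
        have "w k * (kn k ^ 4 * ((norm (v1 0 k))\<^sup>2 + (norm (v2 0 k))\<^sup>2)) \<le> 1 * (kn k ^ 4 * ((norm (v1 0 k))\<^sup>2 + (norm (v2 0 k))\<^sup>2))"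
          by (intro mult_right_mono w) auto
        thus "w k * kn k ^ 4 * ((norm (v1 0 k))\<^sup>2 + (norm (v2 0 k))\<^sup>2) \<le> (kn k ^ 2 * norm (v1 0 k))\<^sup>2 + (kn k ^ 2 * norm (v2 0 k))\<^sup>2"
          by (simp add: power_mult_distrib distrib_left mult.assoc flip: power_mult)
      qed
      also have "\<dots> \<le> I + I" unfolding sum.distrib
        using init F by (intro add_mono) (auto simp: hb_def intro: bsumD)
      finally show ?thesis .
    qed
    also have "(I + I + 2 * C * t) * exp (1 * t) \<le> B"
      unfolding B_def using C0 t bsum_nonneg[OF init(1)[unfolded hb_def]]
      by (intro mult_mono add_mono) (auto intro: mult_left_mono)
    finally have "y t \<le> B" by simp
    thus ?thesis by (simp add: y_def power_mult_distrib distrib_left mult.assoc flip: power_mult)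
  qed
  have "(\<Sum>k\<in>F. w k * (kn k ^ 2 * norm (v1 t k))\<^sup>2) \<le> B" "(\<Sum>k\<in>F. w k * (kn k ^ 2 * norm (v2 t k))\<^sup>2) \<le> B"
    if F: "finite F" and t: "t \<in> {0..T}" for F t
  proof -
    have "(\<Sum>k\<in>F. w k * (kn k ^ 2 * norm (v k))\<^sup>2) \<le> B" if v: "v \<in> {v1 t, v2 t}" for v
    proof -
      have "(\<Sum>k\<in>F. w k * (kn k ^ 2 * norm (v k))\<^sup>2) = (\<Sum>k\<in>F - {0}. w k * (kn k ^ 2 * norm (v k))\<^sup>2)"
        using F by (intro sum.mono_neutral_right) auto
      also have "\<dots> \<le> (\<Sum>k\<in>F - {0}. w k * ((kn k ^ 2 * norm (v1 t k))\<^sup>2 + (kn k ^ 2 * norm (v2 t k))\<^sup>2))"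
        using v w by (intro sum_mono mult_left_mono) auto
      also have "\<dots> \<le> B"
        using F t by (intro est) auto
      finally show ?thesis .
    qed
    thus "(\<Sum>k\<in>F. w k * (kn k ^ 2 * norm (v1 t k))\<^sup>2) \<le> B" "(\<Sum>k\<in>F. w k * (kn k ^ 2 * norm (v2 t k))\<^sup>2) \<le> B"
      by blast+
  qed
  thus ?thesis using that[of B] by (simp add: bsum_def)
qed

text \<open>Two applications: \<open>H\<^sup>1\<close> to \<open>H\<^sup>3\<^sup>/\<^sup>2\<close>, which makes the coefficients summable, and then to
  \<open>H\<^sup>2\<close>, the optimum for a buoyancy that is merely square integrable.\<close>
lemma voigt_H2:
  assumes sol: "fsol a T v1 v2 \<tau>" and a: "a > 0"
    and H1: "\<And>t. t \<in> {0..T} \<Longrightarrow> hb 1 (v1 t) D" "\<And>t. t \<in> {0..T} \<Longrightarrow> hb 1 (v2 t) D"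
    and tau: "\<And>t. t \<in> {0..T} \<Longrightarrow> hb 0 (\<tau> t) M"
    and init: "hb 2 (v1 0) I" "hb 2 (v2 0) I"
  obtains B where "\<And>t. t \<in> {0..T} \<Longrightarrow> hb 2 (v1 t) B" "\<And>t. t \<in> {0..T} \<Longrightarrow> hb 2 (v2 t) B"
proof -
  have v0: "v1 t 0 = 0" "v2 t 0 = 0" if "t \<in> {0..T}" for t using sol that unfolding fsol_def by blast+
  \<comment> \<open>At k = 0 the weight is 0, so it is admissible there as well.\<close>
  have w1: "1 / kn k \<le> 1" for k by (cases "k = 0") (use knat_pos[of k] in \<open>auto simp: field_simps\<close>)
  have c1: "bsum (\<lambda>k. 1 / kn k * (kn k * norm (cv p q k))\<^sup>2) (4 * lat3 * (D * D))"
    if "t \<in> {0..T}" "p \<in> {v1 t, v2 t}" "q \<in> {v1 t, v2 t}" for t p q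
  proof -
    have "bsum (\<lambda>k. kn k * (norm (cv p q k))\<^sup>2) (4 * lat3 * (D * D))"
      using that H1[OF that(1)] v0[OF that(1)] by (intro cv_half_gain) auto
    moreover have "1 / kn k * (kn k * norm (cv p q k))\<^sup>2 = kn k * (norm (cv p q k))\<^sup>2" for k
      by (cases "k = 0") (auto simp: power2_eq_square)
    ultimately show ?thesis by simp
  qed
  obtain B1 where B1: "\<And>t. t \<in> {0..T} \<Longrightarrow> bsum (\<lambda>k. 1 / kn k * (kn k ^ 2 * norm (v1 t k))\<^sup>2) B1"
    "\<And>t. t \<in> {0..T} \<Longrightarrow> bsum (\<lambda>k. 1 / kn k * (kn k ^ 2 * norm (v2 t k))\<^sup>2) B1"
  proof (rule voigt_gain[of a T v1 v2 \<tau> "\<lambda>k. 1 / kn k" "4 * lat3 * (D * D)" M I])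
    show "bsum (\<lambda>k. 1 / kn k * (kn k * norm (cv p q k))\<^sup>2) (4 * lat3 * (D * D))"
      if "t \<in> {0..T}" "p \<in> {v1 t, v2 t}" "q \<in> {v1 t, v2 t}" for t p q using that by (rule c1)
  next
    fix B assume "\<And>t. t \<in> {0..T} \<Longrightarrow> bsum (\<lambda>k. 1 / kn k * (kn k ^ 2 * norm (v1 t k))\<^sup>2) B"
      "\<And>t. t \<in> {0..T} \<Longrightarrow> bsum (\<lambda>k. 1 / kn k * (kn k ^ 2 * norm (v2 t k))\<^sup>2) B"
    thus thesis by (rule that)
  qed (use sol a w1 tau init in simp_all)
  \<comment> \<open>The first round bounds the sum of \<open>kn k ^ 3\<close> times the squared
    modulus; Cauchy-Schwarz against \<open>1 / kn k ^ 3\<close> makes the coefficients summable,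
    which is what \<open>cv_algebra\<close> requires in the second round.\<close>
  have l1: "bsum (\<lambda>k. norm (v k)) (sqrt (lat3 * B1))" if "bsum (\<lambda>k. 1 / kn k * (kn k ^ 2 * norm (v k))\<^sup>2) B1" "v 0 = 0" for v :: "int \<times> int \<Rightarrow> complex"
  proof (rule bsum_mono)
    have e1: "(1 / (sqrt (kn m)) ^ 3)\<^sup>2 = 1 / kn m ^ 3" for m
    proof -
      have "(1 / (sqrt (kn m)) ^ 3)\<^sup>2 = 1 / ((sqrt (kn m))\<^sup>2) ^ 3"
        by (simp only: power_divide power_mult[symmetric] power_one mult.commute)
      thus ?thesis by simp
    qed
    have e2: "((sqrt (kn m)) ^ 3 * norm (v m))\<^sup>2 = 1 / kn m * (kn m ^ 2 * norm (v m))\<^sup>2" for m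
    proof (cases "m = 0")
      case False
      have "((sqrt (kn m)) ^ 3 * norm (v m))\<^sup>2 = ((sqrt (kn m))\<^sup>2) ^ 3 * (norm (v m))\<^sup>2"
        by (simp only: power_mult_distrib power_mult[symmetric] mult.commute)
      thus ?thesis using False by (simp add: field_simps eval_nat_numeral)
    qed simp
    show "bsum (\<lambda>m. (1 / (sqrt (kn m)) ^ 3) * ((sqrt (kn m)) ^ 3 * norm (v m))) (sqrt (lat3 * B1))"
      by (rule bsum_Cauchy_Schwarz) (simp_all only: e1 e2 bsum_lat3 that)
    fix m show "norm (v m) \<le> (1 / (sqrt (kn m)) ^ 3) * ((sqrt (kn m)) ^ 3 * norm (v m))"
      using that(2) by (cases "m = 0") auto
  qed simp
  let ?A = "sqrt (lat3 * B1)"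
  have c2: "bsum (\<lambda>k. 1 * (kn k * norm (cv p q k))\<^sup>2) (4 ^ 1 * (4 * (?A * (?A * D))))"
    if "t \<in> {0..T}" "p \<in> {v1 t, v2 t}" "q \<in> {v1 t, v2 t}" for t p q
    using cv_algebra[of 1 p D ?A q] l1 that H1[OF that(1)] v0[OF that(1)] B1[OF that(1)] by auto
  show ?thesis
  proof (rule voigt_gain[of a T v1 v2 \<tau> "\<lambda>k. 1" "4 ^ 1 * (4 * (?A * (?A * D)))" M I])
    show "bsum (\<lambda>k. 1 * (kn k * norm (cv p q k))\<^sup>2) (4 ^ 1 * (4 * (?A * (?A * D))))"
      if "t \<in> {0..T}" "p \<in> {v1 t, v2 t}" "q \<in> {v1 t, v2 t}" for t p q using that by (rule c2)
  next
    fix B assume "\<And>t. t \<in> {0..T} \<Longrightarrow> bsum (\<lambda>k. 1 * (kn k ^ 2 * norm (v1 t k))\<^sup>2) B"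
      "\<And>t. t \<in> {0..T} \<Longrightarrow> bsum (\<lambda>k. 1 * (kn k ^ 2 * norm (v2 t k))\<^sup>2) B"
    thus thesis by (intro that[of B]) (simp_all add: hb_def)
  qed (use sol a tau init in simp_all)
qed

section \<open>The relative energy\<close>

lemma norm_add_sq_le: "(norm (x + y))\<^sup>2 \<le> 2 * (norm x)\<^sup>2 + 2 * (norm (y :: complex))\<^sup>2"
proof -
  have "(norm (x + y))\<^sup>2 \<le> (norm x + norm y)\<^sup>2" by (intro power_mono norm_triangle_ineq) simp
  also have "\<dots> \<le> 2 * (norm x)\<^sup>2 + 2 * (norm y)\<^sup>2"
    using sum_squares_bound[of "norm x" "norm y"] by (simp add: power2_sum)
  finally show ?thesis .
qed

lemma hb_diff:
  assumes "hb n p A" "hb n q B" shows "hb n (\<lambda>k. p k - q k) (2 * A + 2 * B)"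
  unfolding hb_def
proof (rule bsum_mono)
  show "bsum (\<lambda>m. 2 * (kn m ^ n * norm (p m))\<^sup>2 + 2 * (kn m ^ n * norm (q m))\<^sup>2) (2 * A + 2 * B)"
    using assms unfolding hb_def by (intro bsum_add bsum_cmult) auto
  fix m
  have "(kn m ^ n)\<^sup>2 * (norm (p m - q m))\<^sup>2 \<le> (kn m ^ n)\<^sup>2 * (2 * (norm (p m))\<^sup>2 + 2 * (norm (q m))\<^sup>2)"
    using norm_add_sq_le[of "p m" "- q m"] by (intro mult_left_mono) auto
  thus "(kn m ^ n * norm (p m - q m))\<^sup>2 \<le> 2 * (kn m ^ n * norm (p m))\<^sup>2 + 2 * (kn m ^ n * norm (q m))\<^sup>2"
    by (simp add: power_mult_distrib algebra_simps)
qed simp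

text \<open>Bilinearity, arranged so that the difference is transported by the regularised velocity,
  where only a commutator estimate is available, while the remaining derivative falls on the smooth
  Euler state.\<close>

lemma adv_split:
  assumes "hb 0 v1 A" "hb 0 v2 A" "hb 0 c A" "hb 0 u1 A" "hb 0 u2 A" "hb 0 g A"
  shows "adv v1 v2 c k - adv u1 u2 g k
    = adv v1 v2 (\<lambda>k. c k - g k) k + adv (\<lambda>k. v1 k - u1 k) (\<lambda>k. v2 k - u2 k) g k"
proof -
  note d = hb_diff[OF assms(1,4)] hb_diff[OF assms(2,5)] hb_diff[OF assms(3,6)]
  let ?t = "\<lambda>v1 v2 c m. - 2 * pi * \<i> * ((of_int (fst k) * v1 m + of_int (snd k) * v2 m) * c (k - m))"
  have h1: "((\<lambda>m. ?t v1 v2 c m - ?t u1 u2 g m) has_sum adv v1 v2 c k - adv u1 u2 g k) UNIV"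
    using has_sum_add[OF adv_has_sum[OF assms(1,2,3)] has_sum_uminusI[OF adv_has_sum[OF assms(4,5,6)]], of k k] by simp
  have h2: "((\<lambda>m. ?t v1 v2 (\<lambda>k. c k - g k) m + ?t (\<lambda>k. v1 k - u1 k) (\<lambda>k. v2 k - u2 k) g m) has_sum
     adv v1 v2 (\<lambda>k. c k - g k) k + adv (\<lambda>k. v1 k - u1 k) (\<lambda>k. v2 k - u2 k) g k) UNIV"
    by (intro has_sum_add adv_has_sum[OF assms(1,2) d(3)] adv_has_sum[OF d(1,2) assms(6)])
  have eq: "(\<lambda>m. ?t v1 v2 (\<lambda>k. c k - g k) m + ?t (\<lambda>k. v1 k - u1 k) (\<lambda>k. v2 k - u2 k) g m) = (\<lambda>m. ?t v1 v2 c m - ?t u1 u2 g m)"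
    by (simp add: algebra_simps)
  show ?thesis by (rule has_sum_unique[OF h1]) (rule h2[unfolded eq])
qed

text \<open>Four times the constant of \<open>cv_algebra\<close> for n = 2, one for each product of
  velocity components, plus M for the buoyancy; the 5 is that of
  \<open>sum_square_le_5\<close>.\<close>

definition forcing_const :: "real \<Rightarrow> real" where
  "forcing_const M = 4 * pi\<^sup>2 * (5 * (4 * pi\<^sup>2 * (4 * (4 ^ 2 * (4 * (sqrt (lat3 * M) * (sqrt (lat3 * M) * M))))) + M))"

text \<open>For an Euler solution the sum is the squared V norm of the time derivative of the
  velocity. It involves two derivatives of products of velocities, which are controlled because
  \<open>H^2\<close> is an algebra.\<close>

lemma euler_forcing_bound:
  assumes u: "hb 3 u1 M" "hb 3 u2 M" "u1 0 = 0" "u2 0 = 0" and th: "hb 3 \<theta> M" "\<theta> 0 = 0"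
  shows "bsum (\<lambda>k. 4 * pi\<^sup>2 * (norm (perp k (adv u1 u2 u1 k) (adv u1 u2 u2 k + \<theta> k)))\<^sup>2) (forcing_const M)"
proof -
  let ?A = "sqrt (lat3 * M)"
  let ?K = "4 ^ 2 * (4 * (?A * (?A * M)))"
  have u2: "hb 2 u1 M" "hb 2 u2 M" using hb_mono[OF u(1) _ u(3)] hb_mono[OF u(2) _ u(4)] by auto
  have cvb: "bsum (\<lambda>k. (kn k ^ 2 * norm (cv p q k))\<^sup>2) ?K" if "p \<in> {u1, u2}" "q \<in> {u1, u2}" for p q
    using that u2 u(3,4) by (intro cv_algebra hb_l1) auto
  have th1: "bsum (\<lambda>k. (kn k * norm (\<theta> k))\<^sup>2) M"
    using hb_mono[OF th(1) _ th(2), of 1] by (simp add: hb_def)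
  let ?x = "\<lambda>p q k. kn k ^ 2 * norm (cv p q k)"
  let ?b = "\<lambda>k. 4 * pi\<^sup>2 * (5 * (4 * pi\<^sup>2 * ((?x u1 u1 k)\<^sup>2 + (?x u2 u1 k)\<^sup>2 + (?x u1 u2 k)\<^sup>2 + (?x u2 u2 k)\<^sup>2) + (kn k * norm (\<theta> k))\<^sup>2))"
  show ?thesis
  proof (rule bsum_mono)
    show "bsum ?b (4 * pi\<^sup>2 * (5 * (4 * pi\<^sup>2 * (?K + ?K + ?K + ?K) + M)))"
      by (intro bsum_cmult bsum_add cvb th1) auto
    show "4 * pi\<^sup>2 * (5 * (4 * pi\<^sup>2 * (?K + ?K + ?K + ?K) + M)) \<le> forcing_const M"
    proof -
      have four: "x + x + x + x = 4 * x" for x :: real by simp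
      show ?thesis unfolding four forcing_const_def by (rule order_refl)
    qed
    fix k
    have "norm (perp k (adv u1 u2 u1 k) (adv u1 u2 u2 k + \<theta> k)) \<le> kn k * (norm (adv u1 u2 u1 k) + norm (adv u1 u2 u2 k + \<theta> k))"
      by (rule norm_perp_le)
    also have "\<dots> \<le> kn k * (norm (adv u1 u2 u1 k) + (norm (adv u1 u2 u2 k) + norm (\<theta> k)))"
      by (intro mult_left_mono add_left_mono norm_triangle_ineq) simp
    also have "\<dots> \<le> kn k * (2 * pi * (kn k * (norm (cv u1 u1 k) + norm (cv u2 u1 k)))
           + (2 * pi * (kn k * (norm (cv u1 u2 k) + norm (cv u2 u2 k))) + norm (\<theta> k)))"
      by (intro mult_left_mono add_mono norm_adv_le) auto
    also have "\<dots> = 2 * pi * ?x u1 u1 k + 2 * pi * ?x u2 u1 k + 2 * pi * ?x u1 u2 k + 2 * pi * ?x u2 u2 k + kn k * norm (\<theta> k)" (is "_ = ?s")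
      by (simp add: algebra_simps power2_eq_square)
    finally have "(norm (perp k (adv u1 u2 u1 k) (adv u1 u2 u2 k + \<theta> k)))\<^sup>2 \<le> ?s\<^sup>2" by (rule power_mono) simp
    also have "\<dots> \<le> 5 * ((2 * pi * ?x u1 u1 k)\<^sup>2 + (2 * pi * ?x u2 u1 k)\<^sup>2 + (2 * pi * ?x u1 u2 k)\<^sup>2 + (2 * pi * ?x u2 u2 k)\<^sup>2 + (kn k * norm (\<theta> k))\<^sup>2)"
      by (rule sum_square_le_5)
    also have "\<dots> = 5 * (4 * pi\<^sup>2 * ((?x u1 u1 k)\<^sup>2 + (?x u2 u1 k)\<^sup>2 + (?x u1 u2 k)\<^sup>2 + (?x u2 u2 k)\<^sup>2) + (kn k * norm (\<theta> k))\<^sup>2)"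
      by (simp add: power_mult_distrib algebra_simps)
    finally show "4 * pi\<^sup>2 * (norm (perp k (adv u1 u2 u1 k) (adv u1 u2 u2 k + \<theta> k)))\<^sup>2 \<le> ?b k"
      by (intro mult_left_mono) auto
  qed
qed

lemma divfree_diff: "divfree v1 v2 \<Longrightarrow> divfree u1 u2 \<Longrightarrow> divfree (\<lambda>k. v1 k - u1 k) (\<lambda>k. v2 k - u2 k)"
proof -
  assume v: "divfree v1 v2" and u: "divfree u1 u2"
  have *: "of_int (fst k) * (v1 k - u1 k) + of_int (snd k) * (v2 k - u2 k)
     = (of_int (fst k) * v1 k + of_int (snd k) * v2 k) - (of_int (fst k) * u1 k + of_int (snd k) * u2 k)" for k
    by (simp add: algebra_simps)
  show ?thesis unfolding divfree_def * using v u unfolding divfree_def by simp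
qed

text \<open>A divergence-free vector is a multiple of (-k2, k1), so its pairing with any vector sees
  only that direction. This converts energies in the two components into energies of the scalar that
  solves the mode equation.\<close>

lemma divfree_perp:
  assumes "divfree w1 w2"
  shows "sq2 k * ((norm (w1 k))\<^sup>2 + (norm (w2 k))\<^sup>2) = (norm (perp k (w1 k) (w2 k)))\<^sup>2"
    and "of_real (sq2 k) * (cnj (w1 k) * x + cnj (w2 k) * y) = cnj (perp k (w1 k) (w2 k)) * perp k x y"
proof -
  let ?z = "perp k (w1 k) (w2 k)"
  note r = perp_recover[OF assms, of k]
  have *: "of_real (sq2 k) * (cnj (w1 k) * x + cnj (w2 k) * y) = cnj ?z * perp k x y" for x y
  proof -
    have "of_real (sq2 k) * (cnj (w1 k) * x + cnj (w2 k) * y) = cnj (of_real (sq2 k) * w1 k) * x + cnj (of_real (sq2 k) * w2 k) * y"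
      by (simp add: algebra_simps)
    also have "\<dots> = cnj ?z * perp k x y" unfolding r by (simp add: perp_def[of k x y] algebra_simps)
    finally show ?thesis .
  qed
  show "of_real (sq2 k) * (cnj (w1 k) * x + cnj (w2 k) * y) = cnj ?z * perp k x y" by (rule *)
  have "complex_of_real (sq2 k * ((norm (w1 k))\<^sup>2 + (norm (w2 k))\<^sup>2)) = complex_of_real ((norm ?z)\<^sup>2)"
    unfolding of_real_mult of_real_add complex_norm_square using *[of "w1 k" "w2 k"] by (simp add: mult.commute)
  thus "sq2 k * ((norm (w1 k))\<^sup>2 + (norm (w2 k))\<^sup>2) = (norm ?z)\<^sup>2" unfolding of_real_eq_iff .
qed

text \<open>The Euler solution does not satisfy the regularised equation; the defect
  \<open>a\<^sup>2 \<Delta> \<partial>\<^sub>t u\<close> is the last term of the derivative.\<close>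
lemma energy_mode_derivative:
  assumes v: "fsol a T v1 v2 \<tau>" and u: "fsol 0 T u1 u2 \<theta>" and t: "t \<in> {0..T}" and k: "k \<noteq> 0"
  shows "((\<lambda>s. (1 + a\<^sup>2 * kweight k) * ((norm (v1 s k - u1 s k))\<^sup>2 + (norm (v2 s k - u2 s k))\<^sup>2) + (norm (\<tau> s k - \<theta> s k))\<^sup>2)
     has_real_derivative
       2 * Re (cnj (v1 t k - u1 t k) * (adv (v1 t) (v2 t) (v1 t) k - adv (u1 t) (u2 t) (u1 t) k))
     + 2 * Re (cnj (v2 t k - u2 t k) * (adv (v1 t) (v2 t) (v2 t) k - adv (u1 t) (u2 t) (u2 t) k + (\<tau> t k - \<theta> t k)))
     + 2 * Re (cnj (\<tau> t k - \<theta> t k) * (adv (v1 t) (v2 t) (\<tau> t) k - adv (u1 t) (u2 t) (\<theta> t) k))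
     - 2 * a\<^sup>2 * kweight k / sq2 k * Re (cnj (perp k (v1 t k - u1 t k) (v2 t k - u2 t k)) *
          perp k (adv (u1 t) (u2 t) (u1 t) k) (adv (u1 t) (u2 t) (u2 t) k + \<theta> t k))) (at t within {0..T})"
proof -
  define c where "c = 1 + a\<^sup>2 * kweight k"
  have c: "c > 0" unfolding c_def by (intro add_pos_nonneg mult_nonneg_nonneg kweight_nonneg) auto
  have q: "sq2 k > 0" using k by (rule sq2_pos)
  let ?z = "\<lambda>s. perp k (v1 s k - u1 s k) (v2 s k - u2 s k)"
  let ?X = "adv (v1 t) (v2 t) (v1 t) k - adv (u1 t) (u2 t) (u1 t) k"
  let ?Y = "adv (v1 t) (v2 t) (v2 t) k - adv (u1 t) (u2 t) (u2 t) k + (\<tau> t k - \<theta> t k)"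
  let ?Z = "perp k (adv (u1 t) (u2 t) (u1 t) k) (adv (u1 t) (u2 t) (u2 t) k + \<theta> t k)"
  have dv: "((\<lambda>s. of_real c * perp k (v1 s k) (v2 s k)) has_vector_derivative
      perp k (adv (v1 t) (v2 t) (v1 t) k) (adv (v1 t) (v2 t) (v2 t) k + \<tau> t k)) (at t within {0..T})"
    and dt: "((\<lambda>s. \<tau> s k) has_vector_derivative adv (v1 t) (v2 t) (\<tau> t) k) (at t within {0..T})"
    using v t k unfolding fsol_def c_def by blast+
  have "((\<lambda>s. of_real (1 + 0\<^sup>2 * kweight k) * perp k (u1 s k) (u2 s k)) has_vector_derivative ?Z) (at t within {0..T})"
    and dh: "((\<lambda>s. \<theta> s k) has_vector_derivative adv (u1 t) (u2 t) (\<theta> t) k) (at t within {0..T})"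
    using u t k unfolding fsol_def by blast+
  hence du: "((\<lambda>s. perp k (u1 s k) (u2 s k)) has_vector_derivative ?Z) (at t within {0..T})" by simp
  have "((\<lambda>s. of_real c * perp k (v1 s k) (v2 s k) - of_real c * perp k (u1 s k) (u2 s k)) has_vector_derivative
     perp k (adv (v1 t) (v2 t) (v1 t) k) (adv (v1 t) (v2 t) (v2 t) k + \<tau> t k) - of_real c * ?Z) (at t within {0..T})"
    by (intro has_vector_derivative_diff dv has_vector_derivative_mult_right du)
  moreover have "of_real c * perp k (v1 s k) (v2 s k) - of_real c * perp k (u1 s k) (u2 s k) = of_real c * ?z s" for s
    by (simp add: perp_def algebra_simps)
  \<comment> \<open>The Euler velocity obeys its equation with factor 1; multiplying it by c leaves
    the surplus c - 1, which is \<open>a\<^sup>2 * kweight k\<close>.\<close>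
  moreover have "perp k (adv (v1 t) (v2 t) (v1 t) k) (adv (v1 t) (v2 t) (v2 t) k + \<tau> t k) - of_real c * ?Z = perp k ?X ?Y - of_real (c - 1) * ?Z"
    by (simp add: perp_def algebra_simps)
  ultimately have dz: "((\<lambda>s. of_real c * ?z s) has_vector_derivative perp k ?X ?Y - of_real (c - 1) * ?Z) (at t within {0..T})"
    by simp
  have df: "divfree (\<lambda>k. v1 s k - u1 s k) (\<lambda>k. v2 s k - u2 s k)" if "s \<in> {0..T}" for s
    using u v that unfolding fsol_def by (intro divfree_diff) auto
  \<comment> \<open>Only c times the orthogonal component has a known derivative, so the kinetic
    part of the energy is rewritten as the square of that quantity.\<close>
  have eq: "c * ((norm (v1 s k - u1 s k))\<^sup>2 + (norm (v2 s k - u2 s k))\<^sup>2) = 1 / (c * sq2 k) * (norm (of_real c * ?z s))\<^sup>2"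
    if "s \<in> {0..T}" for s
  proof -
    have "c * x = 1 / (c * sq2 k) * (c\<^sup>2 * (sq2 k * x))" for x
      using c q by (simp add: field_simps power2_eq_square)
    thus ?thesis
      unfolding norm_mult power_mult_distrib divfree_perp(1)[OF df[OF that], of k, symmetric] norm_of_real power2_abs .
  qed
  have re: "Re (cnj (?z t) * perp k ?X ?Y) = sq2 k * (Re (cnj (v1 t k - u1 t k) * ?X) + Re (cnj (v2 t k - u2 t k) * ?Y))"
    unfolding divfree_perp(2)[OF df[OF t], symmetric] Re_of_real_mult by simp
  have val: "1 / (c * sq2 k) * (2 * Re (cnj (of_real c * ?z t) * (perp k ?X ?Y - of_real (c - 1) * ?Z)))
     = 2 * Re (cnj (v1 t k - u1 t k) * ?X) + 2 * Re (cnj (v2 t k - u2 t k) * ?Y) - 2 * (c - 1) / sq2 k * Re (cnj (?z t) * ?Z)"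
  proof -
    have "cnj (of_real c * ?z t) * (perp k ?X ?Y - of_real (c - 1) * ?Z)
       = of_real c * (cnj (?z t) * perp k ?X ?Y) - of_real c * (of_real (c - 1) * (cnj (?z t) * ?Z))"
      by (simp add: algebra_simps)
    hence "Re (cnj (of_real c * ?z t) * (perp k ?X ?Y - of_real (c - 1) * ?Z))
       = c * Re (cnj (?z t) * perp k ?X ?Y) - c * ((c - 1) * Re (cnj (?z t) * ?Z))"
      by (simp only: minus_complex.sel Re_of_real_mult)
    thus ?thesis unfolding re using c q by (simp only:) (simp add: field_simps)
  qed
  have d1: "((\<lambda>s. 1 / (c * sq2 k) * (norm (of_real c * ?z s))\<^sup>2) has_real_derivative
      1 / (c * sq2 k) * (2 * Re (cnj (of_real c * ?z t) * (perp k ?X ?Y - of_real (c - 1) * ?Z)))) (at t within {0..T})"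
    by (intro DERIV_cmult DERIV_norm_sq dz)
  have d1': "((\<lambda>s. c * ((norm (v1 s k - u1 s k))\<^sup>2 + (norm (v2 s k - u2 s k))\<^sup>2)) has_real_derivative
      1 / (c * sq2 k) * (2 * Re (cnj (of_real c * ?z t) * (perp k ?X ?Y - of_real (c - 1) * ?Z)))) (at t within {0..T})"
    using has_vector_derivative_transform[OF t eq d1[unfolded has_real_derivative_iff_has_vector_derivative]]
    unfolding has_real_derivative_iff_has_vector_derivative .
  have d2: "((\<lambda>s. (norm (\<tau> s k - \<theta> s k))\<^sup>2) has_real_derivative
      2 * Re (cnj (\<tau> t k - \<theta> t k) * (adv (v1 t) (v2 t) (\<tau> t) k - adv (u1 t) (u2 t) (\<theta> t) k))) (at t within {0..T})"
    by (intro DERIV_norm_sq has_vector_derivative_diff dt dh)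
  show ?thesis
    using DERIV_add[OF d1' d2] unfolding val unfolding c_def
    by (rule DERIV_cong) simp
qed

text \<open>For each N the weighted energy is a finite sum and can be differentiated term by term.
  Transport contributes only an error vanishing as N grows; stretching, buoyancy and the defect
  yield the Gronwall rate and the source. B occurs only in the vanishing error, so it is absent from
  the bound.\<close>

lemma relative_energy_estimate:
  assumes v: "fsol a T v1 v2 \<tau>" and u: "fsol 0 T u1 u2 \<theta>" and a: "a > 0"
    and vb: "\<And>t. t \<in> {0..T} \<Longrightarrow> hb 2 (v1 t) B" "\<And>t. t \<in> {0..T} \<Longrightarrow> hb 2 (v2 t) B" "\<And>t. t \<in> {0..T} \<Longrightarrow> hb 0 (\<tau> t) B"
    and ub: "\<And>t. t \<in> {0..T} \<Longrightarrow> hb 3 (u1 t) M" "\<And>t. t \<in> {0..T} \<Longrightarrow> hb 3 (u2 t) M" "\<And>t. t \<in> {0..T} \<Longrightarrow> hb 3 (\<theta> t) M"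
    and init: "bsum (\<lambda>k. (1 + a\<^sup>2 * kweight k) * ((norm (v1 0 k - u1 0 k))\<^sup>2 + (norm (v2 0 k - u2 0 k))\<^sup>2) + (norm (\<tau> 0 k - \<theta> 0 k))\<^sup>2) Y0"
    and t: "t \<in> {0..T}"
  shows "bsum (\<lambda>k. (1 + a\<^sup>2 * kweight k) * ((norm (v1 t k - u1 t k))\<^sup>2 + (norm (v2 t k - u2 t k))\<^sup>2) + (norm (\<tau> t k - \<theta> t k))\<^sup>2)
     ((Y0 + a\<^sup>2 * forcing_const M * t) * exp ((10 * pi * sqrt (lat3 * M) + 2) * t))"
proof -
  define w1 w2 e where "w1 s k = v1 s k - u1 s k" and "w2 s k = v2 s k - u2 s k" and "e s k = \<tau> s k - \<theta> s k" for s k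
  define en where "en s k = (1 + a\<^sup>2 * kweight k) * ((norm (w1 s k))\<^sup>2 + (norm (w2 s k))\<^sup>2) + (norm (e s k))\<^sup>2" for s k
  define Z where "Z s k = perp k (adv (u1 s) (u2 s) (u1 s) k) (adv (u1 s) (u2 s) (u2 s) k + \<theta> s k)" for s k
  define A where "A = 2 * pi * sqrt (lat3 * M)"
  define C where "C = 2 * B + 2 * M"
  \<comment> \<open>Both sixes are three transported components times the factor 2 from
    differentiating a square. The two summands are the errors of \<open>transport_commutator\<close>
    and of \<open>stretching_bound\<close>.\<close>
  define dn where "dn N = 6 * (2 * pi * sqrt (96 / real N * B) * C) + 6 * (A * (C / sqrt (real N)))" for N :: nat
  let ?D = "forcing_const M"
  have T0: "0 \<in> {0..T}" using t by simp
  have v0: "v1 s 0 = 0" "v2 s 0 = 0" "\<tau> s 0 = 0" "divfree (v1 s) (v2 s)"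
    and vsym: "\<And>k. v1 s (- k) = cnj (v1 s k)" "\<And>k. v2 s (- k) = cnj (v2 s k)" if "s \<in> {0..T}" for s
    using v that unfolding fsol_def by blast+
  have u0: "u1 s 0 = 0" "u2 s 0 = 0" "\<theta> s 0 = 0" "divfree (u1 s) (u2 s)" if "s \<in> {0..T}" for s
    using u that unfolding fsol_def by blast+
  have hv: "hb 0 (v1 s) B" "hb 0 (v2 s) B" "hb 0 (\<tau> s) B" and hu: "hb 0 (u1 s) M" "hb 0 (u2 s) M" "hb 0 (\<theta> s) M"
    if s: "s \<in> {0..T}" for s
    using hb_mono[OF vb(1)[OF s] _ v0(1)[OF s]] hb_mono[OF vb(2)[OF s] _ v0(2)[OF s]] vb(3)[OF s]
      hb_mono[OF ub(1)[OF s] _ u0(1)[OF s]] hb_mono[OF ub(2)[OF s] _ u0(2)[OF s]] hb_mono[OF ub(3)[OF s] _ u0(3)[OF s]]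
    by auto
  have hw: "hb 0 (w1 s) C" "hb 0 (w2 s) C" "hb 0 (e s) C" if s: "s \<in> {0..T}" for s
    unfolding w1_def[abs_def] w2_def[abs_def] e_def[abs_def] C_def by (intro hb_diff hv hu s)+
  have B0: "0 \<le> B" and M0: "0 \<le> M" and C0: "0 \<le> C"
    using hv(1)[OF T0] hu(1)[OF T0] hw(1)[OF T0] bsum_nonneg unfolding hb_def by blast+
  have A0: "0 \<le> A" by (simp add: A_def lat3_nonneg M0)
  have D0: "0 \<le> ?D"
    using bsum_nonneg[OF euler_forcing_bound[OF ub(1,2)[OF T0] u0(1,2)[OF T0] ub(3)[OF T0] u0(3)[OF T0]]] .
  have wdiv: "divfree (w1 s) (w2 s)" if s: "s \<in> {0..T}" for s
    unfolding w1_def[abs_def] w2_def[abs_def] by (intro divfree_diff v0 u0 s)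
  have split: "adv (v1 s) (v2 s) (v1 s) k - adv (u1 s) (u2 s) (u1 s) k = adv (v1 s) (v2 s) (w1 s) k + adv (w1 s) (w2 s) (u1 s) k"
    "adv (v1 s) (v2 s) (v2 s) k - adv (u1 s) (u2 s) (u2 s) k = adv (v1 s) (v2 s) (w2 s) k + adv (w1 s) (w2 s) (u2 s) k"
    "adv (v1 s) (v2 s) (\<tau> s) k - adv (u1 s) (u2 s) (\<theta> s) k = adv (v1 s) (v2 s) (e s) k + adv (w1 s) (w2 s) (\<theta> s) k"
    if s: "s \<in> {0..T}" for s k
  proof -
    have m: "hb 0 p (B + M)" if "hb 0 p B \<or> hb 0 p M" for p
      using that B0 M0 unfolding hb_def by (auto intro: bsum_mono)
    note h = hv[OF s, THEN disjI1, THEN m] hu[OF s, THEN disjI2, THEN m]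
    show "adv (v1 s) (v2 s) (v1 s) k - adv (u1 s) (u2 s) (u1 s) k = adv (v1 s) (v2 s) (w1 s) k + adv (w1 s) (w2 s) (u1 s) k"
      "adv (v1 s) (v2 s) (v2 s) k - adv (u1 s) (u2 s) (u2 s) k = adv (v1 s) (v2 s) (w2 s) k + adv (w1 s) (w2 s) (u2 s) k"
      "adv (v1 s) (v2 s) (\<tau> s) k - adv (u1 s) (u2 s) (\<theta> s) k = adv (v1 s) (v2 s) (e s) k + adv (w1 s) (w2 s) (\<theta> s) k"
      unfolding w1_def[abs_def] w2_def[abs_def] e_def[abs_def]
      by (rule adv_split[OF h(1,2,1,4,5,4)] adv_split[OF h(1,2,2,4,5,5)] adv_split[OF h(1,2,3,4,5,6)])+
  qed
  define src where "src s k = 2 * Re (cnj (w2 s k) * e s k)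
     - 2 * a\<^sup>2 * kweight k / sq2 k * Re (cnj (perp k (w1 s k) (w2 s k)) * Z s k)" for s k
  define de where "de s k =
       2 * Re (cnj (w1 s k) * adv (v1 s) (v2 s) (w1 s) k) + 2 * Re (cnj (w2 s k) * adv (v1 s) (v2 s) (w2 s) k)
     + 2 * Re (cnj (e s k) * adv (v1 s) (v2 s) (e s) k)
     + (2 * Re (cnj (w1 s k) * adv (w1 s) (w2 s) (u1 s) k) + 2 * Re (cnj (w2 s k) * adv (w1 s) (w2 s) (u2 s) k)
     + 2 * Re (cnj (e s k) * adv (w1 s) (w2 s) (\<theta> s) k))
     + src s k" for s k
  have den: "((\<lambda>s. en s k) has_real_derivative de s k) (at s within {0..T})" if s: "s \<in> {0..T}" for s k
  proof (cases "k = 0")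
    case False
    have w: "v1 r k - u1 r k = w1 r k" "v2 r k - u2 r k = w2 r k" "\<tau> r k - \<theta> r k = e r k" for r
      by (simp_all add: w1_def w2_def e_def)
    have Re_distrib: "Re (z * (x + y)) = Re (z * x) + Re (z * y)" for x y z :: complex
      unfolding distrib_left by simp
    show ?thesis
      using energy_mode_derivative[OF v u s False]
      unfolding split[OF s] w Z_def[symmetric] en_def[symmetric] Re_distrib
      by (rule DERIV_cong) (simp only: de_def src_def algebra_simps)
  next
    case True
    have z: "0 = en r k" if "r \<in> {0..T}" for r
      using v0[OF that] u0[OF that] True by (simp add: en_def w1_def w2_def e_def)
    have "de s k = 0" using v0[OF s] u0[OF s] True by (simp add: de_def src_def w1_def w2_def e_def kweight_def)
    moreover have "((\<lambda>s. en s k) has_vector_derivative 0) (at s within {0..T})"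
      by (rule has_vector_derivative_transform[OF s _ has_vector_derivative_const[of 0]]) (use z in simp)
    ultimately show ?thesis by (simp add: has_real_derivative_iff_has_vector_derivative)
  qed
  have en0: "0 \<le> en s k" for s k
    unfolding en_def by (intro add_nonneg_nonneg mult_nonneg_nonneg kweight_nonneg) auto
  have fin: "(\<Sum>k | om N k \<noteq> 0. om N k * en t k) \<le> (Y0 + (dn N + a\<^sup>2 * ?D) * t) * exp ((5 * A + 2) * t)" if N: "N > 0" for N
  proof -
    let ?S = "{k. om N k \<noteq> 0}"
    have S: "finite ?S" using N by (rule finite_om_support)
    define y where "y s = (\<Sum>k\<in>?S. om N k * en s k)" for s
    define y' where "y' s = (\<Sum>k\<in>?S. om N k * de s k)" for s
    have dy: "(y has_real_derivative y' s) (at s within {0..T})" if "s \<in> {0..T}" for s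
      unfolding y_def y'_def using that by (intro DERIV_sum DERIV_cmult den)
    have dn0: "0 \<le> dn N" unfolding dn_def using A0 B0 C0 by simp
    have le: "y' s \<le> (5 * A + 2) * y s + (dn N + a\<^sup>2 * ?D)" if s: "s \<in> {0..T}" for s
    proof -
      let ?Y = "\<lambda>z. \<Sum>k\<in>?S. om N k * (norm (z k :: complex))\<^sup>2"
      let ?R = "\<lambda>c f. Re (\<Sum>k\<in>?S. of_real (om N k) * (cnj (c k) * f k))"
      define Y1 Y2 Y3 where "Y1 = ?Y (w1 s)" and "Y2 = ?Y (w2 s)" and "Y3 = ?Y (e s)"
      define X where "X = (\<Sum>k\<in>?S. om N k * (a\<^sup>2 * kweight k * ((norm (w1 s k))\<^sup>2 + (norm (w2 s k))\<^sup>2)))"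
      have Y0: "0 \<le> Y1" "0 \<le> Y2" "0 \<le> Y3" "0 \<le> X"
        unfolding Y1_def Y2_def Y3_def X_def by (intro sum_nonneg mult_nonneg_nonneg om_nonneg kweight_nonneg; simp)+
      have y: "y s = Y1 + Y2 + Y3 + X"
        unfolding y_def Y1_def Y2_def Y3_def X_def en_def sum.distrib[symmetric]
        by (intro sum.cong refl) (simp add: algebra_simps)
      have R: "(\<Sum>k\<in>?S. om N k * (2 * Re (cnj (c k) * f k))) = 2 * ?R c f" for c f
        by (simp only: Re_sum Re_of_real_mult sum_distrib_left mult.left_commute[of "om N _" 2])
      have comm: "?R c (adv (v1 s) (v2 s) c) \<le> 2 * pi * sqrt (96 / real N * B) * C" if "hb 0 c C" for c
        using transport_commutator[OF N v0(4)[OF s] vsym[OF s] v0(1,2)[OF s] vb(1,2)[OF s] that] by linarith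
      have str: "?R c (adv (w1 s) (w2 s) g) \<le> A * (?Y c + (Y1 + Y2) / 2 + C / sqrt (real N))"
        if "hb 0 c C" "hb 3 g M" "g 0 = 0" for c g
        using stretching_bound[OF N wdiv[OF s] hw(1,2)[OF s] that] unfolding A_def Y1_def Y2_def by linarith
      \<comment> \<open>Young's inequality is applied to the buoyancy, giving Y2 + Y3, and to the
        defect. In the latter \<open>kweight k\<close> divided by \<open>sq2 k\<close> is the
        constant 4 pi^2, so one part reproduces the regularised energy X and the other is the
        forcing of the Euler solution.\<close>
      have last: "(\<Sum>k\<in>?S. om N k * src s k)
        \<le> Y2 + Y3 + X + a\<^sup>2 * ?D"
      proof -
        have young: "2 * Re (cnj p * d) \<le> (norm p)\<^sup>2 + (norm d)\<^sup>2" "- 2 * Re (cnj p * d) \<le> (norm p)\<^sup>2 + (norm d)\<^sup>2" for p d :: complex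
          using sum_squares_bound[of "norm p" "norm d"] abs_Re_le_cmod[of "cnj p * d"]
          by (simp_all only: norm_mult complex_mod_cnj mult.assoc)
        have pt: "om N k * src s k
           \<le> om N k * (norm (w2 s k))\<^sup>2 + om N k * (norm (e s k))\<^sup>2 + om N k * (a\<^sup>2 * kweight k * ((norm (w1 s k))\<^sup>2 + (norm (w2 s k))\<^sup>2))
             + a\<^sup>2 * (4 * pi\<^sup>2 * (norm (Z s k))\<^sup>2)" for k
        proof (cases "k = 0")
          case True
          have "2 * Re (cnj (w2 s k) * e s k) \<le> (norm (w2 s k))\<^sup>2 + (norm (e s k))\<^sup>2" by (rule young)
          hence "om N k * (2 * Re (cnj (w2 s k) * e s k)) \<le> om N k * ((norm (w2 s k))\<^sup>2 + (norm (e s k))\<^sup>2)"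
            by (intro mult_left_mono om_nonneg)
          thus ?thesis using True by (simp add: src_def kweight_def sq2_def distrib_left add_increasing2)
        next
          case False
          hence q: "sq2 k > 0" by (rule sq2_pos)
          let ?z = "perp k (w1 s k) (w2 s k)"
          have kq: "kweight k / sq2 k = 4 * pi\<^sup>2" using q by (simp add: kweight_sq2)
          have "- 2 * a\<^sup>2 * kweight k / sq2 k * Re (cnj ?z * Z s k) = a\<^sup>2 * (kweight k / sq2 k) * (- 2 * Re (cnj ?z * Z s k))"
          proof -
            have "- 2 * a' * p / q * r = a' * (p / q) * (- 2 * r)" for a' p q r :: real by simp
            thus ?thesis .
          qed
          also have "\<dots> \<le> a\<^sup>2 * (kweight k / sq2 k) * ((norm ?z)\<^sup>2 + (norm (Z s k))\<^sup>2)"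
            using q by (intro mult_left_mono young mult_nonneg_nonneg divide_nonneg_pos kweight_nonneg) auto
          also have "\<dots> = a\<^sup>2 * kweight k * ((norm (w1 s k))\<^sup>2 + (norm (w2 s k))\<^sup>2) + a\<^sup>2 * (4 * pi\<^sup>2 * (norm (Z s k))\<^sup>2)"
          proof -
            have e1: "a\<^sup>2 * (kweight k / sq2 k) * (sq2 k * x) = a\<^sup>2 * kweight k * x" for x using q by simp
            have e2: "a\<^sup>2 * (kweight k / sq2 k) * x = a\<^sup>2 * (4 * pi\<^sup>2 * x)" for x unfolding kq by simp
            show ?thesis
              unfolding divfree_perp(1)[OF wdiv[OF s], symmetric]
              unfolding distrib_left[of "a\<^sup>2 * (kweight k / sq2 k)"] unfolding e1 unfolding e2 ..
          qed
          finally have "om N k * src s k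
            \<le> om N k * (((norm (w2 s k))\<^sup>2 + (norm (e s k))\<^sup>2) + (a\<^sup>2 * kweight k * ((norm (w1 s k))\<^sup>2 + (norm (w2 s k))\<^sup>2) + a\<^sup>2 * (4 * pi\<^sup>2 * (norm (Z s k))\<^sup>2)))"
            using young(1)[of "w2 s k" "e s k"] unfolding src_def by (intro mult_left_mono om_nonneg) linarith
          moreover have "om N k * (a\<^sup>2 * (4 * pi\<^sup>2 * (norm (Z s k))\<^sup>2)) \<le> 1 * (a\<^sup>2 * (4 * pi\<^sup>2 * (norm (Z s k))\<^sup>2))"
            by (intro mult_right_mono om_le_1) simp
          ultimately show ?thesis by (simp only: distrib_left mult_1)
        qed
        have "(\<Sum>k\<in>?S. 4 * pi\<^sup>2 * (norm (Z s k))\<^sup>2) \<le> ?D"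
          unfolding Z_def by (rule bsumD[OF euler_forcing_bound[OF ub(1,2)[OF s] u0(1,2)[OF s] ub(3)[OF s] u0(3)[OF s]] S])
        hence "a\<^sup>2 * (\<Sum>k\<in>?S. 4 * pi\<^sup>2 * (norm (Z s k))\<^sup>2) \<le> a\<^sup>2 * ?D" by (intro mult_left_mono) auto
        moreover have "(\<Sum>k\<in>?S. om N k * src s k)
          \<le> (\<Sum>k\<in>?S. om N k * (norm (w2 s k))\<^sup>2 + om N k * (norm (e s k))\<^sup>2 + om N k * (a\<^sup>2 * kweight k * ((norm (w1 s k))\<^sup>2 + (norm (w2 s k))\<^sup>2))
             + a\<^sup>2 * (4 * pi\<^sup>2 * (norm (Z s k))\<^sup>2))"
          by (rule sum_mono) (rule pt)
        ultimately show ?thesis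
          unfolding Y2_def Y3_def X_def sum.distrib sum_distrib_left by linarith
      qed
      have "y' s = 2 * ?R (w1 s) (adv (v1 s) (v2 s) (w1 s)) + 2 * ?R (w2 s) (adv (v1 s) (v2 s) (w2 s)) + 2 * ?R (e s) (adv (v1 s) (v2 s) (e s))
         + (2 * ?R (w1 s) (adv (w1 s) (w2 s) (u1 s)) + 2 * ?R (w2 s) (adv (w1 s) (w2 s) (u2 s)) + 2 * ?R (e s) (adv (w1 s) (w2 s) (\<theta> s)))
         + (\<Sum>k\<in>?S. om N k * src s k)"
        unfolding y'_def de_def R[symmetric] sum.distrib[symmetric] distrib_left[symmetric] ..
      also have "\<dots> \<le> 2 * (2 * pi * sqrt (96 / real N * B) * C) + 2 * (2 * pi * sqrt (96 / real N * B) * C) + 2 * (2 * pi * sqrt (96 / real N * B) * C)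
         + (2 * (A * (Y1 + (Y1 + Y2) / 2 + C / sqrt (real N))) + 2 * (A * (Y2 + (Y1 + Y2) / 2 + C / sqrt (real N))) + 2 * (A * (Y3 + (Y1 + Y2) / 2 + C / sqrt (real N))))
         + (Y2 + Y3 + X + a\<^sup>2 * ?D)"
        using str[OF hw(1)[OF s] ub(1)[OF s] u0(1)[OF s]] str[OF hw(2)[OF s] ub(2)[OF s] u0(2)[OF s]] str[OF hw(3)[OF s] ub(3)[OF s] u0(3)[OF s]]
        unfolding Y1_def[symmetric] Y2_def[symmetric] Y3_def[symmetric]
        by (intro add_mono last mult_left_mono comm hw s) auto
      \<comment> \<open>Each of the three stretching terms contributes twice its own energy plus Y1
        + Y2; together this is 5 Y1 + 5 Y2 + 2 Y3.\<close>
      also have "\<dots> = A * (5 * Y1 + 5 * Y2 + 2 * Y3) + (Y2 + Y3 + X) + (dn N + a\<^sup>2 * ?D)"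
        unfolding dn_def by (simp add: algebra_simps)
      also have "\<dots> \<le> A * (5 * y s) + 2 * y s + (dn N + a\<^sup>2 * ?D)"
        using Y0 A0 unfolding y by (intro add_mono mult_left_mono order_refl) auto
      finally show ?thesis by (simp add: algebra_simps)
    qed
    have "y t \<le> (y 0 + (dn N + a\<^sup>2 * ?D) * t) * exp ((5 * A + 2) * t)"
      using A0 dn0 D0 by (intro gronwall[OF dy le _ _ t]) auto
    also have "\<dots> \<le> (Y0 + (dn N + a\<^sup>2 * ?D) * t) * exp ((5 * A + 2) * t)"
    proof (intro mult_right_mono add_right_mono)
      have "y 0 \<le> (\<Sum>k\<in>?S. en 0 k)"
        unfolding y_def by (intro sum_mono mult_left_le_one_le en0 om_nonneg om_le_1)
      also have "\<dots> \<le> Y0" using bsumD[OF init S] by (simp add: en_def w1_def w2_def e_def)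
      finally show "y 0 \<le> Y0" .
    qed simp
    finally show ?thesis by (simp add: y_def)
  qed
  \<comment> \<open>On a fixed finite set of modes the weight tends to 1 while \<open>dn N\<close>
    tends to 0. The bound does not depend on F, so it passes to the full energy.\<close>
  have "sum (en t) F \<le> (Y0 + a\<^sup>2 * ?D * t) * exp ((5 * A + 2) * t)" if F: "finite F" for F
  proof (rule LIMSEQ_le)
    have "(\<lambda>N. \<Sum>k\<in>F. om N k * en t k) \<longlonglongrightarrow> (\<Sum>k\<in>F. 1 * en t k)"
      by (intro tendsto_intros om_tendsto)
    thus "(\<lambda>N. \<Sum>k\<in>F. om N k * en t k) \<longlonglongrightarrow> sum (en t) F" by simp
    have "(\<lambda>N. sqrt (96 / real N * B)) \<longlonglongrightarrow> sqrt (0 * B)" "(\<lambda>N. sqrt (1 / real N)) \<longlonglongrightarrow> sqrt 0"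
      by (intro tendsto_intros lim_const_over_n)+
    hence "(\<lambda>N. 6 * (2 * pi * sqrt (96 / real N * B) * C) + 6 * (A * (C * sqrt (1 / real N)))) \<longlonglongrightarrow> 6 * (2 * pi * sqrt (0 * B) * C) + 6 * (A * (C * sqrt 0))"
      by (intro tendsto_intros)
    hence "dn \<longlonglongrightarrow> 0" unfolding dn_def by (simp add: real_sqrt_divide)
    hence "(\<lambda>N. (Y0 + (dn N + a\<^sup>2 * ?D) * t) * exp ((5 * A + 2) * t)) \<longlonglongrightarrow> (Y0 + (0 + a\<^sup>2 * ?D) * t) * exp ((5 * A + 2) * t)"
      by (intro tendsto_intros)
    thus "(\<lambda>N. (Y0 + (dn N + a\<^sup>2 * ?D) * t) * exp ((5 * A + 2) * t)) \<longlonglongrightarrow> (Y0 + a\<^sup>2 * ?D * t) * exp ((5 * A + 2) * t)" by simp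
    show "\<exists>N0. \<forall>N\<ge>N0. (\<Sum>k\<in>F. om N k * en t k) \<le> (Y0 + (dn N + a\<^sup>2 * ?D) * t) * exp ((5 * A + 2) * t)"
    proof (intro exI[of _ 1] allI impI)
      fix N :: nat assume "1 \<le> N"
      hence N: "N > 0" by simp
      have "(\<Sum>k\<in>F. om N k * en t k) \<le> (\<Sum>k | om N k \<noteq> 0. om N k * en t k)"
        by (rule bsumD[OF bsum_finite_support[OF finite_om_support[OF N]] F]) (auto simp: om_nonneg en0)
      thus "(\<Sum>k\<in>F. om N k * en t k) \<le> (Y0 + (dn N + a\<^sup>2 * ?D) * t) * exp ((5 * A + 2) * t)"
        using fin[OF N] by linarith
    qed
  qed
  moreover have "5 * A = 10 * pi * sqrt (lat3 * M)" by (simp add: A_def)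
  ultimately show ?thesis unfolding bsum_def en_def w1_def w2_def e_def by simp
qed

section \<open>Solutions and their Fourier coefficients\<close>

lemma in_HsD:
  assumes "in_Hs s f"
  shows "in_L2 f" "fcoef f 0 = 0" "bsum (\<lambda>k. kweight k powr s * (norm (fcoef f k))\<^sup>2) (Hs_sq s f)"
proof -
  show "in_L2 f" "fcoef f 0 = 0" using assms by (simp_all add: in_Hs_def zero_prod_def)
  show "bsum (\<lambda>k. kweight k powr s * (norm (fcoef f k))\<^sup>2) (Hs_sq s f)"
    using assms unfolding in_Hs_def Hs_sq_def bsum_def by (auto intro!: finite_sum_le_infsum)
qed

lemma Hs_sq_nonneg: "0 \<le> Hs_sq s f"
  unfolding Hs_sq_def by (rule infsum_nonneg) simp

lemma bsum_Hs_diff: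
  assumes f: "in_Hs s f" and g: "in_Hs s g"
  shows "bsum (\<lambda>k. kweight k powr s * (norm (fcoef f k - fcoef g k))\<^sup>2) (Hs_sq s (\<lambda>x. f x - g x))"
proof -
  have d: "fcoef (\<lambda>x. f x - g x) k = fcoef f k - fcoef g k" for k
    by (intro fcoef_diff in_L2_imp_integrable in_HsD(1)[OF f] in_HsD(1)[OF g])
  \<comment> \<open>An infinite sum that does not converge has the value 0 by convention, so
    summability of the difference has to be shown before its norm can bound anything.\<close>
  have "bsum (\<lambda>k. kweight k powr s * (norm (fcoef f k - fcoef g k))\<^sup>2) (2 * Hs_sq s f + 2 * Hs_sq s g)"
  proof (rule bsum_mono)
    show "bsum (\<lambda>k. 2 * (kweight k powr s * (norm (fcoef f k))\<^sup>2) + 2 * (kweight k powr s * (norm (fcoef g k))\<^sup>2)) (2 * Hs_sq s f + 2 * Hs_sq s g)"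
      by (intro bsum_add bsum_cmult in_HsD f g) auto
    fix k
    have "kweight k powr s * (norm (fcoef f k - fcoef g k))\<^sup>2 \<le> kweight k powr s * (2 * (norm (fcoef f k))\<^sup>2 + 2 * (norm (fcoef g k))\<^sup>2)"
      using norm_add_sq_le[of "fcoef f k" "- fcoef g k"] by (intro mult_left_mono) auto
    thus "kweight k powr s * (norm (fcoef f k - fcoef g k))\<^sup>2 \<le> 2 * (kweight k powr s * (norm (fcoef f k))\<^sup>2) + 2 * (kweight k powr s * (norm (fcoef g k))\<^sup>2)"
      by (simp add: algebra_simps)
  qed simp
  hence "(\<lambda>k. kweight k powr s * (norm (fcoef f k - fcoef g k))\<^sup>2) summable_on UNIV"
    by (intro nonneg_bdd_above_summable_on) (auto simp: bdd_above_def bsum_def)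
  thus ?thesis unfolding bsum_def Hs_sq_def d by (auto intro!: finite_sum_le_infsum)
qed

lemma hb_1_kweight:
  assumes "bsum (\<lambda>k. kweight k powr 1 * (norm (p k))\<^sup>2) B" shows "hb 1 p B"
  unfolding hb_def
proof (rule bsum_mono[OF assms])
  fix k show "(kn k ^ 1 * norm (p k))\<^sup>2 \<le> kweight k powr 1 * (norm (p k))\<^sup>2"
    using kweight_ge[of k] by (simp add: power_mult_distrib mult_right_mono kweight_nonneg)
qed simp

lemma hb_3_kweight:
  assumes "bsum (\<lambda>k. kweight k powr 3 * (norm (p k))\<^sup>2) B" shows "hb 3 p B"
  unfolding hb_def
proof (rule bsum_mono[OF assms])
  fix k
  have "((kn k)\<^sup>2) ^ 3 \<le> kweight k ^ 3" by (intro power_mono kweight_ge) simp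
  hence "(kn k ^ 3)\<^sup>2 \<le> kweight k powr 3" by (simp add: kweight_nonneg flip: power_mult)
  thus "(kn k ^ 3 * norm (p k))\<^sup>2 \<le> kweight k powr 3 * (norm (p k))\<^sup>2"
    unfolding power_mult_distrib by (rule mult_right_mono) simp
qed simp

lemma kweight_ge_1: "k \<noteq> 0 \<Longrightarrow> 1 \<le> kweight k"
  using kweight_ge[of k] one_le_power[OF knat_pos, of k 2] by linarith

lemma bsum_kweight_3_1:
  assumes "bsum (\<lambda>k. kweight k powr 3 * (norm (p k))\<^sup>2) B"
  shows "bsum (\<lambda>k. kweight k * (norm (p k))\<^sup>2) B"
proof (rule bsum_mono[OF assms])
  fix k
  have "kweight k \<le> kweight k powr 3"
  proof (cases "k = 0")
    case False
    have "kweight k ^ 1 \<le> kweight k ^ 3" by (intro power_increasing kweight_ge_1 False) simp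
    thus ?thesis by (simp add: kweight_nonneg)
  qed (simp add: kweight_def)
  thus "kweight k * (norm (p k))\<^sup>2 \<le> kweight k powr 3 * (norm (p k))\<^sup>2" by (rule mult_right_mono) simp
qed simp

text \<open>For a nonzero frequency the weight is a positive constant, whatever the sign of s, so
  continuity in the norm bounds the single coefficient. At 0 the coefficient vanishes
  identically.\<close>

lemma continuous_on_coef:
  fixes p :: "real \<Rightarrow> int \<times> int \<Rightarrow> complex"
  assumes 0: "\<And>t. t \<in> S \<Longrightarrow> p t 0 = 0"
    and lim: "\<And>t. t \<in> S \<Longrightarrow> ((\<lambda>r. H r t) \<longlongrightarrow> 0) (at t within S)"
    and le: "\<And>r t. r \<in> S \<Longrightarrow> t \<in> S \<Longrightarrow> bsum (\<lambda>k. kweight k powr s * (norm (p r k - p t k))\<^sup>2) (H r t)"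
  shows "continuous_on S (\<lambda>t. p t k)"
proof (cases "k = 0")
  case True
  thus ?thesis using 0 continuous_on_cong[of S S "\<lambda>t. p t k" "\<lambda>_. 0"] by simp
next
  case False
  define c where "c = kweight k powr s"
  have c: "c > 0" using kweight_ge_1[OF False] by (simp add: c_def)
  show ?thesis unfolding continuous_on_def
  proof
    fix t assume t: "t \<in> S"
    have ev: "\<forall>\<^sub>F r in at t within S. r \<in> S" by (simp add: eventually_at_filter)
    have "((\<lambda>r. sqrt (H r t / c)) \<longlongrightarrow> sqrt (0 / c)) (at t within S)"
      using c by (intro tendsto_intros lim t) auto
    hence l1: "((\<lambda>r. sqrt (H r t / c)) \<longlongrightarrow> 0) (at t within S)" by simp
    have l2: "\<forall>\<^sub>F r in at t within S. norm (p r k - p t k) \<le> sqrt (H r t / c)"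
      using ev
    proof eventually_elim
      case (elim r)
      have "c * (norm (p r k - p t k))\<^sup>2 \<le> H r t" using bsumD[OF le[OF elim t], of "{k}"] by (simp add: c_def)
      hence "(norm (p r k - p t k))\<^sup>2 \<le> H r t / c" using c by (simp add: field_simps)
      thus ?case by (rule real_le_rsqrt)
    qed
    show "((\<lambda>t. p t k) \<longlongrightarrow> p t k) (at t within S)"
      by (rule Lim_null[THEN iffD2, OF Lim_null_comparison[OF l2 l1]])
  qed
qed

lemma c1_diff: "c1 (\<lambda>x. u x - v x) = (\<lambda>x. c1 u x - c1 v x)"
  and c2_diff: "c2 (\<lambda>x. u x - v x) = (\<lambda>x. c2 u x - c2 v x)"
  by (simp_all add: c1_def c2_def)

lemma bsum_Hs_v_diff:
  assumes "in_Hs_v s u" "in_Hs_v s v"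
  shows "bsum (\<lambda>k. kweight k powr s * (norm (fcoef (c1 u) k - fcoef (c1 v) k))\<^sup>2) (Hs_sq_v s (\<lambda>x. u x - v x))"
    "bsum (\<lambda>k. kweight k powr s * (norm (fcoef (c2 u) k - fcoef (c2 v) k))\<^sup>2) (Hs_sq_v s (\<lambda>x. u x - v x))"
proof -
  have *: "bsum (\<lambda>k. kweight k powr s * (norm (fcoef (c1 u) k - fcoef (c1 v) k))\<^sup>2) (Hs_sq s (\<lambda>x. c1 u x - c1 v x))"
    "bsum (\<lambda>k. kweight k powr s * (norm (fcoef (c2 u) k - fcoef (c2 v) k))\<^sup>2) (Hs_sq s (\<lambda>x. c2 u x - c2 v x))"
    using assms by (auto simp: in_Hs_v_def intro: bsum_Hs_diff)
  show "bsum (\<lambda>k. kweight k powr s * (norm (fcoef (c1 u) k - fcoef (c1 v) k))\<^sup>2) (Hs_sq_v s (\<lambda>x. u x - v x))"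
    by (rule bsum_mono[OF *(1)]) (simp_all add: Hs_sq_v_def c1_diff c2_diff Hs_sq_nonneg)
  show "bsum (\<lambda>k. kweight k powr s * (norm (fcoef (c2 u) k - fcoef (c2 v) k))\<^sup>2) (Hs_sq_v s (\<lambda>x. u x - v x))"
    by (rule bsum_mono[OF *(2)]) (simp_all add: Hs_sq_v_def c1_diff c2_diff Hs_sq_nonneg)
qed

text \<open>The bridge from weak solutions to mode equations. The initial coefficients are
  identified through the orthogonal component, which together with incompressibility determines both
  velocity components.\<close>

lemma weak_eq_fsol:
  assumes T: "T > 0" and weak: "weak_eq a T u0 th0 u th"
    and V: "\<And>t. t \<in> {0..T} \<Longrightarrow> in_V (u t)" and th: "\<And>t. t \<in> {0..T} \<Longrightarrow> in_L2 (th t)" "\<And>t. t \<in> {0..T} \<Longrightarrow> fcoef (th t) 0 = 0"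
    and V0: "in_V u0" and th0: "in_L2 th0" "fcoef th0 0 = 0"
    and bd: "\<And>t. t \<in> {0..T} \<Longrightarrow> hb 1 (fcoef (c1 (u t))) D" "\<And>t. t \<in> {0..T} \<Longrightarrow> hb 1 (fcoef (c2 (u t))) D"
      "\<And>t. t \<in> {0..T} \<Longrightarrow> hb 0 (fcoef (th t)) M"
    and ct: "\<And>k. continuous_on {0..T} (\<lambda>t. fcoef (c1 (u t)) k)" "\<And>k. continuous_on {0..T} (\<lambda>t. fcoef (c2 (u t)) k)"
      "\<And>k. continuous_on {0..T} (\<lambda>t. fcoef (th t) k)"
  shows "fsol a T (\<lambda>t. fcoef (c1 (u t))) (\<lambda>t. fcoef (c2 (u t))) (\<lambda>t. fcoef (th t))"
    and "fcoef (c1 (u 0)) = fcoef (c1 u0)" "fcoef (c2 (u 0)) = fcoef (c2 u0)" "fcoef (th 0) = fcoef th0"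
proof -
  have L2: "in_L2 (c1 (u t))" "in_L2 (c2 (u t))" and z: "fcoef (c1 (u t)) 0 = 0" "fcoef (c2 (u t)) 0 = 0"
    and df: "divfree (fcoef (c1 (u t))) (fcoef (c2 (u t)))" if "t \<in> {0..T}" for t
    using V[OF that] by (auto simp: in_V_def in_Hs_v_def divfree_def dest: in_HsD)
  have L20: "in_L2 (c1 u0)" "in_L2 (c2 u0)" and z0: "fcoef (c1 u0) 0 = 0" "fcoef (c2 u0) 0 = 0"
    and df0: "divfree (fcoef (c1 u0)) (fcoef (c2 u0))"
    using V0 by (auto simp: in_V_def in_Hs_v_def divfree_def dest: in_HsD)
  have bd0: "hb 0 (fcoef (c1 (u t))) D" "hb 0 (fcoef (c2 (u t))) D" if "t \<in> {0..T}" for t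
    using hb_mono[OF bd(1)[OF that] _ z(1)[OF that]] hb_mono[OF bd(2)[OF that] _ z(2)[OF that]] by auto
  have sq1: "(\<Sum>m\<in>F. (kn m * norm (fcoef (c1 (u t)) m))\<^sup>2) \<le> D" "(\<Sum>m\<in>F. (kn m * norm (fcoef (c2 (u t)) m))\<^sup>2) \<le> D"
    "(\<Sum>m\<in>F. (norm (fcoef (c1 (u t)) m))\<^sup>2) \<le> D" "(\<Sum>m\<in>F. (norm (fcoef (c2 (u t)) m))\<^sup>2) \<le> D"
    "(\<Sum>m\<in>F. (norm (fcoef (th t) m))\<^sup>2) \<le> M" if "t \<in> {0..T}" "finite F" for t F
    using bd(1,2)[OF that(1)] bd0[OF that(1)] bd(3)[OF that(1)] that(2) by (simp_all add: hb_def bsum_def)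
  have cc: "continuous_on {0..T} (\<lambda>t. cv (fcoef (c1 (u t))) (fcoef (th t)) k)"
    "continuous_on {0..T} (\<lambda>t. cv (fcoef (c2 (u t))) (fcoef (th t)) k)"
    "continuous_on {0..T} (\<lambda>t. cv (fcoef (c1 (u t))) (fcoef (c1 (u t))) k)"
    "continuous_on {0..T} (\<lambda>t. cv (fcoef (c1 (u t))) (fcoef (c2 (u t))) k)"
    "continuous_on {0..T} (\<lambda>t. cv (fcoef (c2 (u t))) (fcoef (c1 (u t))) k)"
    "continuous_on {0..T} (\<lambda>t. cv (fcoef (c2 (u t))) (fcoef (c2 (u t))) k)" for k
    by (rule continuous_on_cv; (rule sq1 z ct; assumption)?; rule ct)+
  note weak1 = weak[unfolded weak_eq_def, THEN conjunct1, rule_format]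
  note weak2 = weak[unfolded weak_eq_def, THEN conjunct2, rule_format]
  note th_ode = theta_ode[OF T _ weak2 th(1) L2 th0(1) ct(3) cc(1,2)]
  note u_ode = velocity_ode[OF T _ weak1 th(1) L2 L20 ct(3,1,2) cc(3-6)]
  have zT: "0 \<in> {0..T}" using T by simp
  show "fsol a T (\<lambda>t. fcoef (c1 (u t))) (\<lambda>t. fcoef (c2 (u t))) (\<lambda>t. fcoef (th t))"
    unfolding fsol_def
  proof (intro ballI conjI allI impI)
    fix t k assume t: "t \<in> {0..T}" and k: "k \<noteq> (0 :: int \<times> int)"
    show "((\<lambda>s. of_real (1 + a\<^sup>2 * kweight k) * perp k (fcoef (c1 (u s)) k) (fcoef (c2 (u s)) k)) has_vector_derivative
       perp k (adv (fcoef (c1 (u t))) (fcoef (c2 (u t))) (fcoef (c1 (u t))) k)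
         (adv (fcoef (c1 (u t))) (fcoef (c2 (u t))) (fcoef (c2 (u t))) k + fcoef (th t) k)) (at t within {0..T})"
      by (rule u_ode(1)[OF k _ _ _ _ t])
    show "((\<lambda>s. fcoef (th s) k) has_vector_derivative adv (fcoef (c1 (u t))) (fcoef (c2 (u t))) (fcoef (th t)) k) (at t within {0..T})"
      by (rule th_ode(1)[OF k _ _ _ _ t])
  qed (auto simp: df z th fcoef_uminus_index)
  have p: "perp k (fcoef (c1 (u 0)) k) (fcoef (c2 (u 0)) k) = perp k (fcoef (c1 u0) k) (fcoef (c2 u0) k)" if "k \<noteq> 0" for k
    by (rule u_ode(2)[OF that])
  show "fcoef (c1 (u 0)) = fcoef (c1 u0)"
  proof
    fix k show "fcoef (c1 (u 0)) k = fcoef (c1 u0) k"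
    proof (cases "k = 0")
      case False
      have "of_real (sq2 k) * fcoef (c1 (u 0)) k = of_real (sq2 k) * fcoef (c1 u0) k"
        unfolding perp_recover(1)[OF df[OF zT]] perp_recover(1)[OF df0] p[OF False] ..
      thus ?thesis using sq2_pos[OF False] by simp
    qed (simp add: z[OF zT] z0)
  qed
  show "fcoef (c2 (u 0)) = fcoef (c2 u0)"
  proof
    fix k show "fcoef (c2 (u 0)) k = fcoef (c2 u0) k"
    proof (cases "k = 0")
      case False
      have "of_real (sq2 k) * fcoef (c2 (u 0)) k = of_real (sq2 k) * fcoef (c2 u0) k"
        unfolding perp_recover(2)[OF df[OF zT]] perp_recover(2)[OF df0] p[OF False] ..
      thus ?thesis using sq2_pos[OF False] by simp
    qed (simp add: z[OF zT] z0)
  qed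
  show "fcoef (th 0) = fcoef th0"
  proof
    fix k show "fcoef (th 0) k = fcoef th0 k"
    proof (cases "k = 0")
      case False
      show ?thesis by (rule th_ode(2)[OF False])
    qed (simp add: th(2)[OF zT] th0(2))
  qed
qed

section \<open>Both notions of solution in coefficient form\<close>

lemma hb_3_Hs: "in_Hs 3 f \<Longrightarrow> hb 3 (fcoef f) (Hs_sq 3 f)"
  by (intro hb_3_kweight in_HsD)

lemma hb_le: "hb n p A \<Longrightarrow> A \<le> B \<Longrightarrow> hb n p B"
  unfolding hb_def by (erule bsum_mono) auto

lemma Palpha_sol_fsol:
  assumes sol: "Palpha_sol a T u0 th0 u th" and T: "T > 0" and a: "a > 0"
    and u0: "in_Hs_v 3 u0" "in_V u0" and th0: "in_Hs 3 th0"
  obtains B where "fsol a T (\<lambda>t. fcoef (c1 (u t))) (\<lambda>t. fcoef (c2 (u t))) (\<lambda>t. fcoef (th t))"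
    "fcoef (c1 (u 0)) = fcoef (c1 u0)" "fcoef (c2 (u 0)) = fcoef (c2 u0)" "fcoef (th 0) = fcoef th0"
    "\<And>t. t \<in> {0..T} \<Longrightarrow> hb 2 (fcoef (c1 (u t))) B" "\<And>t. t \<in> {0..T} \<Longrightarrow> hb 2 (fcoef (c2 (u t))) B"
    "\<And>t. t \<in> {0..T} \<Longrightarrow> hb 0 (fcoef (th t)) B"
proof -
  have V: "in_V (u t)" and H0: "in_Hs 0 (th t)" if "t \<in> {0..T}" for t
    using sol that unfolding Palpha_sol_def by blast+
  have Hv: "in_Hs_v 1 (u t)" if "t \<in> {0..T}" for t using V[OF that] unfolding in_V_def by blast
  obtain L where L: "\<And>s t. s \<in> {0..T} \<Longrightarrow> t \<in> {0..T} \<Longrightarrow> sqrt (Vnorm_sq (\<lambda>x. u s x - u t x)) \<le> L * \<bar>s - t\<bar>"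
    using sol unfolding Palpha_sol_def by blast
  obtain M where M: "\<And>t. t \<in> {0..T} \<Longrightarrow> Int2 (\<lambda>x. (th t x)\<^sup>2) \<le> M"
    using sol unfolding Palpha_sol_def by blast
  have cont: "cont_Hs_v 1 T u" and weakc: "\<And>g. in_L2 g \<Longrightarrow> continuous_on {0..T} (\<lambda>t. L2i (th t) g)"
    and weak: "weak_eq a T u0 th0 u th"
    using sol unfolding Palpha_sol_def by blast+
  have z: "fcoef (c1 (u t)) 0 = 0" "fcoef (c2 (u t)) 0 = 0" if "t \<in> {0..T}" for t
    using Hv[OF that] by (auto simp: in_Hs_v_def dest: in_HsD)
  have zT: "0 \<in> {0..T}" using T by simp
  have M': "hb 0 (fcoef (th t)) M" if t: "t \<in> {0..T}" for t
    unfolding hb_0 bsum_def using Bessel[OF in_HsD(1)[OF H0[OF t]]] M[OF t] by (auto intro: order_trans)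
  \<comment> \<open>The Lipschitz bound in V confines u(t) to distance L T from u(0), which gives an
    \<open>H^1\<close> bound uniform on [0, T].\<close>
  define D where "D = 2 * ((L * T)\<^sup>2) + 2 * Hs_sq_v 1 (u 0)"
  have Vb: "Hs_sq_v 1 (\<lambda>x. u t x - u 0 x) \<le> (L * T)\<^sup>2" if t: "t \<in> {0..T}" for t
  proof -
    have nn: "0 \<le> Vnorm_sq (\<lambda>x. u t x - u 0 x)" unfolding Vnorm_sq_def Hs_sq_v_def by (intro add_nonneg_nonneg Hs_sq_nonneg)
    have "0 \<le> L * \<bar>T - 0\<bar>" by (rule order_trans[OF _ L]) (use T nn in \<open>auto simp: Vnorm_sq_def Hs_sq_v_def intro!: add_nonneg_nonneg Hs_sq_nonneg\<close>)
    hence L0: "0 \<le> L" using T by (simp add: zero_le_mult_iff)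
    have "sqrt (Vnorm_sq (\<lambda>x. u t x - u 0 x)) \<le> L * \<bar>t - 0\<bar>" by (rule L[OF t zT])
    also have "\<dots> \<le> L * T" using t L0 by (intro mult_left_mono) auto
    finally have "(sqrt (Vnorm_sq (\<lambda>x. u t x - u 0 x)))\<^sup>2 \<le> (L * T)\<^sup>2" by (rule power_mono) (use nn in simp)
    thus ?thesis using nn by (simp add: Vnorm_sq_def)
  qed
  have b0: "hb 1 (fcoef (c1 (u 0))) (Hs_sq_v 1 (u 0))" "hb 1 (fcoef (c2 (u 0))) (Hs_sq_v 1 (u 0))"
  proof -
    have H: "in_Hs 1 (c1 (u 0))" "in_Hs 1 (c2 (u 0))" using Hv[OF zT] unfolding in_Hs_v_def by blast+
    show "hb 1 (fcoef (c1 (u 0))) (Hs_sq_v 1 (u 0))" "hb 1 (fcoef (c2 (u 0))) (Hs_sq_v 1 (u 0))"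
      using hb_le[OF hb_1_kweight[OF in_HsD(3)[OF H(1)]], of "Hs_sq_v 1 (u 0)"]
        hb_le[OF hb_1_kweight[OF in_HsD(3)[OF H(2)]], of "Hs_sq_v 1 (u 0)"]
      by (simp_all add: Hs_sq_v_def Hs_sq_nonneg)
  qed
  have bd: "hb 1 (fcoef (c1 (u t))) D" "hb 1 (fcoef (c2 (u t))) D" if t: "t \<in> {0..T}" for t
  proof -
    have neg: "hb 1 (\<lambda>k. - p k) A" if "hb 1 p A" for p A using that by (simp add: hb_def)
    have "hb 1 (\<lambda>k. fcoef (c1 (u t)) k - fcoef (c1 (u 0)) k) ((L * T)\<^sup>2)" "hb 1 (\<lambda>k. fcoef (c2 (u t)) k - fcoef (c2 (u 0)) k) ((L * T)\<^sup>2)"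
      by (rule hb_le[OF hb_1_kweight[OF bsum_Hs_v_diff(1)[OF Hv[OF t] Hv[OF zT]]] Vb[OF t]]
          hb_le[OF hb_1_kweight[OF bsum_Hs_v_diff(2)[OF Hv[OF t] Hv[OF zT]]] Vb[OF t]])+
    from hb_diff[OF this(1) neg[OF b0(1)]] hb_diff[OF this(2) neg[OF b0(2)]]
    show "hb 1 (fcoef (c1 (u t))) D" "hb 1 (fcoef (c2 (u t))) D" unfolding D_def by simp_all
  qed
  have lim: "((\<lambda>r. Hs_sq_v 1 (\<lambda>x. u r x - u t x)) \<longlongrightarrow> 0) (at t within {0..T})" if "t \<in> {0..T}" for t
    using cont that unfolding cont_Hs_v_def by blast
  have cu: "continuous_on {0..T} (\<lambda>t. fcoef (c1 (u t)) k)" "continuous_on {0..T} (\<lambda>t. fcoef (c2 (u t)) k)" for k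
    by (rule continuous_on_coef[OF _ lim, where s = 1]; use z bsum_Hs_v_diff Hv in blast)+
  \<comment> \<open>The buoyancy is only weakly continuous in time; testing with waves of two phases
    is enough for the continuity of each coefficient.\<close>
  have ct: "continuous_on {0..T} (\<lambda>t. fcoef (th t) k)" for k
  proof -
    have w: "continuous_on {0..T} (\<lambda>t. Re (cis (- b) * fcoef (th t) k))" for b
    proof -
      have one: "in_L2 (\<lambda>_. 1)" unfolding in_L2_torus by simp
      have "in_L2 (wave b k)" using in_L2_mult_wave[OF one, of b k] by simp
      from weakc[OF this] show ?thesis
        by (rule continuous_on_eq) (simp add: L2i_def Int2_mult_wave in_L2_imp_integrable in_HsD(1)[OF H0] del: times_complex.sel)
    qed
    have "continuous_on {0..T} (\<lambda>t. complex_of_real (Re (cis (- 0) * fcoef (th t) k)) + \<i> * complex_of_real (Re (cis (- (pi / 2)) * fcoef (th t) k)))"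
      by (intro continuous_intros w)
    thus ?thesis by (rule continuous_on_eq) (simp add: complex_eq_iff)
  qed
  have F: "fsol a T (\<lambda>t. fcoef (c1 (u t))) (\<lambda>t. fcoef (c2 (u t))) (\<lambda>t. fcoef (th t))"
    "fcoef (c1 (u 0)) = fcoef (c1 u0)" "fcoef (c2 (u 0)) = fcoef (c2 u0)" "fcoef (th 0) = fcoef th0"
    by (rule weak_eq_fsol[OF T weak V in_HsD(1)[OF H0] in_HsD(2)[OF H0] u0(2) in_HsD(1,2)[OF th0] bd M' cu ct]; assumption)+
  have u03: "in_Hs 3 (c1 u0)" "in_Hs 3 (c2 u0)" using u0(1) unfolding in_Hs_v_def by auto
  define I where "I = Hs_sq 3 (c1 u0) + Hs_sq 3 (c2 u0)"
  have init: "hb 2 (fcoef (c1 (u 0))) I" "hb 2 (fcoef (c2 (u 0))) I"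
    unfolding F(2,3) I_def
    by (rule hb_le[OF hb_mono[OF hb_3_Hs[OF u03(1)]]]; use in_HsD(2)[OF u03(1)] in \<open>simp add: Hs_sq_nonneg\<close>)
       (rule hb_le[OF hb_mono[OF hb_3_Hs[OF u03(2)]]]; use in_HsD(2)[OF u03(2)] in \<open>simp add: Hs_sq_nonneg\<close>)
  obtain B where B: "\<And>t. t \<in> {0..T} \<Longrightarrow> hb 2 (fcoef (c1 (u t))) B" "\<And>t. t \<in> {0..T} \<Longrightarrow> hb 2 (fcoef (c2 (u t))) B"
    by (rule voigt_H2[OF F(1) a bd M' init]) blast+
  show ?thesis
  proof (rule that[of "max B M", OF F])
    fix t assume t: "t \<in> {0..T}"
    show "hb 2 (fcoef (c1 (u t))) (max B M)" by (rule hb_le[OF B(1)[OF t]]) simp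
    show "hb 2 (fcoef (c2 (u t))) (max B M)" by (rule hb_le[OF B(2)[OF t]]) simp
    show "hb 0 (fcoef (th t)) (max B M)" by (rule hb_le[OF M'[OF t]]) simp
  qed
qed

lemma P0_sol_fsol:
  assumes sol: "P0_sol T u0 th0 u th" and T: "T > 0" and u0: "in_V u0" and th0: "in_Hs 3 th0"
    and M: "\<And>t. t \<in> {0..T} \<Longrightarrow> Hs_sq_v 3 (u t) \<le> M" "\<And>t. t \<in> {0..T} \<Longrightarrow> Hs_sq 3 (th t) \<le> M"
  shows "fsol 0 T (\<lambda>t. fcoef (c1 (u t))) (\<lambda>t. fcoef (c2 (u t))) (\<lambda>t. fcoef (th t))"
    "fcoef (c1 (u 0)) = fcoef (c1 u0)" "fcoef (c2 (u 0)) = fcoef (c2 u0)" "fcoef (th 0) = fcoef th0"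
    "\<And>t. t \<in> {0..T} \<Longrightarrow> hb 3 (fcoef (c1 (u t))) M" "\<And>t. t \<in> {0..T} \<Longrightarrow> hb 3 (fcoef (c2 (u t))) M"
    "\<And>t. t \<in> {0..T} \<Longrightarrow> hb 3 (fcoef (th t)) M"
proof -
  have V: "in_V (u t)" and Hv: "in_Hs_v 3 (u t)" and H: "in_Hs 3 (th t)" if "t \<in> {0..T}" for t
    using sol that unfolding P0_sol_def by blast+
  have cont: "cont_Hs_v 3 T u" "cont_Hs 3 T th" and weak: "weak_eq 0 T u0 th0 u th"
    using sol unfolding P0_sol_def by blast+
  have Hc: "in_Hs 3 (c1 (u t))" "in_Hs 3 (c2 (u t))" if "t \<in> {0..T}" for t
    using Hv[OF that] by (simp_all add: in_Hs_v_def)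
  have z: "fcoef (c1 (u t)) 0 = 0" "fcoef (c2 (u t)) 0 = 0" "fcoef (th t) 0 = 0" if "t \<in> {0..T}" for t
    using Hc[OF that] H[OF that] by (auto dest: in_HsD)
  have Hle: "Hs_sq 3 (c1 (u t)) \<le> M" "Hs_sq 3 (c2 (u t)) \<le> M" if "t \<in> {0..T}" for t
    using M(1)[OF that] Hs_sq_nonneg[of 3 "c1 (u t)"] Hs_sq_nonneg[of 3 "c2 (u t)"] by (simp_all add: Hs_sq_v_def)
  show b3: "hb 3 (fcoef (c1 (u t))) M" "hb 3 (fcoef (c2 (u t))) M" "hb 3 (fcoef (th t)) M" if t: "t \<in> {0..T}" for t
    using hb_le[OF hb_3_Hs[OF Hc(1)[OF t]] Hle(1)[OF t]] hb_le[OF hb_3_Hs[OF Hc(2)[OF t]] Hle(2)[OF t]] hb_le[OF hb_3_Hs[OF H[OF t]] M(2)[OF t]] by auto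
  have b: "hb 1 (fcoef (c1 (u t))) M" "hb 1 (fcoef (c2 (u t))) M" "hb 0 (fcoef (th t)) M" if t: "t \<in> {0..T}" for t
    using hb_mono[OF b3(1)[OF t] _ z(1)[OF t]] hb_mono[OF b3(2)[OF t] _ z(2)[OF t]] hb_mono[OF b3(3)[OF t] _ z(3)[OF t]] by auto
  have lim: "((\<lambda>r. Hs_sq_v 3 (\<lambda>x. u r x - u t x)) \<longlongrightarrow> 0) (at t within {0..T})"
    "((\<lambda>r. Hs_sq 3 (\<lambda>x. th r x - th t x)) \<longlongrightarrow> 0) (at t within {0..T})" if "t \<in> {0..T}" for t
    using cont that unfolding cont_Hs_v_def cont_Hs_def by blast+
  have cu: "continuous_on {0..T} (\<lambda>t. fcoef (c1 (u t)) k)" "continuous_on {0..T} (\<lambda>t. fcoef (c2 (u t)) k)" for k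
    by (rule continuous_on_coef[OF _ lim(1), where s = 3]; use z bsum_Hs_v_diff Hv in blast)+
  have ct: "continuous_on {0..T} (\<lambda>t. fcoef (th t) k)" for k
    by (rule continuous_on_coef[OF _ lim(2), where s = 3]; use z bsum_Hs_diff H in blast)
  show "fsol 0 T (\<lambda>t. fcoef (c1 (u t))) (\<lambda>t. fcoef (c2 (u t))) (\<lambda>t. fcoef (th t))"
    "fcoef (c1 (u 0)) = fcoef (c1 u0)" "fcoef (c2 (u 0)) = fcoef (c2 u0)" "fcoef (th 0) = fcoef th0"
    by (rule weak_eq_fsol[OF T weak V in_HsD(1)[OF H] in_HsD(2)[OF H] u0 in_HsD(1,2)[OF th0] b cu ct]; assumption)+
qed

text \<open>Poincare's inequality: off the zero mode \<open>kweight k\<close> is at least 1, so the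
  L^2 part of the kinetic energy is absorbed into the V norm.\<close>

lemma initial_energy_bound:
  assumes u: "in_Hs_v 1 u" "in_Hs_v 1 v" and th: "in_L2 f" "in_L2 g"
  shows "bsum (\<lambda>k. (1 + a\<^sup>2 * kweight k) * ((norm (fcoef (c1 u) k - fcoef (c1 v) k))\<^sup>2 + (norm (fcoef (c2 u) k - fcoef (c2 v) k))\<^sup>2)
       + (norm (fcoef f k - fcoef g k))\<^sup>2)
     ((1 + a\<^sup>2) * Vnorm_sq (\<lambda>x. u x - v x) + Int2 (\<lambda>x. (f x - g x)\<^sup>2))"
proof -
  let ?p = "\<lambda>k. fcoef (c1 u) k - fcoef (c1 v) k" and ?q = "\<lambda>k. fcoef (c2 u) k - fcoef (c2 v) k"
  have H: "in_Hs 1 (c1 u)" "in_Hs 1 (c2 u)" "in_Hs 1 (c1 v)" "in_Hs 1 (c2 v)" using u by (simp_all add: in_Hs_v_def)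
  have z: "?p 0 = 0" "?q 0 = 0" using H by (simp_all add: in_HsD)
  have "bsum (\<lambda>k. (norm (fcoef (\<lambda>x. f x - g x) k))\<^sup>2) (Int2 (\<lambda>x. (f x - g x)\<^sup>2))"
    unfolding bsum_def using Bessel[OF in_L2_diff[OF th]] by blast
  moreover have "fcoef (\<lambda>x. f x - g x) k = fcoef f k - fcoef g k" for k
    by (intro fcoef_diff in_L2_imp_integrable th)
  ultimately have b: "bsum (\<lambda>k. (norm (fcoef f k - fcoef g k))\<^sup>2) (Int2 (\<lambda>x. (f x - g x)\<^sup>2))" by simp
  show ?thesis
  proof (rule bsum_mono)
    show "bsum (\<lambda>k. (1 + a\<^sup>2) * (kweight k powr 1 * (norm (?p k))\<^sup>2 + kweight k powr 1 * (norm (?q k))\<^sup>2) + (norm (fcoef f k - fcoef g k))\<^sup>2)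
       ((1 + a\<^sup>2) * (Hs_sq 1 (\<lambda>x. c1 u x - c1 v x) + Hs_sq 1 (\<lambda>x. c2 u x - c2 v x)) + Int2 (\<lambda>x. (f x - g x)\<^sup>2))"
      by (intro bsum_add bsum_cmult bsum_Hs_diff H b) simp
    fix k
    have "(1 + a\<^sup>2 * kweight k) * ((norm (?p k))\<^sup>2 + (norm (?q k))\<^sup>2) \<le> (1 + a\<^sup>2) * kweight k * ((norm (?p k))\<^sup>2 + (norm (?q k))\<^sup>2)"
    proof (cases "k = 0")
      case False
      have "1 + a\<^sup>2 * kweight k \<le> (1 + a\<^sup>2) * kweight k" using kweight_ge_1[OF False] by (simp add: distrib_right)
      thus ?thesis by (intro mult_right_mono) auto
    qed (simp add: z)
    thus "(1 + a\<^sup>2 * kweight k) * ((norm (?p k))\<^sup>2 + (norm (?q k))\<^sup>2) + (norm (fcoef f k - fcoef g k))\<^sup>2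
      \<le> (1 + a\<^sup>2) * (kweight k powr 1 * (norm (?p k))\<^sup>2 + kweight k powr 1 * (norm (?q k))\<^sup>2) + (norm (fcoef f k - fcoef g k))\<^sup>2"
      by (simp add: kweight_nonneg algebra_simps)
  qed (simp add: Vnorm_sq_def Hs_sq_v_def c1_diff c2_diff)
qed

text \<open>The field is its difference from the Euler velocity plus that velocity. The first is
  controlled by the relative energy, the second by a fixed V bound that carries the small factor
  \<open>a\<^sup>2\<close>; the 4 is 2 from squaring a sum times two components.\<close>

lemma Vnorm_sq_le_energy:
  assumes a: "a > 0" and v: "in_Hs_v 1 v"
    and en: "bsum (\<lambda>k. (1 + a\<^sup>2 * kweight k) * ((norm (fcoef (c1 v) k - p k))\<^sup>2 + (norm (fcoef (c2 v) k - q k))\<^sup>2) + (norm (e k))\<^sup>2) R"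
    and pq: "bsum (\<lambda>k. kweight k * (norm (p k))\<^sup>2) M" "bsum (\<lambda>k. kweight k * (norm (q k))\<^sup>2) M"
  shows "a\<^sup>2 * Vnorm_sq v \<le> 2 * R + 4 * a\<^sup>2 * M"
proof -
  let ?f = "\<lambda>k. kweight k * (norm (fcoef (c1 v) k))\<^sup>2" and ?g = "\<lambda>k. kweight k * (norm (fcoef (c2 v) k))\<^sup>2"
  have H: "in_Hs 1 (c1 v)" "in_Hs 1 (c2 v)" using v by (simp_all add: in_Hs_v_def)
  have sm: "?f summable_on UNIV" "?g summable_on UNIV"
    using H by (simp_all add: in_Hs_def kweight_nonneg)
  have "Vnorm_sq v = infsum ?f UNIV + infsum ?g UNIV"
    by (simp add: Vnorm_sq_def Hs_sq_v_def Hs_sq_def kweight_nonneg)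
  also have "\<dots> = infsum (\<lambda>k. ?f k + ?g k) UNIV" by (rule infsum_add[OF sm, symmetric])
  also have "\<dots> \<le> (2 * R + 4 * a\<^sup>2 * M) / a\<^sup>2"
  proof (rule infsum_le_finite_sums[OF summable_on_add[OF sm]])
    fix F :: "(int \<times> int) set" assume F: "finite F"
    have "bsum (\<lambda>k. 2 * ((1 + a\<^sup>2 * kweight k) * ((norm (fcoef (c1 v) k - p k))\<^sup>2 + (norm (fcoef (c2 v) k - q k))\<^sup>2) + (norm (e k))\<^sup>2)
       + (2 * a\<^sup>2) * (kweight k * (norm (p k))\<^sup>2 + kweight k * (norm (q k))\<^sup>2)) (2 * R + (2 * a\<^sup>2) * (M + M))"
      by (intro bsum_add bsum_cmult en pq) auto
    hence "bsum (\<lambda>k. a\<^sup>2 * (?f k + ?g k)) (2 * R + 4 * a\<^sup>2 * M)"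
    proof (rule bsum_mono)
      fix k
      have split: "(norm x)\<^sup>2 \<le> 2 * (norm (x - y))\<^sup>2 + 2 * (norm y)\<^sup>2" for x y :: complex
        using norm_add_sq_le[of "x - y" y] by simp
      have "a\<^sup>2 * (?f k + ?g k) = a\<^sup>2 * kweight k * ((norm (fcoef (c1 v) k))\<^sup>2 + (norm (fcoef (c2 v) k))\<^sup>2)"
        by (simp add: algebra_simps)
      also have "\<dots> \<le> a\<^sup>2 * kweight k * ((2 * (norm (fcoef (c1 v) k - p k))\<^sup>2 + 2 * (norm (p k))\<^sup>2) + (2 * (norm (fcoef (c2 v) k - q k))\<^sup>2 + 2 * (norm (q k))\<^sup>2))"
        by (intro mult_left_mono add_mono split mult_nonneg_nonneg kweight_nonneg) simp
      also have "\<dots> \<le> 2 * ((1 + a\<^sup>2 * kweight k) * ((norm (fcoef (c1 v) k - p k))\<^sup>2 + (norm (fcoef (c2 v) k - q k))\<^sup>2) + (norm (e k))\<^sup>2)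
       + (2 * a\<^sup>2) * (kweight k * (norm (p k))\<^sup>2 + kweight k * (norm (q k))\<^sup>2)"
        by (simp add: algebra_simps)
      finally show "a\<^sup>2 * (?f k + ?g k) \<le> \<dots>" .
    qed simp
    from bsumD[OF this F] have "a\<^sup>2 * (\<Sum>k\<in>F. ?f k + ?g k) \<le> 2 * R + 4 * a\<^sup>2 * M" by (simp add: sum_distrib_left)
    thus "(\<Sum>k\<in>F. ?f k + ?g k) \<le> (2 * R + 4 * a\<^sup>2 * M) / a\<^sup>2" using a by (simp add: field_simps)
  qed
  finally show ?thesis using a by (simp add: field_simps)
qed

theorem theorem5p6:
  fixes u0 :: "real \<times> real \<Rightarrow> real \<times> real" and th0 :: "real \<times> real \<Rightarrow> real"
    and u0a :: "real \<Rightarrow> real \<times> real \<Rightarrow> real \<times> real" and th0a :: "real \<Rightarrow> real \<times> real \<Rightarrow> real"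
    and ua :: "real \<Rightarrow> real \<Rightarrow> real \<times> real \<Rightarrow> real \<times> real"
    and tha :: "real \<Rightarrow> real \<Rightarrow> real \<times> real \<Rightarrow> real"
    and Ts :: real
  assumes u0_reg: "in_Hs_v 3 u0 \<and> in_V u0" and th0_reg: "in_Hs 3 th0"
    and u0a_reg: "\<And>\<alpha>. \<alpha> > 0 \<Longrightarrow> in_Hs_v 3 (u0a \<alpha>) \<and> in_V (u0a \<alpha>)"
    and th0a_reg: "\<And>\<alpha>. \<alpha> > 0 \<Longrightarrow> in_Hs 3 (th0a \<alpha>)"
    and u0a_conv: "((\<lambda>\<alpha>. Vnorm_sq (\<lambda>x. u0a \<alpha> x - u0 x)) \<longlongrightarrow> 0) (at_right 0)"
    and th0a_conv: "((\<lambda>\<alpha>. Int2 (\<lambda>x. (th0a \<alpha> x - th0 x)\<^sup>2)) \<longlongrightarrow> 0) (at_right 0)"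
    and alpha_sol: "\<And>\<alpha> T. \<alpha> > 0 \<Longrightarrow> T > 0 \<Longrightarrow>
                      Palpha_sol \<alpha> T (u0a \<alpha>) (th0a \<alpha>) (ua \<alpha>) (tha \<alpha>)"
    and gap: "(SUP t\<in>{0..<Ts}. Limsup (at_right 0) (\<lambda>\<alpha>. ereal (\<alpha>\<^sup>2 * Vnorm_sq (ua \<alpha> t)))) > 0"
  shows "\<not> (\<exists>u th. (\<forall>T. 0 \<le> T \<and> T < Ts \<longrightarrow> P0_sol T u0 th0 u th)
              \<and> (\<exists>M. \<forall>t\<in>{0..<Ts}. Hs_sq_v 3 (u t) \<le> M \<and> Hs_sq 3 (th t) \<le> M))"
proof
  assume "\<exists>u th. (\<forall>T. 0 \<le> T \<and> T < Ts \<longrightarrow> P0_sol T u0 th0 u th)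
              \<and> (\<exists>M. \<forall>t\<in>{0..<Ts}. Hs_sq_v 3 (u t) \<le> M \<and> Hs_sq 3 (th t) \<le> M)"
  then obtain u th M where P0: "\<And>T. 0 \<le> T \<Longrightarrow> T < Ts \<Longrightarrow> P0_sol T u0 th0 u th"
    and M: "\<And>t. t \<in> {0..<Ts} \<Longrightarrow> Hs_sq_v 3 (u t) \<le> M" "\<And>t. t \<in> {0..<Ts} \<Longrightarrow> Hs_sq 3 (th t) \<le> M"
    by blast
  obtain t where t: "t \<in> {0..<Ts}" and pos: "0 < Limsup (at_right 0) (\<lambda>\<alpha>. ereal (\<alpha>\<^sup>2 * Vnorm_sq (ua \<alpha> t)))"
    using gap unfolding less_SUP_iff by blast
  \<comment> \<open>The midpoint is positive even if t = 0 and still below Ts, so the Euler solution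
    exists on the closed interval [0, T] and is bounded there by the same M.\<close>
  define T where "T = (t + Ts) / 2"
  have T: "0 < T" "T < Ts" and tT: "t \<in> {0..T}" using t by (auto simp: T_def)
  have sol0: "P0_sol T u0 th0 u th" using P0 T by simp
  have MT: "Hs_sq_v 3 (u s) \<le> M" "Hs_sq 3 (th s) \<le> M" if "s \<in> {0..T}" for s
    using M that T by auto
  have F0: "fsol 0 T (\<lambda>t. fcoef (c1 (u t))) (\<lambda>t. fcoef (c2 (u t))) (\<lambda>t. fcoef (th t))"
    "fcoef (c1 (u 0)) = fcoef (c1 u0)" "fcoef (c2 (u 0)) = fcoef (c2 u0)" "fcoef (th 0) = fcoef th0"
    using P0_sol_fsol[OF sol0 T(1) conjunct2[OF u0_reg] th0_reg MT] by blast+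
  have b3: "hb 3 (fcoef (c1 (u s))) M" "hb 3 (fcoef (c2 (u s))) M" "hb 3 (fcoef (th s)) M" if "s \<in> {0..T}" for s
    using P0_sol_fsol[OF sol0 T(1) conjunct2[OF u0_reg] th0_reg MT] that by blast+
  define K where "K = exp ((10 * pi * sqrt (lat3 * M) + 2) * t)"
  \<comment> \<open>The bound of the relative energy at time t. It depends on \<alpha> only through
    the initial discrepancy and explicit factors \<alpha>^2, because M and K belong to the Euler
    solution; hence it tends to 0.\<close>
  define R where "R \<alpha> = (((1 + \<alpha>\<^sup>2) * Vnorm_sq (\<lambda>x. u0a \<alpha> x - u0 x) + Int2 (\<lambda>x. (th0a \<alpha> x - th0 x)\<^sup>2))
      + \<alpha>\<^sup>2 * forcing_const M * t) * K" for \<alpha>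
  have bound: "\<alpha>\<^sup>2 * Vnorm_sq (ua \<alpha> t) \<le> 2 * R \<alpha> + 4 * \<alpha>\<^sup>2 * M" if \<alpha>: "\<alpha> > 0" for \<alpha>
  proof -
    obtain B where B: "fsol \<alpha> T (\<lambda>t. fcoef (c1 (ua \<alpha> t))) (\<lambda>t. fcoef (c2 (ua \<alpha> t))) (\<lambda>t. fcoef (tha \<alpha> t))"
      "fcoef (c1 (ua \<alpha> 0)) = fcoef (c1 (u0a \<alpha>))" "fcoef (c2 (ua \<alpha> 0)) = fcoef (c2 (u0a \<alpha>))" "fcoef (tha \<alpha> 0) = fcoef (th0a \<alpha>)"
      "\<And>t. t \<in> {0..T} \<Longrightarrow> hb 2 (fcoef (c1 (ua \<alpha> t))) B" "\<And>t. t \<in> {0..T} \<Longrightarrow> hb 2 (fcoef (c2 (ua \<alpha> t))) B"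
      "\<And>t. t \<in> {0..T} \<Longrightarrow> hb 0 (fcoef (tha \<alpha> t)) B"
      using Palpha_sol_fsol[OF alpha_sol[OF \<alpha> T(1)] T(1) \<alpha> conjunct1[OF u0a_reg[OF \<alpha>]] conjunct2[OF u0a_reg[OF \<alpha>]] th0a_reg[OF \<alpha>]]
      by blast
    have Va: "in_Hs_v 1 (u0a \<alpha>)" "in_Hs_v 1 u0" using u0a_reg[OF \<alpha>] u0_reg by (simp_all add: in_V_def)
    have "bsum (\<lambda>k. (1 + \<alpha>\<^sup>2 * kweight k) * ((norm (fcoef (c1 (ua \<alpha> t)) k - fcoef (c1 (u t)) k))\<^sup>2
        + (norm (fcoef (c2 (ua \<alpha> t)) k - fcoef (c2 (u t)) k))\<^sup>2) + (norm (fcoef (tha \<alpha> t) k - fcoef (th t) k))\<^sup>2) (R \<alpha>)"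
      unfolding R_def K_def
    proof (rule relative_energy_estimate[OF B(1) F0(1) \<alpha> B(5,6,7) b3 _ tT])
      show "bsum (\<lambda>k. (1 + \<alpha>\<^sup>2 * kweight k) * ((norm (fcoef (c1 (ua \<alpha> 0)) k - fcoef (c1 (u 0)) k))\<^sup>2
        + (norm (fcoef (c2 (ua \<alpha> 0)) k - fcoef (c2 (u 0)) k))\<^sup>2) + (norm (fcoef (tha \<alpha> 0) k - fcoef (th 0) k))\<^sup>2)
        ((1 + \<alpha>\<^sup>2) * Vnorm_sq (\<lambda>x. u0a \<alpha> x - u0 x) + Int2 (\<lambda>x. (th0a \<alpha> x - th0 x)\<^sup>2))"
        unfolding B(2,3,4) F0(2,3,4)
        by (rule initial_energy_bound[OF Va in_HsD(1)[OF th0a_reg[OF \<alpha>]] in_HsD(1)[OF th0_reg]])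
    qed
    moreover have "in_Hs_v 1 (ua \<alpha> t)"
      using alpha_sol[OF \<alpha> T(1)] tT unfolding Palpha_sol_def in_V_def by blast
    moreover have "bsum (\<lambda>k. kweight k * (norm (fcoef (c1 (u t)) k))\<^sup>2) M" "bsum (\<lambda>k. kweight k * (norm (fcoef (c2 (u t)) k))\<^sup>2) M"
    proof -
      have H: "in_Hs 3 (c1 (u t))" "in_Hs 3 (c2 (u t))"
        using sol0 tT unfolding P0_sol_def in_Hs_v_def by blast+
      have le: "Hs_sq 3 (c1 (u t)) \<le> M" "Hs_sq 3 (c2 (u t)) \<le> M"
        using MT(1)[OF tT] Hs_sq_nonneg[of 3 "c1 (u t)"] Hs_sq_nonneg[of 3 "c2 (u t)"] by (simp_all add: Hs_sq_v_def)
      show "bsum (\<lambda>k. kweight k * (norm (fcoef (c1 (u t)) k))\<^sup>2) M"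
        by (rule bsum_mono[OF bsum_kweight_3_1[OF in_HsD(3)[OF H(1)]] order_refl le(1)])
      show "bsum (\<lambda>k. kweight k * (norm (fcoef (c2 (u t)) k))\<^sup>2) M"
        by (rule bsum_mono[OF bsum_kweight_3_1[OF in_HsD(3)[OF H(2)]] order_refl le(2)])
    qed
    ultimately show ?thesis using \<alpha> by (intro Vnorm_sq_le_energy)
  qed
  have a0: "((\<lambda>\<alpha>::real. \<alpha>) \<longlongrightarrow> 0) (at_right 0)" by (rule tendsto_ident_at)
  have "((\<lambda>\<alpha>. 2 * R \<alpha> + 4 * \<alpha>\<^sup>2 * M) \<longlongrightarrow> 2 * ((((1 + 0\<^sup>2) * 0 + 0) + 0\<^sup>2 * forcing_const M * t) * K) + 4 * 0\<^sup>2 * M) (at_right 0)"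
    unfolding R_def by (intro tendsto_intros u0a_conv th0a_conv a0)
  hence lim: "((\<lambda>\<alpha>. 2 * R \<alpha> + 4 * \<alpha>\<^sup>2 * M) \<longlongrightarrow> 0) (at_right 0)" by simp
  have upper: "\<forall>\<^sub>F \<alpha> in at_right 0. \<alpha>\<^sup>2 * Vnorm_sq (ua \<alpha> t) \<le> 2 * R \<alpha> + 4 * \<alpha>\<^sup>2 * M"
    using eventually_at_right_less[of "0::real"] by eventually_elim (rule bound)
  have lower: "\<forall>\<^sub>F \<alpha> in at_right 0. 0 \<le> \<alpha>\<^sup>2 * Vnorm_sq (ua \<alpha> t)"
    by (intro always_eventually allI mult_nonneg_nonneg) (simp_all add: Vnorm_sq_def Hs_sq_v_def Hs_sq_nonneg)
  have "((\<lambda>\<alpha>. \<alpha>\<^sup>2 * Vnorm_sq (ua \<alpha> t)) \<longlongrightarrow> 0) (at_right 0)"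
    by (rule tendsto_sandwich[OF lower upper tendsto_const lim])
  hence "((\<lambda>\<alpha>. ereal (\<alpha>\<^sup>2 * Vnorm_sq (ua \<alpha> t))) \<longlongrightarrow> ereal 0) (at_right 0)" by simp
  hence "Limsup (at_right 0) (\<lambda>\<alpha>. ereal (\<alpha>\<^sup>2 * Vnorm_sq (ua \<alpha> t))) = ereal 0"
    by (intro lim_imp_Limsup) simp_all
  thus False using pos by simp
qed

end
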